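(* Let $|q|<1$. Then \begin{align*} \sum_{i,j\geq 0}\frac{q^{i^2+2j^2-2ij}}{(q^4;q^4)_i(q^4;q^4)_j}&=\frac{J_4^3J_{56}J_{6,28}}{J_2^2 J_8 J_{8,56}J_{24,56}}+2q\frac{J_8J_{56}J_{8,56}}{J_4^2J_{4,56}},\\ \sum_{i,j\geq 0}\frac{q^{i^2+2j^2-2ij+2i-2j}}{(q^4;q^4)_i(q^4;q^4)_j}&= 2\frac{J_8J_{56}J_{24,56}}{J_4^2J_{12,56}}+q\frac{J_4^3J_{28}J_{10,56}J_{18,56}}{J_2^2J_8J_{56}J_{16,56}J_{24,56}},\\ \sum_{i,j\geq 0}\frac{q^{i^2+2j^2-2ij+2i}}{(q^4;q^4)_i (q^4;q^4)_j}&=\frac{J_4^3J_{28}J_{2,56}J_{26,56}}{J_2^2J_8J_{56}J_{8,56}J_{16,56}}+2q^3\frac{J_8J_{56}J_{16,56}}{J_4^2J_{20,56}}. \end{align*} As a consequence, with $A=\begin{pmatrix}1/2&-1/2\\-1/2&1\end{pmatrix}$ and $(B,C)\in\{((0,0)^{\mathrm T},-5/84),\ ((1/2,-1/2)^{\mathrm T},1/21),\ ((1/2,0)^{\mathrm T},1/84)\}$, the function $\tau\mapsto f_{A,B,C}(q^{84})$ (with $q=e^{2\pi i\tau}$) is a modular function on $\Gamma_1(7056)$.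
   Context: Notation: $(a;q)_n=\prod_{k=0}^{n-1}(1-aq^k)$, $(a;q)_\infty=\prod_{k\ge0}(1-aq^k)$, $(a_1,\dots,a_m;q)_n=(a_1;q)_n\cdots(a_m;q)_n$; $J_m=(q^m;q^m)_\infty$ and $J_{a,m}=(q^a,q^{m-a},q^m;q^m)_\infty$. Fractional powers $q^{x}$ mean $e^{2\pi i x\tau}$ where $q=e^{2\pi i\tau}$, $\tau$ in the upper half-plane. For a positive definite symmetric rational $2\times2$ matrix $A$, a rational vector $B$ and rational scalar $C$, the Nahm sum is $f_{A,B,C}(q)=\sum_{n=(n_1,n_2)^{\mathrm T}\in\mathbb{Z}_{\ge0}^2}\frac{q^{\frac12 n^{\mathrm T}An+n^{\mathrm T}B+C}}{(q;q)_{n_1}(q;q)_{n_2}}$. $\Gamma_1(N)=\{\gamma\in\mathrm{SL}_2(\mathbb Z):\gamma\equiv\begin{pmatrix}1&*\\0&1\end{pmatrix}\pmod N\}$. *)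

theory Defs
  imports "HOL-Complex_Analysis.Complex_Analysis" "HOL-Number_Theory.Cong"
begin

definition qpoch :: "complex \<Rightarrow> complex \<Rightarrow> nat \<Rightarrow> complex" where
  "qpoch a q n = (\<Prod>k<n. 1 - a * q ^ k)"

definition qpoch_inf :: "complex \<Rightarrow> complex \<Rightarrow> complex" where
  "qpoch_inf a q = (\<Prod>k. 1 - a * q ^ k)"

definition J :: "nat \<Rightarrow> complex \<Rightarrow> complex" where
  "J m q = qpoch_inf (q ^ m) (q ^ m)"

text \<open>\<open>JJ a m q\<close> is $J_{a,m} = (q^a, q^{m-a}, q^m; q^m)_\infty$; the subtraction is on naturals,
  so it is meant for \<open>a \<le> m\<close> only.\<close>

definition JJ :: "nat \<Rightarrow> nat \<Rightarrow> complex \<Rightarrow> complex" where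
  "JJ a m q = qpoch_inf (q ^ a) (q ^ m) * qpoch_inf (q ^ (m - a)) (q ^ m) * qpoch_inf (q ^ m) (q ^ m)"

text \<open>The power $q^x$ with rational exponent, where $q = e^{2\pi i\tau}$. It depends on \<open>\<tau>\<close>,
  not only on $q$; accordingly a function of $q$ involving such powers is a function of \<open>\<tau>\<close>,
  and replacing $q$ by $q^{84}$ means replacing \<open>\<tau>\<close> by \<open>84 * \<tau>\<close>.\<close>

definition qpow :: "rat \<Rightarrow> complex \<Rightarrow> complex" where
  "qpow x \<tau> = exp (2 * of_real pi * \<i> * of_rat x * \<tau>)"

definition nahm_exponent :: "rat^2^2 \<Rightarrow> rat^2 \<Rightarrow> rat \<Rightarrow> rat^2 \<Rightarrow> rat" where
  "nahm_exponent A B C n =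
     1/2 * (\<Sum>i\<in>UNIV. n $ i * (A *v n) $ i) + (\<Sum>i\<in>UNIV. n $ i * B $ i) + C"

definition nahm_sum :: "rat^2^2 \<Rightarrow> rat^2 \<Rightarrow> rat \<Rightarrow> complex \<Rightarrow> complex" where
  "nahm_sum A B C \<tau> =
     (\<Sum>\<^sub>\<infinity>(n1, n2) \<in> (UNIV :: (nat \<times> nat) set).
        qpow (nahm_exponent A B C (vector [of_nat n1, of_nat n2])) \<tau> /
        (qpoch (qpow 1 \<tau>) (qpow 1 \<tau>) n1 * qpoch (qpow 1 \<tau>) (qpow 1 \<tau>) n2))"

definition SL2Z :: "(int^2^2) set" where
  "SL2Z = {\<gamma>. det \<gamma> = 1}"

definition Gamma1 :: "nat \<Rightarrow> (int^2^2) set" where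
  "Gamma1 N = {\<gamma> \<in> SL2Z. [\<gamma> $ 1 $ 1 = 1] (mod int N) \<and>
     [\<gamma> $ 2 $ 1 = 0] (mod int N) \<and> [\<gamma> $ 2 $ 2 = 1] (mod int N)}"

definition moebius_act :: "int^2^2 \<Rightarrow> complex \<Rightarrow> complex" where
  "moebius_act \<gamma> \<tau> = (of_int (\<gamma> $ 1 $ 1) * \<tau> + of_int (\<gamma> $ 1 $ 2)) /
                     (of_int (\<gamma> $ 2 $ 1) * \<tau> + of_int (\<gamma> $ 2 $ 2))"

text \<open>Meromorphy at the cusp $\gamma(i\infty)$: near $i\infty$, \<open>f \<circ> \<gamma>\<close> is given by
  a Laurent series with finite principal part in $e^{2\pi i\tau/h}$ for some \<open>h > 0\<close>.\<close>

definition meromorphic_at_cusp :: "(complex \<Rightarrow> complex) \<Rightarrow> int^2^2 \<Rightarrow> bool" where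
  "meromorphic_at_cusp f \<gamma> \<longleftrightarrow>
     (\<exists>h::nat. h > 0 \<and> (\<exists>g Y. g meromorphic_on {0} \<and>
        (\<forall>\<tau>. Im \<tau> > Y \<longrightarrow> f (moebius_act \<gamma> \<tau>) = g (qpow (1 / of_nat h) \<tau>))))"

text \<open>\<open>nicely_meromorphic_on\<close> fixes the value of \<open>f\<close> at removable singularities and poles,
  so that invariance can be required at every point of the upper half-plane.\<close>

definition modular_function :: "(int^2^2) set \<Rightarrow> (complex \<Rightarrow> complex) \<Rightarrow> bool" where
  "modular_function G f \<longleftrightarrow>
     f nicely_meromorphic_on {\<tau>. Im \<tau> > 0} \<and>
     (\<forall>\<gamma>\<in>G. \<forall>\<tau>. Im \<tau> > 0 \<longrightarrow> f (moebius_act \<gamma> \<tau>) = f \<tau>) \<and>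
     (\<forall>\<gamma>\<in>SL2Z. meromorphic_at_cusp f \<gamma>)"

end

(*
Summing over j by Euler's identity and splitting i by parity turns each double sum into two
Slater type single sums modulo 28. These come from four Bailey pairs whose beta's satisfy
q-Pascal recurrences, combined with the 1phi1 summation and the quintuple product identity.

For the modularity, every theta product J_{a,m} / J_m^3 is a Klein form, that is, the theta
function divided by eta^3 with z in a torsion class. Its behaviour under SL_2(Z) follows from
Liouville's theorem, without a transformation law for eta. The remaining eta powers are products
of Klein forms at 2- and 3-torsion points. Hence each summand is a product of Klein forms of total
weight 0, invariant under the matrices congruent to I modulo 7056, and having period 1 it is
invariant under Gamma_1(7056). It is meromorphic at the cusps because diag(m, 1) gamma is the
product of an element of SL_2(Z) and an upper triangular matrix.
*)

theory Submission
  imports Defs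
begin

section \<open>Infinite products\<close>

text \<open>The sum over \<open>j\<close> leaves the product
  \<open>(-q^(2+b2-2i); q^4)_\<infinity>\<close> with even \<open>b2\<close>. Its exponent modulo 4
  depends only on the parity of \<open>i\<close>; stepping through multiples of \<open>q^4\<close>
  leads to \<open>(-q^2; q^4)_\<infinity>\<close> or \<open>(-q^4; q^4)_\<infinity>\<close>, times a
  finite product that becomes the numerator of a single sum. These sums follow from Bailey's lemma
  with one parameter sent to infinity. The pairs are written as sums over all integers, so index 0
  plays no special part and series can be reindexed freely. The Nahm sum at \<open>84 \<tau>\<close>
  has nome \<open>q^4\<close> with \<open>q = e^(2 pi i 21 \<tau>)\<close>, so a theta product of
  modulus \<open>m\<close> lives at \<open>21 m \<tau>\<close>. The level \<open>7056 = 84^2\<close>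
  is divisible by \<open>21 m\<close> for all moduli that occur, 14, 28, 56, 112 and 168, with even
  \<open>7056 / m\<close>. The obstacle is the multiplier of eta: a single \<open>J m\<close>
  transforms with roots of unity that are awkward to track. A Klein form picks up only an explicit
  root of unity, which is trivial modulo the level. So each summand is rebuilt exactly from Klein
  forms, including its leading power of the nome; the balance of these powers confirms the values of
  \<open>C\<close>.\<close>

lemma abs_convergent_qpoch:
  fixes a q :: complex
  assumes "norm q < 1"
  shows "abs_convergent_prod (\<lambda>k. 1 - a * q ^ k)"
proof -
  have "summable (\<lambda>k. norm a * norm q ^ k)"
    using assms by (intro summable_mult summable_geometric) auto
  then show ?thesis
    by (intro summable_imp_abs_convergent_prod) (simp add: norm_mult norm_power)
qed

lemma qpoch_inf_has_prod:
  assumes "norm q < 1"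
  shows "(\<lambda>k. 1 - a * q ^ k) has_prod qpoch_inf a q"
  unfolding qpoch_inf_def using abs_convergent_qpoch[OF assms]
  by (intro convergent_prod_has_prod abs_convergent_prod_imp_convergent_prod)

lemma qpoch_LIMSEQ:
  assumes "norm q < 1"
  shows "(\<lambda>n. qpoch a q n) \<longlonglongrightarrow> qpoch_inf a q"
  using has_prod_imp_tendsto'[OF qpoch_inf_has_prod[OF assms]] by (simp add: qpoch_def)

lemma qpoch_inf_eqI:
  assumes "norm q < 1" "(\<lambda>n. qpoch a q n) \<longlonglongrightarrow> L"
  shows "qpoch_inf a q = L"
  using LIMSEQ_unique[OF qpoch_LIMSEQ[OF assms(1)] assms(2)] .

lemma qpoch_0 [simp]: "qpoch a q 0 = 1"
  by (simp add: qpoch_def)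

lemma qpoch_Suc: "qpoch a q (Suc n) = qpoch a q n * (1 - a * q ^ n)"
  by (simp add: qpoch_def)

lemma qpoch_Suc': "qpoch a q (Suc n) = (1 - a) * qpoch (a * q) q n"
  unfolding qpoch_def by (simp add: prod.lessThan_Suc_shift mult_ac del: prod.lessThan_Suc)

lemma qpoch_add: "qpoch a q (m + n) = qpoch a q m * qpoch (a * q ^ m) q n"
  by (induction n) (simp_all add: qpoch_Suc power_add mult_ac)

lemma qpoch_inf_split:
  assumes "norm q < 1"
  shows "qpoch_inf a q = qpoch a q n * qpoch_inf (a * q ^ n) q"
proof (rule qpoch_inf_eqI[OF assms])
  have "(\<lambda>k. qpoch a q n * qpoch (a * q ^ n) q k) \<longlonglongrightarrow> qpoch a q n * qpoch_inf (a * q ^ n) q"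
    by (intro tendsto_mult tendsto_const qpoch_LIMSEQ assms)
  then have "(\<lambda>k. qpoch a q (k + n)) \<longlonglongrightarrow> qpoch a q n * qpoch_inf (a * q ^ n) q"
    by (simp add: qpoch_add[symmetric] add.commute)
  then show "(\<lambda>k. qpoch a q k) \<longlonglongrightarrow> qpoch a q n * qpoch_inf (a * q ^ n) q"
    by (rule LIMSEQ_offset)
qed

lemma qpoch_inf_rec:
  assumes "norm q < 1"
  shows "qpoch_inf a q = (1 - a) * qpoch_inf (a * q) q"
  using qpoch_inf_split[OF assms, of a 1] by (simp add: qpoch_def)

lemma qpoch_inf_eq_0_iff:
  assumes "norm q < 1"
  shows "qpoch_inf a q = 0 \<longleftrightarrow> (\<exists>k. a * q ^ k = 1)"
  using has_prod_eq_0_iff[OF qpoch_inf_has_prod[OF assms, of a]]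
  by (auto simp: image_iff)

lemma norm_mult_power_less_1:
  fixes a q :: complex
  assumes "norm q < 1" "norm a < 1"
  shows "norm (a * q ^ k) < 1"
proof -
  have "norm q ^ k \<le> 1"
    using assms by (intro power_le_one) auto
  then have "norm a * norm q ^ k \<le> norm a * 1"
    by (intro mult_left_mono) auto
  then show ?thesis
    using assms by (simp add: norm_mult norm_power)
qed

lemma qpoch_inf_nonzero:
  assumes "norm q < 1" "norm a < 1"
  shows "qpoch_inf a q \<noteq> 0"
proof
  assume "qpoch_inf a q = 0"
  then obtain k where "a * q ^ k = 1"
    using assms qpoch_inf_eq_0_iff by blast
  then show False
    using norm_mult_power_less_1[OF assms, of k] by simp
qed

lemma qpoch_nonzero:
  assumes "norm q < 1" "norm a < 1"
  shows "qpoch a q n \<noteq> 0"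
proof
  assume "qpoch a q n = 0"
  then obtain k where "a * q ^ k = 1"
    by (auto simp: qpoch_def)
  then show False
    using norm_mult_power_less_1[OF assms, of k] by simp
qed

lemma norm_power_less_1:
  fixes q :: complex
  assumes "norm q < 1" "m > 0"
  shows "norm (q ^ m) < 1"
  using assms by (simp add: norm_power power_less_one_iff)

lemma qpoch_inf_0 [simp]: "qpoch_inf 0 q = 1"
  by (simp add: qpoch_inf_def)

text \<open>The factors are sorted by the residue of the exponent modulo \<open>m\<close>.\<close>

lemma qpoch_dissect:
  "qpoch a q (m * n) = (\<Prod>i<m. qpoch (a * q ^ i) (q ^ m) n)"
proof (induction n)
  case (Suc n)
  have "qpoch (a * q ^ (m * n)) q m = (\<Prod>i<m. 1 - a * q ^ i * (q ^ m) ^ n)"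
    by (simp add: qpoch_def power_mult mult_ac)
  then show ?case
    by (simp add: qpoch_Suc qpoch_add add.commute[of m] Suc prod.distrib)
qed (simp add: qpoch_def)

lemma qpoch_inf_dissect:
  assumes "norm q < 1" "m > 0"
  shows "qpoch_inf a q = (\<Prod>i<m. qpoch_inf (a * q ^ i) (q ^ m))"
proof -
  have "(\<lambda>n. \<Prod>i<m. qpoch (a * q ^ i) (q ^ m) n) \<longlonglongrightarrow> (\<Prod>i<m. qpoch_inf (a * q ^ i) (q ^ m))"
    by (intro tendsto_prod qpoch_LIMSEQ norm_power_less_1 assms)
  moreover have "(\<lambda>n. qpoch a q (m * n)) \<longlonglongrightarrow> qpoch_inf a q"
  proof (rule filterlim_compose[OF qpoch_LIMSEQ[OF assms(1)]])
    show "filterlim ((*) m) sequentially sequentially"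
      using assms by (simp add: mult_nat_left_at_top)
  qed
  ultimately show ?thesis
    using LIMSEQ_unique by (simp add: qpoch_dissect)
qed

lemma qpoch_minus: "qpoch a q n * qpoch (- a) q n = qpoch (a\<^sup>2) (q\<^sup>2) n"
  by (simp add: qpoch_def prod.distrib[symmetric])
     (intro prod.cong refl, simp add: power_mult[symmetric] algebra_simps power2_eq_square power_mult_distrib)

lemma qpoch_inf_minus:
  assumes "norm q < 1"
  shows "qpoch_inf a q * qpoch_inf (- a) q = qpoch_inf (a\<^sup>2) (q\<^sup>2)"
proof -
  have "(\<lambda>n. qpoch a q n * qpoch (- a) q n) \<longlonglongrightarrow> qpoch_inf a q * qpoch_inf (- a) q"
    by (intro tendsto_mult qpoch_LIMSEQ assms)
  then show ?thesis
    using qpoch_inf_eqI[of "q\<^sup>2" "a\<^sup>2"] norm_power_less_1[OF assms, of 2] by (simp add: qpoch_minus)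
qed

lemma norm_prod_le_power:
  fixes f :: "'a \<Rightarrow> complex"
  assumes "\<And>k. k \<in> A \<Longrightarrow> norm (f k) \<le> c"
  shows "norm (prod f A) \<le> c ^ card A"
proof -
  have "norm (prod f A) \<le> (\<Prod>k\<in>A. norm (f k))" by (simp add: prod_norm)
  also have "\<dots> \<le> (\<Prod>k\<in>A. c)" by (rule prod_mono) (use assms in auto)
  finally show ?thesis by simp
qed

lemma bounded_inverse_qpoch:
  assumes "norm q < 1" "norm a < 1"
  obtains C where "C > 0" "\<And>n. norm (inverse (qpoch a q n)) \<le> C"
proof -
  have "(\<lambda>n. inverse (qpoch a q n)) \<longlonglongrightarrow> inverse (qpoch_inf a q)"
    by (intro tendsto_inverse qpoch_LIMSEQ qpoch_inf_nonzero assms)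
  then have "Bseq (\<lambda>n. inverse (qpoch a q n))"
    by (intro convergent_imp_Bseq convergentI)
  then show ?thesis
    using that by (auto simp: Bseq_def)
qed

lemma bounded_qpoch:
  assumes "norm q < 1"
  obtains C where "C > 0" "\<And>n. norm (qpoch a q n) \<le> C"
proof -
  have "Bseq (\<lambda>n. qpoch a q n)"
    using qpoch_LIMSEQ[OF assms] by (intro convergent_imp_Bseq convergentI)
  then show ?thesis
    using that by (auto simp: Bseq_def)
qed

text \<open>On a closed ball inside \<open>A\<close>, compactness gives
  \<open>norm (g z) \<le> r < 1\<close> and \<open>norm (f z) \<le> M\<close>, so the factors differ
  from 1 by at most \<open>M * r ^ n\<close> and the finite products converge uniformly. The base
  may vary as well, as it does for functions of \<tau>.\<close>

lemma holomorphic_on_qpoch_inf [holomorphic_intros]: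
  assumes f: "f holomorphic_on A" and g: "g holomorphic_on A" and A: "open A"
    and less: "\<And>z. z \<in> A \<Longrightarrow> norm (g z) < 1"
  shows "(\<lambda>z. qpoch_inf (f z) (g z)) holomorphic_on A"
proof (rule holomorphic_uniform_sequence[OF A, of "\<lambda>n z. qpoch (f z) (g z) n"])
  show "(\<lambda>z. qpoch (f z) (g z) n) holomorphic_on A" for n
    unfolding qpoch_def by (intro holomorphic_intros f g)
next
  fix x assume "x \<in> A"
  then obtain d where d: "d > 0" "cball x d \<subseteq> A"
    using A open_contains_cball by blast
  have cf: "continuous_on (cball x d) f" and cg: "continuous_on (cball x d) g"
    using d f g by (meson holomorphic_on_imp_continuous_on holomorphic_on_subset)+
  obtain M where M: "\<And>z. z \<in> cball x d \<Longrightarrow> norm (f z) \<le> M"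
    using compact_imp_bounded[OF compact_continuous_image[OF cf]] by (force simp: bounded_iff)
  obtain r where r: "r < 1" "r \<ge> 0" "\<And>z. z \<in> cball x d \<Longrightarrow> norm (g z) \<le> r"
  proof -
    have "cball x d \<noteq> {}" using d by auto
    then obtain y where "y \<in> cball x d" "\<And>z. z \<in> cball x d \<Longrightarrow> norm (g z) \<le> norm (g y)"
      using continuous_attains_sup[of "cball x d" "\<lambda>z. norm (g z)"] cg
      by (fastforce intro: continuous_intros)
    then show ?thesis using that[of "norm (g y)"] less d by (meson norm_ge_zero subsetD)
  qed
  have "uniformly_convergent_on (cball x d) (\<lambda>N z. \<Prod>n<N. 1 - f z * g z ^ n)"
  proof (rule uniformly_convergent_on_prod')
    show "uniformly_convergent_on (cball x d) (\<lambda>N z. \<Sum>n<N. norm (1 - f z * g z ^ n - 1))"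
    proof (rule Weierstrass_m_test')
      show "norm (norm (1 - f z * g z ^ n - 1)) \<le> M * r ^ n" if "z \<in> cball x d" for n z
      proof -
        have "0 \<le> M" using M[OF that] norm_ge_zero order_trans by blast
        then have "norm (f z) * norm (g z) ^ n \<le> M * r ^ n"
          using M[OF that] r(3)[OF that] by (intro mult_mono power_mono) auto
        then show ?thesis by (simp add: norm_mult norm_power)
      qed
      show "summable (\<lambda>n. M * r ^ n)"
        using r by (intro summable_mult summable_geometric) auto
    qed
  qed (auto intro!: continuous_intros cf cg)
  then obtain l where l: "uniform_limit (cball x d) (\<lambda>N z. qpoch (f z) (g z) N) l sequentially"
    by (auto simp: uniformly_convergent_on_def qpoch_def)
  have "l z = qpoch_inf (f z) (g z)" if "z \<in> cball x d" for z
    using tendsto_uniform_limitI[OF l that] qpoch_inf_eqI[of "g z" "f z"] less d that by auto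
  then have "uniform_limit (cball x d) (\<lambda>N z. qpoch (f z) (g z) N) (\<lambda>z. qpoch_inf (f z) (g z)) sequentially"
    using uniform_limit_cong'[OF _ _ , of "cball x d"] l by (metis (no_types, lifting))
  then show "\<exists>d>0. cball x d \<subseteq> A \<and>
      uniform_limit (cball x d) (\<lambda>n z. qpoch (f z) (g z) n) (\<lambda>z. qpoch_inf (f z) (g z)) sequentially"
    using d by blast
qed

section \<open>Euler's two series and the 1phi1 sum\<close>

lemma Suc_choose_2: "Suc n choose 2 = (n choose 2) + n"
  by (simp add: numeral_2_eq_2)

text \<open>The ratio \<open>r * s ^ n\<close> of consecutive terms tends to 0 however large
  \<open>r\<close> is. This is the majorant for the series below with a quadratic exponent.\<close>

lemma summable_power_choose_2:
  fixes r s :: real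
  assumes "0 \<le> r" "0 \<le> s" "s < 1"
  shows "summable (\<lambda>n. r ^ n * s ^ (n choose 2))"
proof -
  have "(\<lambda>n. r * s ^ n) \<longlonglongrightarrow> r * 0"
    using assms by (intro tendsto_intros LIMSEQ_power_zero) auto
  then have "eventually (\<lambda>n. r * s ^ n < 1/2) sequentially"
    by (rule order_tendstoD) auto
  then obtain N where N: "\<And>n. n \<ge> N \<Longrightarrow> r * s ^ n < 1/2"
    by (auto simp: eventually_sequentially)
  show ?thesis
  proof (rule summable_ratio_test[of "1/2" N])
    fix n assume "N \<le> n"
    have "norm (r ^ Suc n * s ^ (Suc n choose 2)) = (r * s ^ n) * (r ^ n * s ^ (n choose 2))"
      using assms by (simp add: Suc_choose_2 power_add)
    also have "\<dots> \<le> 1/2 * (r ^ n * s ^ (n choose 2))"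
      using N[OF \<open>N \<le> n\<close>] assms by (intro mult_right_mono) auto
    finally show "norm (r ^ Suc n * s ^ (Suc n choose 2)) \<le> 1/2 * norm (r ^ n * s ^ (n choose 2))"
      using assms by simp
  qed simp
qed

text \<open>Both identities of Euler and the \<open>\<^sub>1\<phi>\<^sub>1\<close> sum below express a solution of a first order
  \<open>q\<close>-difference equation as an infinite product; the equation is iterated along \<open>z, p z, p\<^sup>2 z, \<dots>\<close>
  and the value at 0 is used.\<close>

lemma summable_euler:
  assumes "norm p < 1"
  shows "summable (\<lambda>n. p ^ (n choose 2) * inverse (qpoch p p n) * z ^ n)"
proof -
  obtain C where C: "C > 0" "\<And>n. norm (inverse (qpoch p p n)) \<le> C"
    using bounded_inverse_qpoch[OF assms assms] by blast
  show ?thesis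
  proof (rule summable_comparison_test')
    show "summable (\<lambda>n. C * (norm z ^ n * norm p ^ (n choose 2)))"
      using assms by (intro summable_mult summable_power_choose_2) auto
    fix n
    have "norm (p ^ (n choose 2) * inverse (qpoch p p n) * z ^ n)
        = norm (inverse (qpoch p p n)) * (norm z ^ n * norm p ^ (n choose 2))"
      by (simp add: norm_mult norm_power norm_inverse mult_ac)
    also have "\<dots> \<le> C * (norm z ^ n * norm p ^ (n choose 2))"
      using C by (intro mult_right_mono) auto
    finally show "norm (p ^ (n choose 2) * inverse (qpoch p p n) * z ^ n)
        \<le> C * (norm z ^ n * norm p ^ (n choose 2))" .
  qed
qed

lemma inverse_qpoch_Suc:
  assumes "norm p < 1"
  shows "inverse (qpoch p p (Suc n)) * (1 - p ^ Suc n) = inverse (qpoch p p n)"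
proof -
  have "qpoch p p (Suc n) \<noteq> 0" using qpoch_nonzero assms by blast
  then show ?thesis by (simp add: qpoch_Suc field_simps)
qed

lemma euler_sums:
  assumes "norm p < 1"
  shows "(\<lambda>n. p ^ (n choose 2) * inverse (qpoch p p n) * z ^ n) sums qpoch_inf (- z) p"
proof -
  define c where "c n = p ^ (n choose 2) * inverse (qpoch p p n)" for n
  define f where "f z = (\<Sum>n. c n * z ^ n)" for z
  have summ: "summable (\<lambda>n. c n * z ^ n)" for z
    unfolding c_def by (rule summable_euler[OF assms])
  have fz: "(\<lambda>n. c n * z ^ n) sums f z" for z
    unfolding f_def using summ by (rule summable_sums)
  have step: "f z = (1 + z) * f (z * p)" for z
  proof -
    have "(\<lambda>n. c n * z ^ n - c n * (z * p) ^ n) sums (f z - f (z * p))"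
      by (intro sums_diff fz)
    moreover have "(\<lambda>n. c n * z ^ n - c n * (z * p) ^ n) sums (z * f (z * p))"
    proof -
      have "(\<lambda>n. c (Suc n) * z ^ Suc n - c (Suc n) * (z * p) ^ Suc n) sums (z * f (z * p))"
      proof -
        have "c (Suc n) * z ^ Suc n - c (Suc n) * (z * p) ^ Suc n = z * (c n * (z * p) ^ n)" for n
        proof -
          have "c (Suc n) * z ^ Suc n - c (Suc n) * (z * p) ^ Suc n
              = p ^ (Suc n choose 2) * (inverse (qpoch p p (Suc n)) * (1 - p ^ Suc n)) * z ^ Suc n"
            by (simp add: c_def algebra_simps power_mult_distrib)
          also have "\<dots> = z * (c n * (z * p) ^ n)"
            by (simp only: inverse_qpoch_Suc[OF assms])
               (simp add: c_def Suc_choose_2 power_add power_mult_distrib algebra_simps)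
          finally show ?thesis .
        qed
        then show ?thesis using sums_mult[OF fz, of z "z * p"] by simp
      qed
      then show ?thesis by (subst (asm) sums_Suc_iff) simp
    qed
    ultimately have "f z - f (z * p) = z * f (z * p)"
      using sums_unique2 by blast
    then show ?thesis by (simp add: algebra_simps)
  qed
  have iter: "f z = qpoch (- z) p N * f (z * p ^ N)" for N z
    by (induction N) (simp_all add: qpoch_Suc step[of "z * p ^ N" for N] mult_ac)
  have "isCont f 0"
    unfolding f_def by (rule isCont_powser[OF summ[of 1]]) simp
  moreover have "(\<lambda>N. z * p ^ N) \<longlonglongrightarrow> 0"
    using LIMSEQ_power_zero[OF assms] tendsto_mult_right_zero by blast
  ultimately have "(\<lambda>N. f (z * p ^ N)) \<longlonglongrightarrow> f 0"
    by (rule isCont_tendsto_compose)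
  then have "(\<lambda>N. qpoch (- z) p N * f (z * p ^ N)) \<longlonglongrightarrow> qpoch_inf (- z) p * f 0"
    by (intro tendsto_mult qpoch_LIMSEQ assms)
  then have "f z = qpoch_inf (- z) p * f 0"
    by (simp add: iter[symmetric] LIMSEQ_const_iff)
  moreover have "f 0 = 1"
    using powser_zero[of c] by (simp add: f_def c_def numeral_2_eq_2)
  ultimately show ?thesis using fz[of z] by (simp add: c_def)
qed

lemma euler_inverse_sums:
  assumes "norm p < 1" "norm z < 1"
  shows "(\<lambda>n. inverse (qpoch p p n) * z ^ n) sums inverse (qpoch_inf z p)"
proof -
  define c where "c n = inverse (qpoch p p n)" for n
  define f where "f z = (\<Sum>n. c n * z ^ n)" for z
  obtain C where C: "C > 0" "\<And>n. norm (c n) \<le> C"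
    using bounded_inverse_qpoch[OF assms(1) assms(1)] unfolding c_def by blast
  have summ: "summable (\<lambda>n. c n * z ^ n)" if "norm z < 1" for z
  proof (rule summable_comparison_test')
    show "summable (\<lambda>n. C * norm z ^ n)"
      using that by (intro summable_mult summable_geometric) auto
    show "norm (c n * z ^ n) \<le> C * norm z ^ n" for n
      using C by (auto simp: norm_mult norm_power intro!: mult_right_mono)
  qed
  have fz: "(\<lambda>n. c n * z ^ n) sums f z" if "norm z < 1" for z
    unfolding f_def using summ[OF that] by (rule summable_sums)
  have less: "norm (z * p ^ N) < 1" if "norm z < 1" for z N
    using norm_mult_power_less_1[OF assms(1) that] .
  have step: "(1 - z) * f z = f (z * p)" if "norm z < 1" for z
  proof -
    have zp: "norm (z * p) < 1" using less[OF that, of 1] by simp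
    have "(\<lambda>n. c n * z ^ n - c n * (z * p) ^ n) sums (f z - f (z * p))"
      by (intro sums_diff fz that zp)
    moreover have "(\<lambda>n. c n * z ^ n - c n * (z * p) ^ n) sums (z * f z)"
    proof -
      have "(\<lambda>n. c (Suc n) * z ^ Suc n - c (Suc n) * (z * p) ^ Suc n) sums (z * f z)"
      proof -
        have "c (Suc n) * z ^ Suc n - c (Suc n) * (z * p) ^ Suc n = z * (c n * z ^ n)" for n
        proof -
          have "c (Suc n) * z ^ Suc n - c (Suc n) * (z * p) ^ Suc n
              = (inverse (qpoch p p (Suc n)) * (1 - p ^ Suc n)) * z ^ Suc n"
            by (simp add: c_def algebra_simps power_mult_distrib)
          also have "\<dots> = z * (c n * z ^ n)"
            by (simp only: inverse_qpoch_Suc[OF assms(1)]) (simp add: c_def)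
          finally show ?thesis .
        qed
        then show ?thesis using sums_mult[OF fz[OF that], of z] by simp
      qed
      then show ?thesis by (subst (asm) sums_Suc_iff) simp
    qed
    ultimately have "f z - f (z * p) = z * f z"
      using sums_unique2 by blast
    then show ?thesis by (simp add: algebra_simps)
  qed
  have iter: "qpoch z p N * f z = f (z * p ^ N)" for N
  proof (induction N)
    case (Suc N)
    have "qpoch z p (Suc N) * f z = (1 - z * p ^ N) * (qpoch z p N * f z)"
      by (simp add: qpoch_Suc mult_ac)
    also have "\<dots> = f (z * p ^ N * p)"
      unfolding Suc.IH by (rule step[OF less[OF assms(2)]])
    finally show ?case by (simp add: mult_ac)
  qed simp
  have "isCont f 0"
    unfolding f_def by (rule isCont_powser[OF summ[of "1/2"]]) auto
  moreover have "(\<lambda>N. z * p ^ N) \<longlonglongrightarrow> 0"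
    using LIMSEQ_power_zero[OF assms(1)] tendsto_mult_right_zero by blast
  ultimately have "(\<lambda>N. f (z * p ^ N)) \<longlonglongrightarrow> f 0"
    by (rule isCont_tendsto_compose)
  moreover have "(\<lambda>N. qpoch z p N * f z) \<longlonglongrightarrow> qpoch_inf z p * f z"
    by (intro tendsto_mult qpoch_LIMSEQ assms tendsto_const)
  ultimately have "qpoch_inf z p * f z = f 0"
    using LIMSEQ_unique by (simp add: iter)
  moreover have "f 0 = 1"
    using powser_zero[of c] by (simp add: f_def c_def numeral_2_eq_2)
  moreover have "qpoch_inf z p \<noteq> 0" using qpoch_inf_nonzero assms by blast
  ultimately have "f z = inverse (qpoch_inf z p)"
    by (simp add: field_simps)
  then show ?thesis using fz[OF assms(2)] by (simp add: c_def)
qed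

lemma sum_1phi1:
  assumes "norm p < 1" "norm c < 1"
  shows "(\<lambda>k. (- c) ^ k * p ^ (k choose 2) * inverse (qpoch p p k) * inverse (qpoch c p k)
            * (\<Prod>i<k. y - p ^ i)) sums (qpoch_inf (c * y) p / qpoch_inf c p)"
proof -
  define u where "u k = (- c) ^ k * p ^ (k choose 2) * inverse (qpoch p p k) * inverse (qpoch c p k)" for k
  \<comment> \<open>With \<open>y = 1 / a\<close> this is \<open>(a; p)_k / a^k\<close>. In this
    form it is a polynomial in \<open>y\<close> that keeps its meaning at \<open>y = 0\<close>,
    where the iteration ends.\<close>
  define e where "e k y = (\<Prod>i<k. y - p ^ i)" for k y
  define v where "v k = u k * p ^ k / (1 - c * p ^ k)" for k
  define f where "f y = (\<Sum>k. u k * e k y)" for y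
  obtain C1 where C1: "C1 > 0" "\<And>n. norm (inverse (qpoch p p n)) \<le> C1"
    using bounded_inverse_qpoch[OF assms(1) assms(1)] by blast
  obtain C2 where C2: "C2 > 0" "\<And>n. norm (inverse (qpoch c p n)) \<le> C2"
    using bounded_inverse_qpoch[OF assms] by blast
  have cp: "1 - c * p ^ k \<noteq> 0" for k
    using norm_mult_power_less_1[OF assms, of k] by auto
  have u_bound: "norm (u k) \<le> C1 * C2 * (norm c ^ k * norm p ^ (k choose 2))" for k
  proof -
    have "norm (u k) = norm (inverse (qpoch p p k)) * norm (inverse (qpoch c p k)) * (norm c ^ k * norm p ^ (k choose 2))"
      by (simp add: u_def norm_mult norm_power norm_inverse mult_ac)
    also have "\<dots> \<le> C1 * C2 * (norm c ^ k * norm p ^ (k choose 2))"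
      using C1 C2 by (intro mult_mono) (auto simp: less_imp_le)
    finally show ?thesis .
  qed
  have e_bound: "norm (e k y) \<le> (R + 1) ^ k" if "norm y \<le> R" for k y R
  proof -
    have "norm (y - p ^ i) \<le> R + 1" for i
    proof -
      have "norm (p ^ i) \<le> 1" using assms by (simp add: norm_power power_le_one)
      then show ?thesis using that norm_triangle_ineq4[of y "p ^ i"] by linarith
    qed
    then show ?thesis unfolding e_def using norm_prod_le_power[of "{..<k}" "\<lambda>i. y - p ^ i"] by simp
  qed
  define M where "M R k = C1 * C2 * ((norm c * (R + 1)) ^ k * norm p ^ (k choose 2))" for R k
  have bound: "norm (u k * e k y) \<le> M R k" if "norm y \<le> R" for k y R
  proof -
    have "R \<ge> 0" using that norm_ge_zero order_trans by blast
    then have "norm (u k) * norm (e k y) \<le> C1 * C2 * (norm c ^ k * norm p ^ (k choose 2)) * (R + 1) ^ k"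
      using C1 C2 by (intro mult_mono u_bound e_bound that) (auto simp: less_imp_le)
    then show ?thesis by (simp add: M_def norm_mult power_mult_distrib mult_ac)
  qed
  have M_summ: "summable (M R)" if "R \<ge> 0" for R
    unfolding M_def using assms that by (intro summable_mult summable_power_choose_2) auto
  have summ: "summable (\<lambda>k. u k * e k y)" for y
    by (rule summable_comparison_test'[OF M_summ[of "norm y"]]) (auto intro: bound)
  have fy: "(\<lambda>k. u k * e k y) sums f y" for y
    unfolding f_def using summ by (rule summable_sums)
  have u_Suc: "u (Suc k) * (1 - p ^ Suc k) = - c * v k" for k
  proof -
    have "qpoch p p k \<noteq> 0" "qpoch c p k \<noteq> 0" "1 - p * p ^ k \<noteq> 0"
      using qpoch_nonzero assms norm_mult_power_less_1[OF assms(1) assms(1), of k] by auto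
    then have *: "inverse (qpoch p p (Suc k)) * (1 - p ^ Suc k) = inverse (qpoch p p k)"
      "inverse (qpoch c p (Suc k)) = inverse (qpoch c p k) / (1 - c * p ^ k)"
      using inverse_qpoch_Suc[OF assms(1), of k] cp[of k] by (auto simp: qpoch_Suc field_simps)
    have "u (Suc k) * (1 - p ^ Suc k) = (- c) ^ Suc k * p ^ (Suc k choose 2)
        * (inverse (qpoch p p (Suc k)) * (1 - p ^ Suc k)) * inverse (qpoch c p (Suc k))"
      by (simp only: u_def mult_ac)
    then show ?thesis
      unfolding * by (simp add: u_def v_def Suc_choose_2 power_add)
  qed
  have e_Suc: "e (Suc k) y = (y - p ^ k) * e k y" for k y
    by (simp add: e_def mult_ac)
  have e_p: "e (Suc k) (y * p) = p ^ Suc k * e (Suc k) y - p ^ k * (1 - p ^ Suc k) * e k y" for k y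
  proof -
    have "e (Suc k) (y * p) = (y * p - 1) * (\<Prod>i<k. p * (y - p ^ i))"
      unfolding e_def by (subst prod.lessThan_Suc_shift) (simp add: algebra_simps)
    also have "(\<Prod>i<k. p * (y - p ^ i)) = p ^ k * e k y"
      by (simp add: e_def prod.distrib)
    finally show ?thesis by (simp add: e_Suc algebra_simps)
  qed
  \<comment> \<open>The series with coefficients \<open>v\<close> mediates between the two sides: it
    sums to \<open>f (y * p)\<close>, and its multiple by \<open>1 - c * y\<close> sums to
    \<open>f y\<close>. Both facts hold termwise up to a telescoping difference.\<close>
  have step: "f y = (1 - c * y) * f (y * p)" for y
  proof -
    have v_eq: "v k = u k * p ^ k + c * p ^ k * v k" for k
      using cp[of k] by (simp add: v_def field_simps)
    have vs: "(\<lambda>k. v k * e k y) sums f (y * p)"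
    proof -
      have vsumm: "summable (\<lambda>k. u (Suc k) * (1 - p ^ Suc k) * p ^ k * e k y)"
      proof -
        have "(\<lambda>k. u (Suc k) * e (Suc k) (y * p)) sums (f (y * p) - u 0 * e 0 (y * p))"
          using fy[of "y * p"] by (subst sums_Suc_iff) simp
        moreover have "summable (\<lambda>k. u (Suc k) * p ^ Suc k * e (Suc k) y)"
        proof -
          have "summable (\<lambda>k. norm (u k * e k y))"
            by (rule summable_comparison_test'[OF M_summ[of "norm y"]]) (auto intro: bound)
          then have "summable (\<lambda>k. u k * p ^ k * e k y)"
          proof (rule summable_comparison_test')
            fix k
            have "norm (p ^ k) \<le> 1" using assms by (simp add: norm_power power_le_one)
            then have "norm (u k * e k y) * norm (p ^ k) \<le> norm (u k * e k y) * 1"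
              by (intro mult_left_mono) auto
            then show "norm (u k * p ^ k * e k y) \<le> norm (u k * e k y)"
              by (simp add: norm_mult mult_ac)
          qed
          then show ?thesis by (subst summable_Suc_iff)
        qed
        ultimately have "summable (\<lambda>k. u (Suc k) * p ^ Suc k * e (Suc k) y - u (Suc k) * e (Suc k) (y * p))"
          by (intro summable_diff) (auto simp: sums_iff)
        moreover have "u (Suc k) * p ^ Suc k * e (Suc k) y - u (Suc k) * e (Suc k) (y * p)
            = u (Suc k) * (1 - p ^ Suc k) * p ^ k * e k y" for k
          unfolding e_p by (simp add: algebra_simps)
        ultimately show ?thesis by simp
      qed
      have 1: "(\<lambda>k. u k * e k (y * p)) sums f (y * p)" by (rule fy)
      \<comment> \<open>By \<open>e_p\<close> the \<open>k\<close>-th term is a combination of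
        \<open>e k y\<close> and \<open>e (k - 1) y\<close>; \<open>w k\<close> is the part
        belonging to \<open>e (k - 1) y\<close>, which is counted at index \<open>k - 1\<close>
        instead.\<close>
      define w where "w k = (if k = 0 then 0 else u k * (1 - p ^ k) * p ^ (k - 1) * e (k - 1) y)" for k
      have w1: "(\<lambda>k. w (Suc k)) sums (\<Sum>k. w (Suc k))"
        using vsumm by (intro summable_sums) (simp add: w_def)
      then have w2: "w sums (\<Sum>k. w (Suc k))"
        by (subst (asm) sums_Suc_iff) (simp add: w_def)
      have "(\<lambda>k. u k * e k (y * p) + w k - w (Suc k)) sums f (y * p)"
        using sums_diff[OF sums_add[OF 1 w2] w1] by simp
      moreover have "u k * e k (y * p) + w k - w (Suc k) = v k * e k y" for k
      proof -
        have "u k * e k (y * p) + w k = u k * p ^ k * e k y"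
        proof (cases k)
          case 0 then show ?thesis by (simp add: w_def e_def)
        next
          case (Suc m)
          show ?thesis unfolding Suc e_p by (simp add: w_def algebra_simps)
        qed
        moreover have "w (Suc k) = - c * v k * p ^ k * e k y"
          using u_Suc[of k] by (simp add: w_def)
        ultimately have "u k * e k (y * p) + w k - w (Suc k) = (u k * p ^ k + c * p ^ k * v k) * e k y"
          by (simp add: algebra_simps)
        then show ?thesis unfolding v_eq[symmetric] .
      qed
      ultimately show ?thesis by simp
    qed
    define w where "w k = (if k = 0 then 0 else - c * v (k - 1) * e k y)" for k
    have key: "u k * e k y = (1 - c * y) * (v k * e k y) + w k - w (Suc k)" for k
    proof -
      have 1: "w k = u k * (1 - p ^ k) * e k y"
        using u_Suc[of "k - 1"] by (cases k) (auto simp: w_def)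
      have 2: "w (Suc k) = - c * v k * (y - p ^ k) * e k y"
        by (simp add: w_def e_Suc)
      have 3: "v k * (1 - c * p ^ k) = u k * p ^ k"
        using cp[of k] by (simp add: v_def)
      have "(1 - c * y) * (v k * e k y) + w k - w (Suc k)
          = (v k * (1 - c * p ^ k)) * e k y + u k * (1 - p ^ k) * e k y"
        unfolding 1 2 by (simp add: algebra_simps)
      then show ?thesis unfolding 3 by (simp add: algebra_simps)
    qed
    have "(\<lambda>n. w n) \<longlonglongrightarrow> 0"
    proof -
      have "(\<lambda>k. v k * e k y) \<longlonglongrightarrow> 0" using vs sums_summable summable_LIMSEQ_zero by blast
      then have "(\<lambda>k. - c * (y - p ^ k) * (v k * e k y)) \<longlonglongrightarrow> (- c * (y - 0)) * 0"
        by (intro tendsto_intros LIMSEQ_power_zero assms)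
      then have "(\<lambda>k. w (Suc k)) \<longlonglongrightarrow> 0"
        by (simp add: w_def e_Suc mult_ac)
      then show ?thesis by (rule LIMSEQ_imp_Suc)
    qed
    then have "(\<lambda>n. w (Suc n) - w n) sums (0 - w 0)"
      by (rule telescope_sums)
    then have "(\<lambda>k. (1 - c * y) * (v k * e k y) - (w (Suc k) - w k)) sums ((1 - c * y) * f (y * p) - (0 - w 0))"
      using sums_diff[OF sums_mult[OF vs]] by blast
    then have "(\<lambda>k. u k * e k y) sums ((1 - c * y) * f (y * p))"
      by (simp add: key w_def algebra_simps)
    then show ?thesis using fy sums_unique2 by blast
  qed
  have iter: "f y = qpoch (c * y) p N * f (y * p ^ N)" for N y
    by (induction N) (simp_all add: qpoch_Suc step[of "y * p ^ N" for N] mult_ac)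
  \<comment> \<open>As a series of polynomials, \<open>f\<close> is continuous along
    \<open>y * p ^ N\<close> by Tannery's theorem; \<open>M (norm y)\<close> dominates the terms for
    all \<open>N\<close> at once.\<close>
  have lim0: "(\<lambda>N. f (y * p ^ N)) \<longlonglongrightarrow> f 0" for y
    unfolding f_def
  proof (rule tannerys_theorem[THEN conjunct2, THEN conjunct2])
    show "summable (M (norm y))" by (rule M_summ) simp
    have "(\<lambda>N. y * p ^ N) \<longlonglongrightarrow> 0"
      using LIMSEQ_power_zero[OF assms(1)] tendsto_mult_right_zero by blast
    then show "(\<lambda>N. u k * e k (y * p ^ N)) \<longlonglongrightarrow> u k * e k 0" for k
      unfolding e_def by (intro tendsto_intros)
    have "norm (y * p ^ N) \<le> norm y" for N
      using assms by (simp add: norm_mult norm_power mult_left_le power_le_one)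
    then show "\<forall>\<^sub>F (k, N) in sequentially \<times>\<^sub>F sequentially. norm (u k * e k (y * p ^ N)) \<le> M (norm y) k"
      by (intro always_eventually) (auto intro!: bound)
  qed simp
  have prodf: "f y = qpoch_inf (c * y) p * f 0" for y
  proof -
    have "(\<lambda>N. qpoch (c * y) p N * f (y * p ^ N)) \<longlonglongrightarrow> qpoch_inf (c * y) p * f 0"
      by (intro tendsto_mult qpoch_LIMSEQ assms lim0)
    then show ?thesis by (simp add: iter[symmetric] LIMSEQ_const_iff)
  qed
  \<comment> \<open>At \<open>y = 1\<close> each product with \<open>k > 0\<close> contains the
    vanishing factor \<open>1 - p ^ 0\<close>. This known value fixes the constant
    \<open>f 0\<close>.\<close>
  have "f 1 = 1"
  proof -
    have "e k 1 = (if k = 0 then 1 else 0)" for k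
      by (cases k) (auto simp: e_def prod.lessThan_Suc_shift simp del: prod.lessThan_Suc)
    then have "f 1 = (\<Sum>k\<in>{0}. u k * e k 1)"
      unfolding f_def by (intro suminf_finite) auto
    then show ?thesis by (simp add: u_def e_def numeral_2_eq_2)
  qed
  then have "f 0 = 1 / qpoch_inf c p"
    using prodf[of 1] qpoch_inf_nonzero[OF assms] by (simp add: field_simps)
  then show ?thesis
    using fy[of y] by (simp add: prodf[of y] u_def e_def)
qed

section \<open>Products of absolutely convergent families\<close>

lemma abs_summable_times:
  fixes f :: "'a \<Rightarrow> complex" and g :: "'b \<Rightarrow> complex"
  assumes f: "(\<lambda>x. norm (f x)) summable_on A" and g: "(\<lambda>y. norm (g y)) summable_on B"
  shows "(\<lambda>z. norm (f (fst z) * g (snd z))) summable_on A \<times> B"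
proof (rule summable_on_SigmaI)
  show "((\<lambda>y. norm (f (fst (x, y)) * g (snd (x, y)))) has_sum
      (norm (f x) * (\<Sum>\<^sub>\<infinity>y\<in>B. norm (g y)))) B" for x
    using has_sum_cmult_right[OF has_sum_infsum[OF g], of "norm (f x)"]
    by (simp only: fst_conv snd_conv norm_mult)
  show "(\<lambda>x. norm (f x) * (\<Sum>\<^sub>\<infinity>y\<in>B. norm (g y))) summable_on A"
    using f by (rule summable_on_cmult_left)
qed (rule norm_ge_zero)

lemma has_sum_times:
  fixes f :: "'a \<Rightarrow> complex" and g :: "'b \<Rightarrow> complex"
  assumes f: "(\<lambda>x. norm (f x)) summable_on A" and g: "(\<lambda>y. norm (g y)) summable_on B"
    and fS: "(f has_sum S) A" and gT: "(g has_sum T) B"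
  shows "((\<lambda>(x, y). f x * g y) has_sum S * T) (A \<times> B)"
proof (rule has_sum_SigmaI)
  show "((\<lambda>y. case (x, y) of (x, y) \<Rightarrow> f x * g y) has_sum f x * T) B" for x
    using has_sum_cmult_right[OF gT, of "f x"] by (simp only: prod.case)
  show "((\<lambda>x. f x * T) has_sum S * T) A"
    using fS by (rule has_sum_cmult_left)
  have "(\<lambda>z. f (fst z) * g (snd z)) summable_on A \<times> B"
    using abs_summable_times[OF f g] by (rule abs_summable_summable)
  then show "(\<lambda>(x, y). f x * g y) summable_on A \<times> B"
    by (simp only: case_prod_unfold)
qed

lemma abs_summable_on_int:
  fixes f :: "int \<Rightarrow> complex"
  assumes "summable (\<lambda>n. norm (f (int n)))" "summable (\<lambda>n. norm (f (- int n)))"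
  shows "(\<lambda>n. norm (f n)) summable_on UNIV"
proof -
  have "(\<lambda>n. norm (f n)) summable_on range int"
  proof (subst summable_on_reindex)
    show "(\<lambda>n. norm (f n)) \<circ> int summable_on UNIV"
      using assms(1) by (simp add: summable_on_UNIV_nonneg_real_iff o_def)
  qed auto
  moreover have "(\<lambda>n. norm (f n)) summable_on range (\<lambda>n. - int n)"
  proof (subst summable_on_reindex)
    show "(\<lambda>n. norm (f n)) \<circ> (\<lambda>n. - int n) summable_on UNIV"
      using assms(2) by (simp add: summable_on_UNIV_nonneg_real_iff o_def)
  qed (auto simp: inj_on_def)
  ultimately have "(\<lambda>n. norm (f n)) summable_on (range int \<union> range (\<lambda>n. - int n))"
    by (rule summable_on_union)
  also have "range int \<union> range (\<lambda>n. - int n) = UNIV"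
  proof (intro equalityI subset_UNIV subsetI)
    fix n :: int show "n \<in> range int \<union> range (\<lambda>n. - int n)"
      by (cases n rule: int_cases2) auto
  qed
  finally show ?thesis .
qed

section \<open>Theta series\<close>

text \<open>The binomial coefficient \<open>n choose 2\<close> continued to negative integers, as
  bilateral theta series require.\<close>

definition tri :: "int \<Rightarrow> int" where
  "tri n = n * (n - 1) div 2"

lemma two_tri: "2 * tri n = n * (n - 1)"
  unfolding tri_def by (intro dvd_mult_div_cancel) auto

lemma tri_add: "tri (m + n) = tri m + tri n + m * n"
proof -
  have "2 * tri (m + n) = 2 * (tri m + tri n + m * n)"
    using two_tri[of m] two_tri[of n] two_tri[of "m + n"] by (simp add: algebra_simps)
  then show ?thesis by simp
qed

lemma tri_uminus: "tri (- n) = tri n + n"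
  using two_tri[of n] two_tri[of "- n"] by (simp add: algebra_simps)

lemma tri_of_nat: "tri (int n) = int (n choose 2)"
proof (induction n)
  case (Suc n)
  have "tri (int (Suc n)) = tri (int n) + tri 1 + int n"
    using tri_add[of "int n" 1] by (simp add: add.commute)
  then show ?case using Suc by (simp add: Suc_choose_2) (simp add: tri_def)
qed (simp add: tri_def numeral_2_eq_2)

definition theta_term :: "complex \<Rightarrow> complex \<Rightarrow> int \<Rightarrow> complex" where
  "theta_term p x n = (- x) powi n * p powi tri n"

text \<open>On the negative half, \<open>tri (- n) = tri n + n\<close> replaces \<open>x\<close> by
  \<open>p / x\<close>, so both halves have the majorant of
  \<open>summable_power_choose_2\<close>.\<close>

lemma abs_summable_theta_term:
  assumes "norm p < 1" "p \<noteq> 0"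
  shows "(\<lambda>n. norm (theta_term p x n)) summable_on UNIV"
proof (rule abs_summable_on_int)
  show "summable (\<lambda>n. norm (theta_term p x (int n)))"
    using assms summable_power_choose_2[of "norm x" "norm p"]
    by (simp add: theta_term_def norm_mult norm_power norm_power_int tri_of_nat)
  have "norm (theta_term p x (- int n)) = norm (p / x) ^ n * norm p ^ (n choose 2)" for n
    using assms
    by (simp add: theta_term_def norm_mult norm_power norm_power_int tri_of_nat tri_uminus norm_divide
        power_int_add power_int_minus power_divide field_simps)
  then show "summable (\<lambda>n. norm (theta_term p x (- int n)))"
    using assms summable_power_choose_2[of "norm (p / x)" "norm p"] by simp
qed

text \<open>The value 0 at negative \<open>k\<close> is the usual convention for
  \<open>1 / (p; p)_k\<close>. With it the recurrence \<open>rqp_rec\<close> holds at every integer,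
  also at \<open>k = 0\<close>, where \<open>1 - p powi 0\<close> vanishes.\<close>

definition rqp :: "complex \<Rightarrow> int \<Rightarrow> complex" where
  "rqp p k = (if k < 0 then 0 else inverse (qpoch p p (nat k)))"

lemma rqp_of_nat [simp]: "rqp p (int k) = inverse (qpoch p p k)"
  by (simp add: rqp_def)

lemma rqp_rec:
  assumes "norm p < 1"
  shows "rqp p (k - 1) = (1 - p powi k) * rqp p k"
proof (cases "k > 0")
  case True
  then obtain n where "k = int (Suc n)" by (metis zero_less_imp_eq_int gr0_implies_Suc)
  then show ?thesis
    using inverse_qpoch_Suc[OF assms, of n] by (simp add: rqp_def nat_add_distrib mult_ac flip: power_int_of_nat)
next
  case False
  then show ?thesis by (cases "k = 0") (auto simp: rqp_def)
qed

text \<open>For negative \<open>k\<close> the infinite product contains a factor with exponent 0 and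
  vanishes, in agreement with the default value of \<open>rqp\<close>.\<close>

lemma rqp_qpoch_inf:
  assumes "norm p < 1" "p \<noteq> 0"
  shows "qpoch_inf (p powi (k + 1)) p = rqp p k * qpoch_inf p p"
proof (cases "k \<ge> 0")
  case True
  then obtain n where n: "k = int n" using nonneg_int_cases by blast
  have "p powi (k + 1) = p * p ^ n" using assms by (simp add: n power_int_add)
  moreover have "qpoch_inf p p = qpoch p p n * qpoch_inf (p * p ^ n) p"
    by (rule qpoch_inf_split[OF assms(1)])
  moreover have "qpoch p p n \<noteq> 0" using qpoch_nonzero assms by blast
  ultimately show ?thesis by (simp add: n)
next
  case False
  define n where "n = nat (- k - 1)"
  have "k + 1 = - int n" using False by (simp add: n_def)
  then have "p powi (k + 1) * p ^ n = 1"
    using assms(2) by (simp add: power_int_minus)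
  then have "qpoch_inf (p powi (k + 1)) p = 0"
    using qpoch_inf_eq_0_iff[OF assms(1)] by blast
  then show ?thesis using False by (simp add: rqp_def)
qed

lemma norm_summable_euler:
  assumes "norm p < 1"
  shows "summable (\<lambda>n. norm (p ^ (n choose 2) * inverse (qpoch p p n) * z ^ n))"
proof -
  have "summable (\<lambda>n. p ^ (n choose 2) * inverse (qpoch p p n) * of_real (norm z + 1) ^ n)"
    by (rule summable_euler[OF assms])
  from powser_insidea[OF this, of z] show ?thesis
    by (simp add: abs_if)
qed

text \<open>The theta series is multiplied by Euler's series for
  \<open>1 / (p/x; p)_\<infinity>\<close>, and the terms are collected by the difference
  \<open>n\<close> of the two indices. The inner sum is \<open>(p^(n+1); p)_\<infinity>\<close>,
  again by Euler; it is zero for \<open>n < 0\<close>, so what remains is Euler's series for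
  \<open>(x; p)_\<infinity>\<close>.\<close>

theorem jacobi_triple_product:
  assumes "norm p < 1" "p \<noteq> 0" "x \<noteq> 0" "norm (p / x) < 1"
  shows "(theta_term p x has_sum (qpoch_inf p p * qpoch_inf x p * qpoch_inf (p / x) p)) UNIV"
proof -
  obtain \<theta> where \<theta>: "(theta_term p x has_sum \<theta>) UNIV"
    using abs_summable_summable[OF abs_summable_theta_term[OF assms(1,2)]] summable_on_def by blast
  define g where "g m = inverse (qpoch p p m) * (p / x) ^ m" for m
  have g_sums: "g sums inverse (qpoch_inf (p / x) p)"
    unfolding g_def by (rule euler_inverse_sums[OF assms(1,4)])
  have g_abs: "summable (\<lambda>m. norm (g m))"
  proof -
    obtain r where r: "norm (p / x) < r" "r < 1" using dense[OF assms(4)] by blast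
    then have "0 \<le> r"
      using norm_ge_zero[of "p / x"] by linarith
    then have "norm (complex_of_real r) < 1"
      using r by simp
    then have "summable (\<lambda>m. inverse (qpoch p p m) * complex_of_real r ^ m)"
      using euler_inverse_sums[OF assms(1)] sums_summable by blast
    from powser_insidea[OF this, of "p / x"] show ?thesis
      using r \<open>0 \<le> r\<close> by (simp add: g_def)
  qed
  have g_has: "(g has_sum inverse (qpoch_inf (p / x) p)) UNIV"
    by (rule norm_summable_imp_has_sum[OF g_abs g_sums])
  have prod: "((\<lambda>(N, m). theta_term p x N * g m) has_sum \<theta> * inverse (qpoch_inf (p / x) p)) (UNIV \<times> UNIV)"
    using g_abs by (intro has_sum_times abs_summable_theta_term assms \<theta> g_has)
       (simp add: summable_on_UNIV_nonneg_real_iff)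
  have "((\<lambda>(n, m). theta_term p x (n + int m) * g m) has_sum \<theta> * inverse (qpoch_inf (p / x) p)) (UNIV \<times> UNIV)"
    using prod
    by (subst has_sum_reindex_bij_witness[where i = "\<lambda>(N, m). (N - int m, m)" and j = "\<lambda>(n, m). (n + int m, m)"
          and h = "\<lambda>(N, m). theta_term p x N * g m" and T = "UNIV \<times> UNIV"]) auto
  then have "((\<lambda>n. theta_term p x n * (rqp p n * qpoch_inf p p)) has_sum \<theta> * inverse (qpoch_inf (p / x) p)) UNIV"
  proof (rule has_sum_SigmaD)
    fix n :: int
    have term_eq: "theta_term p x (n + int m) * g m
        = theta_term p x n * (p ^ (m choose 2) * inverse (qpoch p p m) * (- (p powi (n + 1))) ^ m)" for m
    proof -
      have "theta_term p x (n + int m)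
          = theta_term p x n * ((- x) ^ m * p ^ (m choose 2) * (p powi n) ^ m)"
        using assms by (simp add: theta_term_def tri_add tri_of_nat power_int_add power_int_mult mult_ac)
      moreover have "(- (p powi (n + 1))) ^ m = (-1) ^ m * (p powi n) ^ m * p ^ m"
        using assms(2) by (subst power_minus) (simp add: power_int_add power_mult_distrib)
      moreover have "(- x) ^ m * (p / x) ^ m = (-1) ^ m * p ^ m"
        using assms(3) by (subst power_minus) (simp add: power_divide)
      ultimately show ?thesis
        by (simp add: g_def mult_ac)
    qed
    have "((\<lambda>m. p ^ (m choose 2) * inverse (qpoch p p m) * (- (p powi (n + 1))) ^ m)
        has_sum qpoch_inf (p powi (n + 1)) p) UNIV"
      using norm_summable_imp_has_sum[OF norm_summable_euler[OF assms(1)] euler_sums[OF assms(1)], of "- (p powi (n + 1))"]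
      by simp
    from has_sum_cmult_right[OF this, of "theta_term p x n"]
    show "((\<lambda>m. case (n, m) of (n, m) \<Rightarrow> theta_term p x (n + int m) * g m)
        has_sum theta_term p x n * (rqp p n * qpoch_inf p p)) UNIV"
      using rqp_qpoch_inf[OF assms(1,2)] by (simp add: term_eq)
  qed
  moreover have "((\<lambda>n. theta_term p x n * (rqp p n * qpoch_inf p p)) has_sum qpoch_inf p p * qpoch_inf x p) UNIV"
  proof -
    have "((\<lambda>m. p ^ (m choose 2) * inverse (qpoch p p m) * (- x) ^ m) has_sum qpoch_inf x p) UNIV"
      using norm_summable_imp_has_sum[OF norm_summable_euler[OF assms(1)] euler_sums[OF assms(1)], of "- x"]
      by simp
    from has_sum_cmult_right[OF this, of "qpoch_inf p p"]
    have "((\<lambda>n. theta_term p x n * (rqp p n * qpoch_inf p p)) \<circ> int has_sum qpoch_inf p p * qpoch_inf x p) UNIV"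
      by (simp add: o_def theta_term_def tri_of_nat mult_ac)
    then have "((\<lambda>n. theta_term p x n * (rqp p n * qpoch_inf p p)) has_sum qpoch_inf p p * qpoch_inf x p) (range int)"
      by (subst has_sum_reindex) auto
    then show ?thesis
    proof (rule has_sum_cong_neutral[THEN iffD1, rotated -1])
      fix n :: int assume "n \<in> UNIV - range int"
      then have "n < 0" by (metis DiffE nonneg_int_cases not_less rangeI)
      then show "theta_term p x n * (rqp p n * qpoch_inf p p) = 0" by (simp add: rqp_def)
    qed auto
  qed
  ultimately have "\<theta> * inverse (qpoch_inf (p / x) p) = qpoch_inf p p * qpoch_inf x p"
    by (rule has_sum_unique)
  then have "\<theta> = qpoch_inf p p * qpoch_inf x p * qpoch_inf (p / x) p"
    using qpoch_inf_nonzero[OF assms(1,4)] by (simp add: field_simps)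
  then show ?thesis using \<theta> by simp
qed

lemma power_int_of_power: "((x :: complex) ^ n) powi k = x powi (int n * k)"
  by (simp add: power_int_mult)

lemma neg_one_powi: "(-1 :: complex) powi n = (if even n then 1 else -1)"
  using power_int_minus_left_even[of n "1 :: complex"] power_int_minus_left_odd[of n "1 :: complex"] by simp

text \<open>Triple products of base \<open>p ^ 6\<close> at \<open>p ^ 4\<close>,
  \<open>p ^ 2\<close> and \<open>1\<close>. In the first two cases the three factors are the
  residue classes of \<open>(p^2; p^2)_\<infinity>\<close>; in the third the factor
  \<open>(1; p^6)_\<infinity>\<close> is zero.\<close>

lemma pentagonal_sums:
  assumes "norm p < 1" "p \<noteq> 0"
  shows "((\<lambda>l. (-1) powi l * p powi (3 * l\<^sup>2 + l)) has_sum qpoch_inf (p\<^sup>2) (p\<^sup>2)) UNIV"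
    and "((\<lambda>l. (-1) powi l * p powi (3 * l\<^sup>2 - l)) has_sum qpoch_inf (p\<^sup>2) (p\<^sup>2)) UNIV"
    and "((\<lambda>l. (-1) powi l * p powi (3 * l\<^sup>2 - 3 * l)) has_sum 0) UNIV"
proof -
  have p6: "norm (p ^ 6) < 1" by (rule norm_power_less_1[OF assms(1)]) simp
  have eq: "theta_term (p ^ 6) (p ^ j) l = (-1) powi l * p powi (3 * l\<^sup>2 + (int j - 3) * l)" for j l
  proof -
    have "theta_term (p ^ 6) (p ^ j) l = ((-1) * p ^ j) powi l * (p ^ 6) powi tri l"
      by (simp add: theta_term_def)
    also have "\<dots> = (-1) powi l * (p powi (int j * l) * p powi (6 * tri l))"
      by (simp only: power_int_mult_distrib power_int_of_power) simp
    also have "p powi (int j * l) * p powi (6 * tri l) = p powi (int j * l + 6 * tri l)"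
      using assms by (simp add: power_int_add)
    also have "int j * l + 6 * tri l = 3 * l\<^sup>2 + (int j - 3) * l"
      using two_tri[of l] by (simp add: algebra_simps power2_eq_square)
    finally show ?thesis .
  qed
  have dissect: "qpoch_inf (p\<^sup>2) (p\<^sup>2) = qpoch_inf (p\<^sup>2) (p ^ 6) * qpoch_inf (p ^ 4) (p ^ 6) * qpoch_inf (p ^ 6) (p ^ 6)"
    using qpoch_inf_dissect[of "p\<^sup>2" 3 "p\<^sup>2"] norm_power_less_1[OF assms(1), of 2]
    by (simp add: eval_nat_numeral mult_ac)
  have div: "p ^ 6 / p ^ 4 = p\<^sup>2" "p ^ 6 / p\<^sup>2 = p ^ 4"
    using assms(2) by (auto simp: field_simps eval_nat_numeral)
  have "(theta_term (p ^ 6) (p ^ 4) has_sum qpoch_inf (p ^ 6) (p ^ 6) * qpoch_inf (p ^ 4) (p ^ 6) * qpoch_inf (p\<^sup>2) (p ^ 6)) UNIV"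
    using jacobi_triple_product[OF p6, of "p ^ 4"] assms norm_power_less_1[OF assms(1), of 2] by (simp add: div)
  then show "((\<lambda>l. (-1) powi l * p powi (3 * l\<^sup>2 + l)) has_sum qpoch_inf (p\<^sup>2) (p\<^sup>2)) UNIV"
    unfolding eq[abs_def] dissect by (simp add: mult_ac)
  have "(theta_term (p ^ 6) (p ^ 2) has_sum qpoch_inf (p ^ 6) (p ^ 6) * qpoch_inf (p\<^sup>2) (p ^ 6) * qpoch_inf (p ^ 4) (p ^ 6)) UNIV"
    using jacobi_triple_product[OF p6, of "p ^ 2"] assms norm_power_less_1[OF assms(1), of 4] by (simp add: div)
  then show "((\<lambda>l. (-1) powi l * p powi (3 * l\<^sup>2 - l)) has_sum qpoch_inf (p\<^sup>2) (p\<^sup>2)) UNIV"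
    unfolding eq[abs_def] dissect by (simp add: mult_ac)
  have "qpoch_inf 1 (p ^ 6) = 0"
    using qpoch_inf_eq_0_iff[OF p6] by (metis mult_1 power_0)
  then have "(theta_term (p ^ 6) (p ^ 0) has_sum 0) UNIV"
    using jacobi_triple_product[OF p6, of 1] assms p6 by simp
  then show "((\<lambda>l. (-1) powi l * p powi (3 * l\<^sup>2 - 3 * l)) has_sum 0) UNIV"
    unfolding eq[abs_def] by (simp add: mult_ac)
qed

text \<open>The product of the two theta series for \<open>x\<close>, \<open>p\<close> and \<open>p x\<^sup>2\<close>, \<open>p\<^sup>2\<close> is grouped by the
  power \<open>N\<close> of \<open>x\<close>. Each coefficient is again a theta series, which depends essentially only on
  \<open>N mod 3\<close>; it vanishes for \<open>N mod 3 = 2\<close> and is a pentagonal number series otherwise.\<close>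

theorem quintuple_product:
  assumes "norm p < 1" "p \<noteq> 0" "x \<noteq> 0" "norm (p / x) < 1" "norm (p / x\<^sup>2) < 1"
  shows "((\<lambda>k. x powi (3 * k) * p powi (3 * tri k + k) * (1 - x * p powi k)) has_sum
     (qpoch_inf p p * qpoch_inf x p * qpoch_inf (p / x) p
        * qpoch_inf (p * x\<^sup>2) (p\<^sup>2) * qpoch_inf (p / x\<^sup>2) (p\<^sup>2))) UNIV"
proof -
  define \<Theta>1 where "\<Theta>1 = qpoch_inf p p * qpoch_inf x p * qpoch_inf (p / x) p"
  define E where "E = qpoch_inf (p\<^sup>2) (p\<^sup>2)"
  define \<Theta>2 where "\<Theta>2 = E * qpoch_inf (p * x\<^sup>2) (p\<^sup>2) * qpoch_inf (p / x\<^sup>2) (p\<^sup>2)"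
  have p2: "norm (p\<^sup>2) < 1" "norm (p ^ 3) < 1"
    using norm_power_less_1[OF assms(1)] by auto
  have "p\<^sup>2 / (p * x\<^sup>2) = p / x\<^sup>2"
    using assms by (simp add: field_simps power2_eq_square)
  then have th2: "(theta_term (p\<^sup>2) (p * x\<^sup>2) has_sum \<Theta>2) UNIV"
    using jacobi_triple_product[OF p2(1), of "p * x\<^sup>2"] assms by (simp add: \<Theta>2_def E_def)
  have th1: "(theta_term p x has_sum \<Theta>1) UNIV"
    using jacobi_triple_product[OF assms(1-4)] by (simp add: \<Theta>1_def)
  have prod: "((\<lambda>(m, n). theta_term p x m * theta_term (p\<^sup>2) (p * x\<^sup>2) n) has_sum \<Theta>1 * \<Theta>2) (UNIV \<times> UNIV)"
    using assms p2 by (intro has_sum_times th1 th2 abs_summable_theta_term) auto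
  define S :: "int \<Rightarrow> int \<Rightarrow> complex"
    where "S r k = (-1) powi r * x powi (3 * k + r) * p powi (3 * tri k + k + r * k + tri r)" for r k
  define e :: "int \<Rightarrow> int \<Rightarrow> complex"
    where "e r l = (-1) powi l * p powi (3 * l\<^sup>2 - (2 * r - 1) * l)" for r l
  \<comment> \<open>The substitution \<open>m = k + r - 2 * l\<close>, \<open>n = k + l\<close>
    fixes the power \<open>m + 2 * n = 3 * k + r\<close> of \<open>x\<close> and splits the exponent
    of \<open>p\<close> into a part in \<open>k\<close> and \<open>r\<close> and a part in
    \<open>l\<close> and \<open>r\<close>.\<close>
  have term_eq: "theta_term p x (k + r - 2 * l) * theta_term (p\<^sup>2) (p * x\<^sup>2) (k + l) = S r k * e r l" for r k l
  proof -
    have th2_eq: "theta_term (p\<^sup>2) (p * x\<^sup>2) n = (-1) powi n * x powi (2 * n) * p powi (n + 2 * tri n)" for n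
    proof -
      have "theta_term (p\<^sup>2) (p * x\<^sup>2) n = ((-1) * (p * x\<^sup>2)) powi n * (p\<^sup>2) powi tri n"
        by (simp add: theta_term_def)
      also have "\<dots> = (-1) powi n * x powi (2 * n) * (p powi n * p powi (2 * tri n))"
        by (simp only: power_int_mult_distrib power_int_of_power) simp
      finally show ?thesis using assms by (simp add: power_int_add)
    qed
    have th1_eq: "theta_term p x m = (-1) powi m * x powi m * p powi tri m" for m
      by (simp add: theta_term_def power_int_mult_distrib[symmetric])
    have "theta_term p x (k + r - 2 * l) * theta_term (p\<^sup>2) (p * x\<^sup>2) (k + l)
       = ((-1) powi (k + r - 2 * l) * (-1) powi (k + l)) * (x powi (k + r - 2 * l) * x powi (2 * (k + l)))
         * (p powi tri (k + r - 2 * l) * p powi (k + l + 2 * tri (k + l)))"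
      unfolding th1_eq th2_eq by (simp only: mult_ac)
    also have "(-1 :: complex) powi (k + r - 2 * l) * (-1) powi (k + l) = (-1) powi r * (-1) powi l"
      by (auto simp: neg_one_powi)
    also have "x powi (k + r - 2 * l) * x powi (2 * (k + l)) = x powi (3 * k + r)"
      using assms by (simp add: power_int_add[symmetric] algebra_simps)
    also have "p powi tri (k + r - 2 * l) * p powi (k + l + 2 * tri (k + l))
        = p powi (tri (k + r - 2 * l) + (k + l + 2 * tri (k + l)))"
      using assms by (simp add: power_int_add)
    also have "tri (k + r - 2 * l) + (k + l + 2 * tri (k + l))
        = (3 * tri k + k + r * k + tri r) + (3 * l\<^sup>2 - (2 * r - 1) * l)"
    proof -
      have "2 * (tri (k + r - 2 * l) + (k + l + 2 * tri (k + l)))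
        = 2 * ((3 * tri k + k + r * k + tri r) + (3 * l\<^sup>2 - (2 * r - 1) * l))"
        using two_tri[of k] two_tri[of r] two_tri[of "k + r - 2 * l"] two_tri[of "k + l"]
        by (simp add: algebra_simps power2_eq_square)
      then show ?thesis by simp
    qed
    also have "p powi ((3 * tri k + k + r * k + tri r) + (3 * l\<^sup>2 - (2 * r - 1) * l))
        = p powi (3 * tri k + k + r * k + tri r) * p powi (3 * l\<^sup>2 - (2 * r - 1) * l)"
      using assms by (simp add: power_int_add)
    finally show ?thesis by (simp add: S_def e_def mult_ac)
  qed
  have "((\<lambda>(r, k, l). S r k * e r l) has_sum \<Theta>1 * \<Theta>2) ({0, 1, 2} \<times> UNIV \<times> UNIV)"
    using prod
  proof (subst has_sum_reindex_bij_witness[where j = "\<lambda>(r, k, l). (k + r - 2 * l, k + l)"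
        and i = "\<lambda>(m, n). ((m + 2 * n) mod 3, (m + 2 * n) div 3, n - (m + 2 * n) div 3)"
        and h = "\<lambda>(m, n). theta_term p x m * theta_term (p\<^sup>2) (p * x\<^sup>2) n" and T = "UNIV \<times> UNIV"])
    fix a :: "int \<times> int \<times> int" assume a: "a \<in> {0, 1, 2} \<times> UNIV \<times> UNIV"
    obtain r k l where a_eq: "a = (r, k, l)" by (cases a)
    have "(k + r - 2 * l) + 2 * (k + l) = r + k * 3" by simp
    moreover have "(r + k * 3) mod 3 = r" "(r + k * 3) div 3 = k"
      using a by (auto simp: a_eq)
    ultimately show "(case case a of (r, k, l) \<Rightarrow> (k + r - 2 * l, k + l) of
        (m, n) \<Rightarrow> ((m + 2 * n) mod 3, (m + 2 * n) div 3, n - (m + 2 * n) div 3)) = a"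
      unfolding a_eq by (simp only: prod.case) simp
  next
    fix b :: "int \<times> int"
    obtain m n where b_eq: "b = (m, n)" by (cases b)
    define s where "s = m + 2 * n"
    have "s = 3 * (s div 3) + s mod 3" by simp
    moreover have "d + r - 2 * (n - d) = m" if "s = 3 * d + r" for d r
      using that by (simp add: s_def)
    ultimately have "s div 3 + s mod 3 - 2 * (n - s div 3) = m" by blast
    then show "(case case b of (m, n) \<Rightarrow> ((m + 2 * n) mod 3, (m + 2 * n) div 3, n - (m + 2 * n) div 3) of
        (r, k, l) \<Rightarrow> (k + r - 2 * l, k + l)) = b"
      unfolding b_eq by (simp add: s_def[symmetric])
    have "s mod 3 = 0 \<or> s mod 3 = 1 \<or> s mod 3 = 2" by presburger
    then show "(case b of (m, n) \<Rightarrow> ((m + 2 * n) mod 3, (m + 2 * n) div 3, n - (m + 2 * n) div 3)) \<in> {0, 1, 2} \<times> UNIV \<times> UNIV"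
      unfolding b_eq by (simp add: s_def[symmetric])
  qed (auto simp: term_eq split: prod.splits)
  moreover have S_abs: "(\<lambda>k. norm (S r k)) summable_on UNIV" for r
  proof -
    have "S r k = ((-1) powi r * x powi r * p powi tri r) * theta_term (p ^ 3) (- (x ^ 3 * p powi (1 + r))) k" for k
    proof -
      have "theta_term (p ^ 3) (- (x ^ 3 * p powi (1 + r))) k
          = (x ^ 3) powi k * ((p powi (1 + r)) powi k * (p ^ 3) powi tri k)"
        by (simp only: theta_term_def power_int_mult_distrib minus_minus mult.assoc)
      also have "\<dots> = x powi (3 * k) * (p powi ((1 + r) * k) * p powi (3 * tri k))"
        by (simp only: power_int_of_power power_int_mult[of _ "1 + r"] of_nat_numeral)
      also have "\<dots> = x powi (3 * k) * p powi (3 * tri k + k + r * k)"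
        using assms by (simp add: power_int_add[symmetric] algebra_simps)
      finally show ?thesis using assms by (simp add: S_def power_int_add mult_ac)
    qed
    moreover from assms p2 have "(\<lambda>k. norm (theta_term (p ^ 3) (- (x ^ 3 * p powi (1 + r))) k)) summable_on UNIV"
      by (intro abs_summable_theta_term) auto
    then have "(\<lambda>k. norm ((-1) powi r * x powi r * p powi tri r)
        * norm (theta_term (p ^ 3) (- (x ^ 3 * p powi (1 + r))) k)) summable_on UNIV"
      by (rule summable_on_cmult_right)
    ultimately show ?thesis by (simp only: norm_mult)
  qed
  have e_has: "(e 0 has_sum E) UNIV" "(e 1 has_sum E) UNIV" "(e 2 has_sum 0) UNIV"
  proof -
    have "e 0 = (\<lambda>l. (-1) powi l * p powi (3 * l\<^sup>2 + l))"
      "e 1 = (\<lambda>l. (-1) powi l * p powi (3 * l\<^sup>2 - l))"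
      "e 2 = (\<lambda>l. (-1) powi l * p powi (3 * l\<^sup>2 - 3 * l))"
      by (simp_all add: e_def fun_eq_iff)
    then show "(e 0 has_sum E) UNIV" "(e 1 has_sum E) UNIV" "(e 2 has_sum 0) UNIV"
      using pentagonal_sums[OF assms(1,2)] by (simp_all only: E_def)
  qed
  have e_abs: "(\<lambda>l. norm (e r l)) summable_on UNIV" if "r \<in> {0, 1, 2}" for r
  proof -
    have "e r summable_on UNIV"
      using that e_has[THEN has_sum_imp_summable] by (elim insertE) auto
    then show ?thesis by (simp only: summable_on_iff_abs_summable_on_complex)
  qed
  have S_has: "(S r has_sum infsum (S r) UNIV) UNIV" for r
    by (rule has_sum_infsum[OF abs_summable_summable[OF S_abs]])
  \<comment> \<open>The inner series over \<open>l\<close> does not involve \<open>k\<close>; for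
    \<open>r = 2\<close> it is the vanishing one, which leaves the two terms \<open>r = 0, 1\<close>
    of the final factor \<open>1 - x * p powi k\<close>.\<close>
  define Er where "Er r = (if r = 2 then 0 else E)" for r :: int
  have "((\<lambda>r. infsum (S r) UNIV * Er r) has_sum \<Theta>1 * \<Theta>2) {0, 1, 2 :: int}"
  proof (rule has_sum_SigmaD)
    show "((\<lambda>(r, k, l). S r k * e r l) has_sum \<Theta>1 * \<Theta>2) ({0, 1, 2} \<times> UNIV \<times> UNIV)" by fact
    fix r :: int assume r: "r \<in> {0, 1, 2}"
    have "((\<lambda>(k, l). S r k * e r l) has_sum infsum (S r) UNIV * Er r) (UNIV \<times> UNIV)"
      by (rule has_sum_times[OF S_abs e_abs[OF r] S_has]) (use e_has r in \<open>auto simp: Er_def\<close>)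
    then show "((\<lambda>y. case (r, y) of (r, k, l) \<Rightarrow> S r k * e r l) has_sum infsum (S r) UNIV * Er r) (UNIV \<times> UNIV)"
      by simp
  qed
  then have "\<Theta>1 * \<Theta>2 = (infsum (S 0) UNIV + infsum (S 1) UNIV) * E"
    using has_sum_unique[OF _ has_sum_finiteI[OF _ refl, of "{0, 1, 2}" "\<lambda>r. infsum (S r) UNIV * Er r"]]
    by (simp add: Er_def distrib_right)
  moreover have "E \<noteq> 0" unfolding E_def by (rule qpoch_inf_nonzero[OF p2(1) p2(1)])
  ultimately have "infsum (S 0) UNIV + infsum (S 1) UNIV
      = \<Theta>1 * qpoch_inf (p * x\<^sup>2) (p\<^sup>2) * qpoch_inf (p / x\<^sup>2) (p\<^sup>2)"
    by (simp add: \<Theta>2_def mult_ac)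
  moreover have "((\<lambda>k. S 0 k + S 1 k) has_sum infsum (S 0) UNIV + infsum (S 1) UNIV) UNIV"
    by (intro has_sum_add S_has)
  moreover have "S 0 k + S 1 k = x powi (3 * k) * p powi (3 * tri k + k) * (1 - x * p powi k)" for k
  proof -
    have "tri 0 = 0" "tri 1 = 0" by (simp_all add: tri_def)
    then have "S 0 k = x powi (3 * k) * p powi (3 * tri k + k)"
      "S 1 k = - (x powi (3 * k + 1)) * p powi ((3 * tri k + k) + k)"
      by (simp_all add: S_def)
    moreover have "p powi ((3 * tri k + k) + k) = p powi (3 * tri k + k) * p powi k"
      using assms by (intro power_int_add) auto
    moreover have "x powi (3 * k + 1) = x powi (3 * k) * x"
      using assms by (simp add: power_int_add)
    ultimately show ?thesis by (simp only:) (simp add: algebra_simps)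
  qed
  ultimately show ?thesis by (simp add: \<Theta>1_def)
qed

section \<open>Bailey pairs\<close>

text \<open>With \<open>rqp p n = 1 / (p; p)\<^sub>n\<close> (zero for \<open>n < 0\<close>), the \<open>j\<close>-th term is a \<open>p\<close>-binomial coefficient
  up to the factor \<open>(p; p)\<^sub>L\<close>, so \<open>gsum\<close> inherits the \<open>q\<close>-Pascal rules.\<close>

definition gsum :: "complex \<Rightarrow> int \<Rightarrow> int \<Rightarrow> int \<Rightarrow> complex" where
  "gsum p L s e = (\<Sum>\<^sub>\<infinity>j. p powi (6 * j\<^sup>2 + e * j) * rqp p (s - 3 * j) * rqp p (L - s + 3 * j))"

lemma gsum_has_sum:
  "((\<lambda>j. p powi (6 * j\<^sup>2 + e * j) * rqp p (s - 3 * j) * rqp p (L - s + 3 * j)) has_sum gsum p L s e) UNIV"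
  unfolding gsum_def
proof (intro has_sum_infsum finite_nonzero_values_imp_summable_on)
  have "{j \<in> UNIV. p powi (6 * j\<^sup>2 + e * j) * rqp p (s - 3 * j) * rqp p (L - s + 3 * j) \<noteq> 0}
      \<subseteq> {- \<bar>s - L\<bar> .. \<bar>s\<bar>}"
  proof (intro subsetI, elim CollectE conjE)
    fix j assume "p powi (6 * j\<^sup>2 + e * j) * rqp p (s - 3 * j) * rqp p (L - s + 3 * j) \<noteq> 0"
    then have "rqp p (s - 3 * j) \<noteq> 0" "rqp p (L - s + 3 * j) \<noteq> 0" by auto
    then have "s - 3 * j \<ge> 0" "L - s + 3 * j \<ge> 0" by (auto simp: rqp_def split: if_splits)
    then show "j \<in> {- \<bar>s - L\<bar> .. \<bar>s\<bar>}" by auto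
  qed
  then show "finite {j \<in> UNIV. p powi (6 * j\<^sup>2 + e * j) * rqp p (s - 3 * j) * rqp p (L - s + 3 * j) \<noteq> 0}"
    using finite_subset by blast
qed

text \<open>Replacing \<open>j\<close> by \<open>- j\<close> exchanges the two factors
  \<open>rqp\<close>.\<close>

lemma gsum_reflect: "gsum p L s e = gsum p L (L - s) (- e)"
proof -
  have "((\<lambda>j. p powi (6 * j\<^sup>2 + e * j) * rqp p (s - 3 * j) * rqp p (L - s + 3 * j)) has_sum gsum p L (L - s) (- e)) UNIV"
    by (subst has_sum_reindex_bij_witness[where i = uminus and j = uminus and T = UNIV
          and h = "\<lambda>j. p powi (6 * j\<^sup>2 + (- e) * j) * rqp p ((L - s) - 3 * j) * rqp p (L - (L - s) + 3 * j)"])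
       (use gsum_has_sum[of p "- e" "L - s" L] in \<open>auto simp: mult_ac\<close>)
  then show ?thesis by (rule has_sum_unique[OF gsum_has_sum])
qed

lemma mult_diff_eqI:
  fixes a :: complex
  assumes "a * x = u" "a * y = v"
  shows "a * (x - c * y) = u - c * v"
  using assms by (auto simp: algebra_simps)

context
  fixes p :: complex
  assumes p: "norm p < 1" "p \<noteq> 0"
begin

text \<open>Shift of \<open>j\<close> by one: 3 is the step in \<open>s\<close>, and 12 is the
  linear coefficient in the difference of \<open>6 * j\<^sup>2\<close>.\<close>

lemma gsum_shift: "gsum p L s e = p powi (6 + e) * gsum p L (s - 3) (e + 12)"
proof -
  have "((\<lambda>j. p powi (6 + e) * (p powi (6 * j\<^sup>2 + (e + 12) * j) * rqp p (s - 3 - 3 * j) * rqp p (L - (s - 3) + 3 * j)))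
      has_sum p powi (6 + e) * gsum p L (s - 3) (e + 12)) UNIV"
    by (intro has_sum_cmult_right gsum_has_sum)
  moreover have "p powi (6 + e) * (p powi (6 * j\<^sup>2 + (e + 12) * j) * rqp p (s - 3 - 3 * j) * rqp p (L - (s - 3) + 3 * j))
      = p powi (6 * (j + 1)\<^sup>2 + e * (j + 1)) * rqp p (s - 3 * (j + 1)) * rqp p (L - s + 3 * (j + 1))" for j
  proof -
    have "p powi (6 + e) * p powi (6 * j\<^sup>2 + (e + 12) * j) = p powi ((6 + e) + (6 * j\<^sup>2 + (e + 12) * j))"
      using p by (simp add: power_int_add)
    also have "(6 + e) + (6 * j\<^sup>2 + (e + 12) * j) = 6 * (j + 1)\<^sup>2 + e * (j + 1)"
      by (simp add: algebra_simps power2_eq_square)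
    finally show ?thesis by (simp add: algebra_simps)
  qed
  ultimately have "((\<lambda>j. p powi (6 * (j + 1)\<^sup>2 + e * (j + 1)) * rqp p (s - 3 * (j + 1)) * rqp p (L - s + 3 * (j + 1)))
      has_sum p powi (6 + e) * gsum p L (s - 3) (e + 12)) UNIV"
    by simp
  then have "((\<lambda>j. p powi (6 * j\<^sup>2 + e * j) * rqp p (s - 3 * j) * rqp p (L - s + 3 * j))
      has_sum p powi (6 + e) * gsum p L (s - 3) (e + 12)) UNIV"
    by (subst (asm) has_sum_reindex_bij_witness[where i = "\<lambda>j. j - 1" and j = "\<lambda>j. j + 1" and T = UNIV
          and h = "\<lambda>j. p powi (6 * j\<^sup>2 + e * j) * rqp p (s - 3 * j) * rqp p (L - s + 3 * j)"]) auto
  then show ?thesis by (rule has_sum_unique[OF gsum_has_sum])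
qed

text \<open>If \<open>a\<close> and \<open>b\<close> are the powers of \<open>p\<close> attached to
  the two factorials, then \<open>a * b = p powi (L + 1)\<close> and
  \<open>1 - a * b = (1 - a) + a * (1 - b)\<close>; each bracket lowers one factorial by
  \<open>rqp_rec\<close>.\<close>

lemma gsum_pascal1:
  "(1 - p powi (L + 1)) * gsum p (L + 1) s e = gsum p L (s - 1) e + p powi s * gsum p L s (e - 3)"
proof -
  have "((\<lambda>j. (1 - p powi (L + 1)) * (p powi (6 * j\<^sup>2 + e * j) * rqp p (s - 3 * j) * rqp p (L + 1 - s + 3 * j)))
      has_sum (1 - p powi (L + 1)) * gsum p (L + 1) s e) UNIV"
    by (intro has_sum_cmult_right gsum_has_sum)
  moreover have "(1 - p powi (L + 1)) * (p powi (6 * j\<^sup>2 + e * j) * rqp p (s - 3 * j) * rqp p (L + 1 - s + 3 * j))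
      = p powi (6 * j\<^sup>2 + e * j) * rqp p (s - 1 - 3 * j) * rqp p (L - (s - 1) + 3 * j)
        + p powi s * (p powi (6 * j\<^sup>2 + (e - 3) * j) * rqp p (s - 3 * j) * rqp p (L - s + 3 * j))" for j
  proof -
    have 1: "rqp p (s - 1 - 3 * j) = (1 - p powi (s - 3 * j)) * rqp p (s - 3 * j)"
      using rqp_rec[OF p(1), of "s - 3 * j"] by (simp add: algebra_simps)
    have 2: "rqp p (L - s + 3 * j) = (1 - p powi (L + 1 - s + 3 * j)) * rqp p (L + 1 - s + 3 * j)"
      using rqp_rec[OF p(1), of "L + 1 - s + 3 * j"] by (simp add: algebra_simps)
    have 3: "p powi (s - 3 * j) * p powi (L + 1 - s + 3 * j) = p powi (L + 1)"
      using p by (simp add: power_int_add[symmetric])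
    have 4: "p powi s * p powi (6 * j\<^sup>2 + (e - 3) * j) = p powi (6 * j\<^sup>2 + e * j) * p powi (s - 3 * j)"
      using p by (simp add: power_int_add[symmetric] algebra_simps)
    define a b x where "a = p powi (s - 3 * j)" and "b = p powi (L + 1 - s + 3 * j)"
      and "x = p powi (6 * j\<^sup>2 + e * j)"
    define u v where "u = rqp p (s - 3 * j)" and "v = rqp p (L + 1 - s + 3 * j)"
    have 5: "L - (s - 1) + 3 * j = L + 1 - s + 3 * j" by simp
    have "p powi (6 * j\<^sup>2 + e * j) * rqp p (s - 1 - 3 * j) * rqp p (L - (s - 1) + 3 * j)
        + p powi s * (p powi (6 * j\<^sup>2 + (e - 3) * j) * rqp p (s - 3 * j) * rqp p (L - s + 3 * j))
        = x * ((1 - a) * u) * v + (x * a) * u * ((1 - b) * v)"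
      unfolding 1 2 5 mult.assoc[symmetric] 4 by (simp only: a_def b_def x_def u_def v_def)
    also have "\<dots> = (1 - a * b) * (x * u * v)" by (simp add: algebra_simps)
    finally show ?thesis unfolding a_def b_def 3 by (simp add: x_def u_def v_def)
  qed
  ultimately have "((\<lambda>j. p powi (6 * j\<^sup>2 + e * j) * rqp p (s - 1 - 3 * j) * rqp p (L - (s - 1) + 3 * j)
        + p powi s * (p powi (6 * j\<^sup>2 + (e - 3) * j) * rqp p (s - 3 * j) * rqp p (L - s + 3 * j)))
      has_sum (1 - p powi (L + 1)) * gsum p (L + 1) s e) UNIV"
    by simp
  then show ?thesis
    by (rule has_sum_unique) (intro has_sum_add has_sum_cmult_right gsum_has_sum)
qed

text \<open>The other splitting \<open>(1 - b) + b * (1 - a)\<close>, obtained from the first rule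
  by reflection.\<close>

lemma gsum_pascal2:
  "(1 - p powi (L + 1)) * gsum p (L + 1) s e = gsum p L s e + p powi (L + 1 - s) * gsum p L (s - 1) (e + 3)"
proof -
  have "gsum p (L + 1) s e = gsum p (L + 1) (L + 1 - s) (- e)"
    by (rule gsum_reflect)
  moreover have "gsum p L s e = gsum p L (L + 1 - s - 1) (- e)"
    using gsum_reflect[of p L s e] by simp
  moreover have "gsum p L (s - 1) (e + 3) = gsum p L (L + 1 - s) (- e - 3)"
    using gsum_reflect[of p L "s - 1" "e + 3"] by (simp add: algebra_simps)
  ultimately show ?thesis
    using gsum_pascal1[of L "L + 1 - s" "- e"] by simp
qed

lemma one_minus_powi_nonzero: "k > 0 \<Longrightarrow> 1 - p powi k \<noteq> 0"
proof
  assume "k > 0" "1 - p powi k = 0"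
  then obtain n where n: "k = int n" "n > 0" using zero_less_imp_eq_int by blast
  then have "norm (p powi k) < 1" using norm_power_less_1[OF p(1)] by simp
  then show False using \<open>1 - p powi k = 0\<close> by simp
qed

lemma rqp_rec': "rqp p k = (1 - p powi (k + 1)) * rqp p (k + 1)"
  using rqp_rec[OF p(1), of "k + 1"] by simp

lemma gsum_0: "gsum p 0 0 e = 1" "gsum p 0 (- 1) e = 0"
proof -
  have "((\<lambda>j. p powi (6 * j\<^sup>2 + e * j) * rqp p (0 - 3 * j) * rqp p (0 - 0 + 3 * j)) has_sum 1) UNIV"
    by (rule has_sum_finite_neutralI[of "{0}"]) (auto simp: rqp_def)
  then show "gsum p 0 0 e = 1" by (rule has_sum_unique[OF gsum_has_sum])
  have "((\<lambda>j. p powi (6 * j\<^sup>2 + e * j) * rqp p (- 1 - 3 * j) * rqp p (0 - (- 1) + 3 * j)) has_sum 0) UNIV"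
  proof (rule has_sum_0)
    fix j :: int
    have "- 1 - 3 * j < 0 \<or> 0 - (- 1) + 3 * j < 0" by presburger
    then show "p powi (6 * j\<^sup>2 + e * j) * rqp p (- 1 - 3 * j) * rqp p (0 - (- 1) + 3 * j) = 0"
      by (auto simp: rqp_def)
  qed
  then show "gsum p 0 (- 1) e = 0" by (rule has_sum_unique[OF gsum_has_sum])
qed

text \<open>After one Pascal step the two additional terms are mirror images of each other under
  \<open>gsum_reflect\<close> and cancel.\<close>

lemma gsum_bailey1_step:
  "(1 - p powi (2 * n + 2)) * (gsum p (2 * n + 2) (n + 1) 1 - p * gsum p (2 * n + 2) n 5)
     = gsum p (2 * n + 1) n 1 - p * gsum p (2 * n + 1) (n - 1) 5"
proof -
  have L: "2 * n + 2 = (2 * n + 1) + 1" by simp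
  have 1: "(1 - p powi (2 * n + 2)) * gsum p (2 * n + 2) (n + 1) 1
      = gsum p (2 * n + 1) n 1 + p powi (n + 1) * gsum p (2 * n + 1) (n + 1) (- 2)"
    unfolding L by (subst gsum_pascal1) simp
  have 2: "(1 - p powi (2 * n + 2)) * gsum p (2 * n + 2) n 5
      = gsum p (2 * n + 1) (n - 1) 5 + p powi n * gsum p (2 * n + 1) n 2"
    unfolding L by (subst gsum_pascal1) simp
  have 3: "gsum p (2 * n + 1) (n + 1) (- 2) = gsum p (2 * n + 1) n 2"
    by (subst gsum_reflect) simp
  have 4: "p powi (n + 1) = p * p powi n"
    using p by (simp add: power_int_add)
  show ?thesis
    unfolding mult_diff_eqI[OF 1 2] 3 4 by (simp add: ring_distribs)
qed

text \<open>Now the second Pascal rule is the right one: the additional terms agree after a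
  reflection followed by an index shift.\<close>

lemma gsum_bailey2_step:
  "(1 - p powi (2 * n + 1)) * (gsum p (2 * n + 1) n 1 - p * gsum p (2 * n + 1) (n - 1) 5)
     = gsum p (2 * n) n 1 - p * gsum p (2 * n) (n - 1) 5"
proof -
  have 1: "(1 - p powi (2 * n + 1)) * gsum p (2 * n + 1) n 1
      = gsum p (2 * n) n 1 + p powi (n + 1) * gsum p (2 * n) (n - 1) 4"
    by (subst gsum_pascal2) simp
  have 2: "(1 - p powi (2 * n + 1)) * gsum p (2 * n + 1) (n - 1) 5
      = gsum p (2 * n) (n - 1) 5 + p powi (n + 2) * gsum p (2 * n) (n - 2) 8"
    by (subst gsum_pascal2) (simp add: algebra_simps)
  have 3: "gsum p (2 * n) (n - 1) 4 = p powi 2 * gsum p (2 * n) (n - 2) 8"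
    by (subst gsum_reflect, subst gsum_shift) simp
  have 4: "p powi (n + 1) * p powi 2 = p * p powi (n + 2)"
    using p by (simp add: power_int_add eval_nat_numeral)
  have 5: "p powi (n + 1) * (p powi 2 * x) = p * (p powi (n + 2) * x)" for x
    using 4 by (simp only: mult.assoc[symmetric])
  show ?thesis
    unfolding mult_diff_eqI[OF 1 2] 3 5 by (simp add: ring_distribs)
qed

text \<open>A Bailey pair in bilateral form: the coefficients are \<open>p^(6j^2+j)\<close> at index
  \<open>3j\<close> and \<open>-p^(6j^2+5j+1)\<close> at \<open>3j+1\<close>. The step lemmas raise
  \<open>L\<close> by one and alternate between even and odd \<open>L\<close>, and
  \<open>rqp\<close> satisfies the same recurrence, so both identities come out of one
  induction.\<close>

lemma gsum_bailey1: "gsum p (2 * int n) (int n) 1 - p * gsum p (2 * int n) (int n - 1) 5 = rqp p (2 * int n)"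
  and gsum_bailey2: "gsum p (2 * int n + 1) (int n) 1 - p * gsum p (2 * int n + 1) (int n - 1) 5 = rqp p (2 * int n + 1)"
proof -
  have step2: "gsum p (2 * int n + 1) (int n) 1 - p * gsum p (2 * int n + 1) (int n - 1) 5 = rqp p (2 * int n + 1)"
    if "gsum p (2 * int n) (int n) 1 - p * gsum p (2 * int n) (int n - 1) 5 = rqp p (2 * int n)" for n
  proof -
    have "(1 - p powi (2 * int n + 1)) * (gsum p (2 * int n + 1) (int n) 1 - p * gsum p (2 * int n + 1) (int n - 1) 5)
       = (1 - p powi (2 * int n + 1)) * rqp p (2 * int n + 1)"
      unfolding gsum_bailey2_step that by (rule rqp_rec')
    then show ?thesis using one_minus_powi_nonzero[of "2 * int n + 1"] by simp
  qed
  have 1: "gsum p (2 * int n) (int n) 1 - p * gsum p (2 * int n) (int n - 1) 5 = rqp p (2 * int n)" for n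
  proof (induction n)
    case 0
    then show ?case by (simp add: gsum_0 rqp_def)
  next
    case (Suc n)
    have "(1 - p powi (2 * int n + 2)) * (gsum p (2 * int n + 2) (int n + 1) 1 - p * gsum p (2 * int n + 2) (int n) 5)
       = (1 - p powi (2 * int n + 2)) * rqp p (2 * int n + 2)"
      unfolding gsum_bailey1_step step2[OF Suc] using rqp_rec'[of "2 * int n + 1"] by (simp add: add.commute)
    then have "gsum p (2 * int n + 2) (int n + 1) 1 - p * gsum p (2 * int n + 2) (int n) 5 = rqp p (2 * int n + 2)"
      using one_minus_powi_nonzero[of "2 * int n + 2"] by simp
    then show ?case by (simp add: algebra_simps)
  qed
  show "gsum p (2 * int n) (int n) 1 - p * gsum p (2 * int n) (int n - 1) 5 = rqp p (2 * int n)" by (rule 1)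
  show "gsum p (2 * int n + 1) (int n) 1 - p * gsum p (2 * int n + 1) (int n - 1) 5 = rqp p (2 * int n + 1)"
    by (rule step2[OF 1])
qed

text \<open>One Pascal rule is applied to each sum, chosen so that the terms free of a power of
  \<open>p\<close> coincide and cancel. The rest is a power of \<open>p\<close> times
  \<open>gsum_bailey2\<close> at level \<open>2 * n - 1\<close>, which is why \<open>n = 0\<close>
  stands apart.\<close>

lemma gsum_bailey3:
  "gsum p (2 * int n) (int n) 2 - gsum p (2 * int n) (int n - 1) 2 = p ^ n * rqp p (2 * int n)"
proof (cases n)
  case 0
  then show ?thesis by (simp add: gsum_0 rqp_def)
next
  case (Suc m)
  define k where "k = int m"
  have L: "2 * k + 2 = (2 * k + 1) + 1" by simp
  have 1: "(1 - p powi (2 * k + 2)) * gsum p (2 * k + 2) (k + 1) 2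
      = gsum p (2 * k + 1) k 2 + p powi (k + 1) * gsum p (2 * k + 1) (k + 1) (- 1)"
    unfolding L by (subst gsum_pascal1) simp
  have 2: "(1 - p powi (2 * k + 2)) * gsum p (2 * k + 2) k 2
      = gsum p (2 * k + 1) k 2 + p powi (k + 2) * gsum p (2 * k + 1) (k - 1) 5"
    unfolding L by (subst gsum_pascal2) (simp add: algebra_simps)
  have 3: "gsum p (2 * k + 1) (k + 1) (- 1) = gsum p (2 * k + 1) k 1"
    by (subst gsum_reflect) simp
  have 4: "p powi (k + 2) = p powi (k + 1) * p"
    using p power_int_add_1[of p "k + 1"] by (simp add: algebra_simps)
  have "(1 - p powi (2 * k + 2)) * (gsum p (2 * k + 2) (k + 1) 2 - gsum p (2 * k + 2) k 2)
     = p powi (k + 1) * (gsum p (2 * k + 1) k 1 - p * gsum p (2 * k + 1) (k - 1) 5)"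
    using mult_diff_eqI[OF 1 2, of 1] unfolding 3 4 by (simp add: ring_distribs)
  also have "\<dots> = p powi (k + 1) * rqp p (2 * k + 1)"
    unfolding k_def gsum_bailey2 ..
  also have "\<dots> = (1 - p powi (2 * k + 2)) * (p powi (k + 1) * rqp p (2 * k + 2))"
    using rqp_rec'[of "2 * k + 1"] by (simp add: add.commute)
  finally have "gsum p (2 * k + 2) (k + 1) 2 - gsum p (2 * k + 2) k 2 = p powi (k + 1) * rqp p (2 * k + 2)"
    using one_minus_powi_nonzero[of "2 * k + 2"] by (simp add: k_def)
  moreover have "p powi (k + 1) = p ^ n" using p by (simp add: Suc k_def power_int_add)
  ultimately show ?thesis by (simp add: Suc k_def algebra_simps)
qed

text \<open>The same device as for \<open>gsum_bailey3\<close>, now falling back on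
  \<open>gsum_bailey1\<close>.\<close>

lemma gsum_bailey4:
  "gsum p (2 * int n + 1) (int n) 4 - gsum p (2 * int n + 1) (int n - 1) 4 = p ^ n * rqp p (2 * int n + 1)"
proof -
  define k where "k = int n"
  have 1: "(1 - p powi (2 * k + 1)) * gsum p (2 * k + 1) k 4
      = gsum p (2 * k) (k - 1) 4 + p powi k * gsum p (2 * k) k 1"
    by (subst gsum_pascal1) simp
  have 2: "(1 - p powi (2 * k + 1)) * gsum p (2 * k + 1) (k - 1) 4
      = gsum p (2 * k) (k - 1) 4 + p powi (k + 2) * gsum p (2 * k) (k - 2) 7"
    by (subst gsum_pascal2) (simp add: algebra_simps)
  have 3: "gsum p (2 * k) (k - 1) 5 = p * gsum p (2 * k) (k - 2) 7"
    by (subst gsum_reflect, subst gsum_shift) simp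
  have 4: "p powi (k + 2) = p powi k * (p * p)"
    using p by (simp add: power_int_add power2_eq_square)
  have "(1 - p powi (2 * k + 1)) * (gsum p (2 * k + 1) k 4 - gsum p (2 * k + 1) (k - 1) 4)
     = p powi k * (gsum p (2 * k) k 1 - p * gsum p (2 * k) (k - 1) 5)"
    using mult_diff_eqI[OF 1 2, of 1] unfolding 3 4 by (simp add: ring_distribs)
  also have "\<dots> = p powi k * rqp p (2 * k)"
    unfolding k_def gsum_bailey1 ..
  also have "\<dots> = (1 - p powi (2 * k + 1)) * (p powi k * rqp p (2 * k + 1))"
    using rqp_rec'[of "2 * k"] by simp
  finally show ?thesis
    using one_minus_powi_nonzero[of "2 * k + 1"] by (simp add: k_def)
qed

end

section \<open>The limiting case of Bailey's lemma\<close>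

lemma has_sum_diff:
  fixes f g :: "'a \<Rightarrow> complex"
  assumes "(f has_sum S) A" "(g has_sum T) A"
  shows "((\<lambda>x. f x - g x) has_sum (S - T)) A"
  using has_sum_add[OF assms(1), of "\<lambda>x. - g x" "- T"] assms(2) by (simp add: has_sum_uminus)

lemma bounded_rqp:
  assumes "norm p < 1"
  obtains C where "C > 0" "\<And>k. norm (rqp p k) \<le> C"
proof -
  obtain C where C: "C > 0" "\<And>n. norm (inverse (qpoch p p n)) \<le> C"
    using bounded_inverse_qpoch[OF assms assms] by blast
  then have "norm (rqp p k) \<le> C" for k by (auto simp: rqp_def less_imp_le simp del: norm_inverse)
  with C(1) show ?thesis using that by blast
qed

lemma choose_2_add: "(m + n) choose 2 = (m choose 2) + (n choose 2) + m * n"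
  by (induction n) (simp_all add: Suc_choose_2 numeral_2_eq_2[symmetric])

text \<open>Bailey's weight \<open>(\<rho>)_n (\<sigma>)_n (a p / (\<rho> \<sigma>))^n\<close> for
  \<open>a = p ^ \<delta>\<close> in the limit where \<sigma> tends to infinity; the limit is the
  source of \<open>p ^ (n choose 2)\<close> and of the sign.\<close>

definition bailey_weight :: "complex \<Rightarrow> complex \<Rightarrow> nat \<Rightarrow> nat \<Rightarrow> complex" where
  "bailey_weight p \<rho> \<delta> n = qpoch \<rho> p n * p ^ (n choose 2) * (- (p ^ (1 + \<delta>) / \<rho>)) ^ n"

lemma summable_bailey_weight:
  assumes "norm p < 1"
  shows "summable (\<lambda>n. norm (bailey_weight p \<rho> \<delta> n))"
proof -
  obtain C where C: "C > 0" "\<And>n. norm (qpoch \<rho> p n) \<le> C"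
    using bounded_qpoch[OF assms] by blast
  define r where "r = norm (p ^ (1 + \<delta>) / \<rho>)"
  show ?thesis
  proof (rule summable_comparison_test')
    show "summable (\<lambda>n. C * (r ^ n * norm p ^ (n choose 2)))"
      using assms by (intro summable_mult summable_power_choose_2) (auto simp: r_def)
    fix n
    have "norm (bailey_weight p \<rho> \<delta> n) = norm (qpoch \<rho> p n) * (r ^ n * norm p ^ (n choose 2))"
      unfolding bailey_weight_def r_def by (simp only: norm_mult norm_power norm_minus_cancel mult_ac)
    also have "\<dots> \<le> C * (r ^ n * norm p ^ (n choose 2))"
      using C by (intro mult_right_mono) (auto simp: r_def)
    finally show "norm (norm (bailey_weight p \<rho> \<delta> n)) \<le> C * (r ^ n * norm p ^ (n choose 2))"
      by simp
  qed
qed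

text \<open>The terms with \<open>n < r\<close> vanish. After \<open>n = k + r\<close> the series is
  the 1phi1 sum with \<open>c = p^(2r+\<delta>+1)\<close> and
  \<open>y = 1 / (\<rho> p^r)\<close>.\<close>

lemma bailey_weight_sum_nat:
  assumes p: "norm p < 1" "p \<noteq> 0" and \<rho>: "\<rho> \<noteq> 0"
  shows "((\<lambda>n. bailey_weight p \<rho> \<delta> n * (rqp p (int n - int r) * rqp p (int n + int r + int \<delta>)))
     has_sum bailey_weight p \<rho> \<delta> r * qpoch_inf (p ^ (r + \<delta> + 1) / \<rho>) p / qpoch_inf p p) UNIV"
proof (rule norm_summable_imp_has_sum)
  obtain C where C: "C > 0" "\<And>k. norm (rqp p k) \<le> C"
    using bounded_rqp[OF p(1)] by blast
  show "summable (\<lambda>n. norm (bailey_weight p \<rho> \<delta> n * (rqp p (int n - int r) * rqp p (int n + int r + int \<delta>))))"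
  proof (rule summable_comparison_test')
    show "summable (\<lambda>n. norm (bailey_weight p \<rho> \<delta> n) * (C * C))"
      by (intro summable_mult2 summable_bailey_weight p)
    fix n
    have "norm (bailey_weight p \<rho> \<delta> n) * (norm (rqp p (int n - int r)) * norm (rqp p (int n + int r + int \<delta>)))
       \<le> norm (bailey_weight p \<rho> \<delta> n) * (C * C)"
      using C by (intro mult_left_mono mult_mono) (auto simp: less_imp_le)
    then show "norm (norm (bailey_weight p \<rho> \<delta> n * (rqp p (int n - int r) * rqp p (int n + int r + int \<delta>))))
       \<le> norm (bailey_weight p \<rho> \<delta> n) * (C * C)"
      by (simp add: norm_mult)
  qed
next
  define c where "c = p ^ (2 * r + \<delta> + 1)"
  define A where "A = \<rho> * p ^ r"
  define f where "f n = bailey_weight p \<rho> \<delta> n * (rqp p (int n - int r) * rqp p (int n + int r + int \<delta>))" for n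
  define K where "K = bailey_weight p \<rho> \<delta> r * inverse (qpoch p p (2 * r + \<delta>))"
  have A: "A \<noteq> 0" using p \<rho> by (simp add: A_def)
  have c: "norm c < 1" unfolding c_def by (rule norm_power_less_1[OF p(1)]) simp
  have cA: "c * (1 / A) = p ^ (r + \<delta> + 1) / \<rho>"
    using p \<rho> by (simp add: c_def A_def divide_simps mult_2 power_add)
  have "(\<lambda>k. K * ((- c) ^ k * p ^ (k choose 2) * inverse (qpoch p p k) * inverse (qpoch c p k)
            * (\<Prod>i<k. 1 / A - p ^ i))) sums (K * (qpoch_inf (c * (1 / A)) p / qpoch_inf c p))"
    by (intro sums_mult sum_1phi1 p c)
  moreover have "K * ((- c) ^ k * p ^ (k choose 2) * inverse (qpoch p p k) * inverse (qpoch c p k)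
            * (\<Prod>i<k. 1 / A - p ^ i)) = f (k + r)" for k
  proof -
    have 1: "(\<Prod>i<k. 1 / A - p ^ i) = qpoch A p k / A ^ k"
    proof -
      have "(\<Prod>i<k. 1 / A - p ^ i) = (\<Prod>i<k. (1 - A * p ^ i) / A)"
        using A by (intro prod.cong) (auto simp: field_simps)
      then show ?thesis by (simp add: qpoch_def prod_dividef)
    qed
    have 2: "rqp p (int (k + r) - int r) = inverse (qpoch p p k)"
      by (simp add: rqp_def)
    have "int (k + r) + int r + int \<delta> = int (2 * r + \<delta> + k)" by simp
    then have 3: "rqp p (int (k + r) + int r + int \<delta>) = inverse (qpoch p p (2 * r + \<delta>)) * inverse (qpoch c p k)"
      by (simp only: rqp_of_nat qpoch_add) (simp add: c_def mult_ac)
    have 4: "bailey_weight p \<rho> \<delta> (k + r) = bailey_weight p \<rho> \<delta> r * qpoch A p k * p ^ (k choose 2)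
        * (p ^ (r * k) * (- (p ^ (1 + \<delta>) / \<rho>)) ^ k)"
      unfolding bailey_weight_def add.commute[of k r] qpoch_add choose_2_add power_add
      by (simp add: A_def mult_ac)
    have 5: "p ^ (r * k) * (- (p ^ (1 + \<delta>) / \<rho>)) ^ k = (- c) ^ k / A ^ k"
    proof -
      have "p ^ (r * k) * (- (p ^ (1 + \<delta>) / \<rho>)) ^ k = (p ^ r * (- (p ^ (1 + \<delta>) / \<rho>))) ^ k"
        by (simp only: power_mult power_mult_distrib)
      also have "p ^ r * (- (p ^ (1 + \<delta>) / \<rho>)) = (- c) / A"
        using p \<rho> by (simp add: c_def A_def divide_simps mult_2 power_add)
      finally show ?thesis by (simp only: power_divide)
    qed
    show ?thesis unfolding f_def 1 2 3 4 5 K_def by (simp add: mult_ac)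
  qed
  ultimately have "(\<lambda>k. f (k + r)) sums (K * (qpoch_inf (c * (1 / A)) p / qpoch_inf c p))"
    by simp
  moreover have "(\<Sum>i<r. f i) = 0"
    by (rule sum.neutral) (auto simp: f_def rqp_def)
  ultimately have "f sums (K * (qpoch_inf (c * (1 / A)) p / qpoch_inf c p))"
    by (simp add: sums_iff_shift)
  also have "K * (qpoch_inf (c * (1 / A)) p / qpoch_inf c p)
      = bailey_weight p \<rho> \<delta> r * qpoch_inf (p ^ (r + \<delta> + 1) / \<rho>) p / qpoch_inf p p"
  proof -
    have "qpoch_inf p p = qpoch p p (2 * r + \<delta>) * qpoch_inf c p"
      using qpoch_inf_split[OF p(1), of p "2 * r + \<delta>"] by (simp add: c_def)
    then show ?thesis by (simp only: cA K_def) (simp add: divide_inverse mult_ac)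
  qed
  finally show "f sums (bailey_weight p \<rho> \<delta> r * qpoch_inf (p ^ (r + \<delta> + 1) / \<rho>) p / qpoch_inf p p)" .
qed

text \<open>The Bailey transform is an interchange of the sums over \<open>n\<close> and
  \<open>j\<close>. The bound on \<open>e\<close> gives
  \<open>6 * j\<^sup>2 + e * j \<ge> \<bar>j\<bar>\<close>, so the double series has a summable
  majorant.\<close>

lemma bailey_transform_gsum:
  fixes w :: "nat \<Rightarrow> complex"
  assumes p: "norm p < 1" "p \<noteq> 0"
    and w: "summable (\<lambda>n. norm (w n))"
    and W: "\<And>r. ((\<lambda>n. w n * (rqp p (int n - r) * rqp p (int n + r + int \<delta>))) has_sum W r) UNIV"
    and e: "\<bar>e\<bar> \<le> 5"
  obtains T where "((\<lambda>n. w n * gsum p (2 * int n + int \<delta>) (int n - s) e) has_sum T) UNIV"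
    "((\<lambda>j. p powi (6 * j\<^sup>2 + e * j) * W (s + 3 * j)) has_sum T) UNIV"
proof -
  obtain C where C: "C > 0" "\<And>k. norm (rqp p k) \<le> C"
    using bounded_rqp[OF p(1)] by blast
  define t where "t = (\<lambda>(n, j). w n * (p powi (6 * j\<^sup>2 + e * j) * rqp p (int n - s - 3 * j)
      * rqp p (2 * int n + int \<delta> - (int n - s) + 3 * j)))"
  have pj: "summable (\<lambda>n. norm (complex_of_real (norm p) powi \<bar>int n\<bar>))"
           "summable (\<lambda>n. norm (complex_of_real (norm p) powi \<bar>- int n\<bar>))"
    using p by (simp_all add: norm_power)
  have sj: "(\<lambda>j. norm (complex_of_real (norm p) powi \<bar>j\<bar>)) summable_on UNIV"
    by (rule abs_summable_on_int[OF pj])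
  have sw: "(\<lambda>n. norm (w n)) summable_on UNIV"
    using w by (simp add: summable_on_UNIV_nonneg_real_iff)
  have "(\<lambda>z. (C * C) * norm (w (fst z) * complex_of_real (norm p) powi \<bar>snd z\<bar>)) summable_on UNIV \<times> UNIV"
    by (intro summable_on_cmult_right abs_summable_times sw sj)
  then have "(\<lambda>z. norm (t z)) summable_on UNIV \<times> UNIV"
  proof (rule summable_on_comparison_test)
    fix z :: "nat \<times> int"
    obtain n j where z: "z = (n, j)" by (cases z)
    have "\<bar>j\<bar> \<le> 6 * j\<^sup>2 + e * j"
    proof -
      have "\<bar>j\<bar> \<le> j\<^sup>2"
      proof (cases "j = 0")
        case False
        then have "\<bar>j\<bar> * 1 \<le> \<bar>j\<bar> * \<bar>j\<bar>" by (intro mult_left_mono) auto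
        then show ?thesis by (simp add: power2_eq_square)
      qed simp
      moreover have "- (5 * \<bar>j\<bar>) \<le> e * j"
      proof -
        have "\<bar>e * j\<bar> \<le> 5 * \<bar>j\<bar>" unfolding abs_mult using e by (intro mult_right_mono) auto
        then show ?thesis by linarith
      qed
      ultimately show ?thesis by linarith
    qed
    then have "norm (p powi (6 * j\<^sup>2 + e * j)) \<le> norm p powi \<bar>j\<bar>"
      unfolding norm_power_int using p by (intro power_int_decreasing) auto
    then have "norm (w n) * (norm (p powi (6 * j\<^sup>2 + e * j)) * norm (rqp p (int n - s - 3 * j))
        * norm (rqp p (2 * int n + int \<delta> - (int n - s) + 3 * j)))
      \<le> norm (w n) * (norm p powi \<bar>j\<bar> * C * C)"
      using C by (intro mult_left_mono mult_mono) (auto simp: less_imp_le)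
    then show "norm (t z) \<le> (C * C) * norm (w (fst z) * complex_of_real (norm p) powi \<bar>snd z\<bar>)"
      by (simp add: t_def z norm_mult norm_power_int mult_ac)
  qed (rule norm_ge_zero)
  then have "t summable_on UNIV \<times> UNIV"
    by (rule abs_summable_summable)
  then obtain T where T: "(t has_sum T) (UNIV \<times> UNIV)"
    unfolding summable_on_def by blast
  have "((\<lambda>n. w n * gsum p (2 * int n + int \<delta>) (int n - s) e) has_sum T) UNIV"
  proof (rule has_sum_SigmaD[OF T])
    show "((\<lambda>j. t (n, j)) has_sum w n * gsum p (2 * int n + int \<delta>) (int n - s) e) UNIV" for n
      unfolding t_def prod.case by (intro has_sum_cmult_right gsum_has_sum)
  qed
  moreover have "((\<lambda>j. p powi (6 * j\<^sup>2 + e * j) * W (s + 3 * j)) has_sum T) UNIV"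
  proof (rule has_sum_SigmaD)
    show "((\<lambda>(j, n). t (n, j)) has_sum T) (UNIV \<times> UNIV)"
      using T by (subst (asm) has_sum_swap)
    fix j
    have "((\<lambda>n. p powi (6 * j\<^sup>2 + e * j) * (w n * (rqp p (int n - (s + 3 * j)) * rqp p (int n + (s + 3 * j) + int \<delta>))))
      has_sum p powi (6 * j\<^sup>2 + e * j) * W (s + 3 * j)) UNIV"
      by (intro has_sum_cmult_right W)
    moreover have "p powi (6 * j\<^sup>2 + e * j) * (w n * (rqp p (int n - (s + 3 * j)) * rqp p (int n + (s + 3 * j) + int \<delta>)))
      = t (n, j)" for n
    proof -
      have "int n - (s + 3 * j) = int n - s - 3 * j" "int n + (s + 3 * j) + int \<delta> = 2 * int n + int \<delta> - (int n - s) + 3 * j"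
        by simp_all
      then show ?thesis by (simp only: t_def prod.case mult_ac)
    qed
    ultimately show "((\<lambda>n. case (j, n) of (j, n) \<Rightarrow> t (n, j)) has_sum p powi (6 * j\<^sup>2 + e * j) * W (s + 3 * j)) UNIV"
      by (simp only: prod.case)
  qed
  ultimately show ?thesis by (rule that)
qed

text \<open>All pairs used have coefficients only at indices congruent to 0 and 1 modulo 3, whence a
  difference of two \<open>gsum\<close>. It remains to recognise \<open>S\<close> as a quintuple
  product.\<close>

lemma bailey_sum:
  fixes w :: "nat \<Rightarrow> complex"
  assumes p: "norm p < 1" "p \<noteq> 0"
    and w: "summable (\<lambda>n. norm (w n))"
    and W: "\<And>r. ((\<lambda>n. w n * (rqp p (int n - r) * rqp p (int n + r + int \<delta>))) has_sum W r) UNIV"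
    and e: "\<bar>e1\<bar> \<le> 5" "\<bar>e2\<bar> \<le> 5"
    and \<beta>: "\<And>n. gsum p (2 * int n + int \<delta>) (int n) e1 - c * gsum p (2 * int n + int \<delta>) (int n - 1) e2 = \<beta> n"
    and S: "((\<lambda>j. p powi (6 * j\<^sup>2 + e1 * j) * W (3 * j) - c * (p powi (6 * j\<^sup>2 + e2 * j) * W (3 * j + 1))) has_sum S) UNIV"
  shows "((\<lambda>n. w n * \<beta> n) has_sum S) UNIV"
proof -
  obtain T1 where T1: "((\<lambda>n. w n * gsum p (2 * int n + int \<delta>) (int n - 0) e1) has_sum T1) UNIV"
    "((\<lambda>j. p powi (6 * j\<^sup>2 + e1 * j) * W (0 + 3 * j)) has_sum T1) UNIV"
    using bailey_transform_gsum[OF p w W e(1)] by blast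
  obtain T2 where T2: "((\<lambda>n. w n * gsum p (2 * int n + int \<delta>) (int n - 1) e2) has_sum T2) UNIV"
    "((\<lambda>j. p powi (6 * j\<^sup>2 + e2 * j) * W (1 + 3 * j)) has_sum T2) UNIV"
    using bailey_transform_gsum[OF p w W e(2)] by blast
  have "((\<lambda>j. p powi (6 * j\<^sup>2 + e1 * j) * W (0 + 3 * j) - c * (p powi (6 * j\<^sup>2 + e2 * j) * W (1 + 3 * j)))
      has_sum (T1 - c * T2)) UNIV"
    by (intro has_sum_diff T1 has_sum_cmult_right T2)
  then have "S = T1 - c * T2"
    using S has_sum_unique by (fastforce simp: add.commute)
  moreover have "((\<lambda>n. w n * gsum p (2 * int n + int \<delta>) (int n - 0) e1 - c * (w n * gsum p (2 * int n + int \<delta>) (int n - 1) e2))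
      has_sum (T1 - c * T2)) UNIV"
    by (intro has_sum_diff T1 has_sum_cmult_right T2)
  moreover have "w n * gsum p (2 * int n + int \<delta>) (int n - 0) e1 - c * (w n * gsum p (2 * int n + int \<delta>) (int n - 1) e2)
      = w n * \<beta> n" for n
    by (simp add: \<beta>[symmetric] algebra_simps)
  ultimately show ?thesis by simp
qed

text \<open>The product side of \<open>quintuple_product\<close> at base \<open>q ^ m\<close> and
  \<open>x = q ^ a\<close>.\<close>

definition quint_prod :: "nat \<Rightarrow> nat \<Rightarrow> complex \<Rightarrow> complex" where
  "quint_prod a m q = qpoch_inf (q ^ m) (q ^ m) * qpoch_inf (q ^ a) (q ^ m) * qpoch_inf (q ^ (m - a)) (q ^ m)
     * qpoch_inf (q ^ (m + 2 * a)) (q ^ (2 * m)) * qpoch_inf (q ^ (m - 2 * a)) (q ^ (2 * m))"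

text \<open>Exponent of \<open>q\<close> in the first half of the quintuple series; the second half
  carries the additional \<open>a + m * k\<close>.\<close>

definition quint_exp :: "nat \<Rightarrow> nat \<Rightarrow> int \<Rightarrow> int" where
  "quint_exp a m k = 3 * int a * k + int m * (3 * tri k + k)"

text \<open>The two halves of the series are summed separately, because the applications reindex
  them independently.\<close>

lemma quintuple_product_powers:
  assumes q: "norm q < 1" "q \<noteq> 0" and a: "0 < a" "2 * a < m"
  obtains U V where
    "((\<lambda>k. q powi quint_exp a m k) has_sum U) UNIV"
    "((\<lambda>k. q powi (quint_exp a m k + int a + int m * k)) has_sum V) UNIV"
    "U - V = quint_prod a m q"
proof -
  define P where "P = q ^ m"
  have P: "norm P < 1" "P \<noteq> 0" "norm (P ^ 3) < 1"
    using norm_power_less_1[OF q(1), of m] q a norm_power_less_1[of P 3] by (auto simp: P_def)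
  have th: "(\<lambda>k. q ^ b * theta_term (P ^ 3) (- (q ^ c)) k) summable_on UNIV" for b c
    using P by (intro summable_on_cmult_right abs_summable_summable[OF abs_summable_theta_term]) auto
  have th_eq: "q ^ b * theta_term (P ^ 3) (- (q ^ c)) k = q powi (int b + int c * k + int m * (3 * tri k))" for b c k
  proof -
    have "q ^ b * theta_term (P ^ 3) (- (q ^ c)) k = q powi int b * (q powi (int c * k) * q powi (int m * (3 * tri k)))"
      by (simp only: theta_term_def P_def minus_minus power_int_of_power power_mult[symmetric] of_nat_mult of_nat_numeral mult.assoc power_int_of_nat)
    then show ?thesis using q by (simp add: power_int_add)
  qed
  have "(\<lambda>k. q powi quint_exp a m k) summable_on UNIV"
  proof -
    have e: "quint_exp a m k = int 0 + int (3 * a + m) * k + int m * (3 * tri k)" for k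
      by (simp add: quint_exp_def algebra_simps)
    show ?thesis using th[of 0 "3 * a + m"] by (simp only: th_eq e)
  qed
  then obtain U where U: "((\<lambda>k. q powi quint_exp a m k) has_sum U) UNIV"
    unfolding summable_on_def by blast
  have "(\<lambda>k. q powi (quint_exp a m k + int a + int m * k)) summable_on UNIV"
  proof -
    have e: "quint_exp a m k + int a + int m * k = int a + int (3 * a + 2 * m) * k + int m * (3 * tri k)" for k
      by (simp add: quint_exp_def algebra_simps)
    show ?thesis using th[of a "3 * a + 2 * m"] by (simp only: th_eq e)
  qed
  then obtain V where V: "((\<lambda>k. q powi (quint_exp a m k + int a + int m * k)) has_sum V) UNIV"
    unfolding summable_on_def by blast
  have div: "P / q ^ a = q ^ (m - a)" "P / (q ^ a)\<^sup>2 = q ^ (m - 2 * a)"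
    using q a by (simp_all add: P_def power_diff power_mult[symmetric] mult.commute)
  have "norm (P / q ^ a) < 1" "norm (P / (q ^ a)\<^sup>2) < 1"
    unfolding div using a by (intro norm_power_less_1 q; simp)+
  then have "((\<lambda>k. (q ^ a) powi (3 * k) * P powi (3 * tri k + k) * (1 - q ^ a * P powi k)) has_sum
     (qpoch_inf P P * qpoch_inf (q ^ a) P * qpoch_inf (q ^ (m - a)) P
        * qpoch_inf (P * (q ^ a)\<^sup>2) (P\<^sup>2) * qpoch_inf (q ^ (m - 2 * a)) (P\<^sup>2))) UNIV"
    using quintuple_product[OF P(1,2), of "q ^ a"] q by (simp add: div)
  moreover have "P * (q ^ a)\<^sup>2 = q ^ (m + 2 * a)" "P\<^sup>2 = q ^ (2 * m)"
    by (simp_all add: P_def power_add power_mult[symmetric] mult.commute)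
  moreover have "(q ^ a) powi (3 * k) * P powi (3 * tri k + k) * (1 - q ^ a * P powi k)
      = q powi quint_exp a m k - q powi (quint_exp a m k + int a + int m * k)" for k
  proof -
    have "(q ^ a) powi (3 * k) * P powi (3 * tri k + k) = q powi quint_exp a m k"
      unfolding P_def power_int_of_power quint_exp_def using q
      by (simp add: power_int_add[symmetric] mult_ac)
    moreover have "q ^ a * P powi k = q powi (int a + int m * k)"
      unfolding P_def power_int_of_power using q by (simp add: power_int_add)
    moreover have "q powi quint_exp a m k * q powi (int a + int m * k) = q powi (quint_exp a m k + int a + int m * k)"
      using q by (simp add: power_int_add mult.assoc)
    ultimately show ?thesis by (simp only: right_diff_distrib mult_1_right)
  qed
  ultimately have "((\<lambda>k. q powi quint_exp a m k - q powi (quint_exp a m k + int a + int m * k)) has_sum quint_prod a m q) UNIV"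
    by (simp only: quint_prod_def P_def)
  moreover have "((\<lambda>k. q powi quint_exp a m k - q powi (quint_exp a m k + int a + int m * k)) has_sum (U - V)) UNIV"
    by (rule has_sum_diff[OF U V])
  ultimately have "U - V = quint_prod a m q" using has_sum_unique by blast
  then show ?thesis by (rule that[OF U V])
qed

text \<open>A Bailey sum may run through a half of the quintuple series in reversed order; the
  substitutions \<open>- k\<close> and \<open>- 1 - k\<close> are absorbed here.\<close>

lemma quint_has_sum:
  assumes q: "norm q < 1" "q \<noteq> 0" and a: "0 < a" "2 * a < m"
    and u: "u = quint_exp a m \<or> u = (\<lambda>k. quint_exp a m (- k))"
    and v: "v = (\<lambda>k. quint_exp a m k + int a + int m * k) \<or>
            v = (\<lambda>k. quint_exp a m (- 1 - k) + int a + int m * (- 1 - k))"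
  shows "((\<lambda>k. K * (q powi u k) - K * (q powi v k)) has_sum (K * quint_prod a m q)) UNIV"
proof -
  obtain U V where U: "((\<lambda>k. q powi quint_exp a m k) has_sum U) UNIV"
    and V: "((\<lambda>k. q powi (quint_exp a m k + int a + int m * k)) has_sum V) UNIV"
    and UV: "U - V = quint_prod a m q"
    using quintuple_product_powers[OF q a] by blast
  have bij: "bij_betw uminus UNIV (UNIV :: int set)" "bij_betw (\<lambda>k. - 1 - k) UNIV (UNIV :: int set)"
    by (rule bij_betwI[of _ _ _ uminus]; simp) (rule bij_betwI[of _ _ _ "\<lambda>k. - 1 - k"]; simp)
  have "((\<lambda>k. q powi u k) has_sum U) UNIV"
    using u U has_sum_reindex_bij_betw[OF bij(1), of "\<lambda>k. q powi quint_exp a m k" U] by auto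
  moreover have "((\<lambda>k. q powi v k) has_sum V) UNIV"
    using v V has_sum_reindex_bij_betw[OF bij(2), of "\<lambda>k. q powi (quint_exp a m k + int a + int m * k)" V] by auto
  ultimately have "((\<lambda>k. K * (q powi u k) - K * (q powi v k)) has_sum (K * U - K * V)) UNIV"
    by (intro has_sum_diff has_sum_cmult_right)
  then show ?thesis by (simp only: UV[symmetric] right_diff_distrib)
qed

text \<open>The change of \<open>r\<close> to \<open>- r - \<delta>\<close> swaps the two factors
  \<open>rqp\<close>, so a symmetric \<open>W\<close> extends the formula from nonnegative indices.
  Since \<open>\<delta> \<le> 1\<close>, each negative \<open>r\<close> is sent to a nonnegative
  one.\<close>

lemma bailey_weight_sum:
  assumes p: "norm p < 1" "p \<noteq> 0" and \<rho>: "\<rho> \<noteq> 0"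
    and W: "\<And>r. W (int r) = bailey_weight p \<rho> \<delta> r * qpoch_inf (p ^ (r + \<delta> + 1) / \<rho>) p / qpoch_inf p p"
    and sym: "\<And>r. W (- r - int \<delta>) = W r" and \<delta>: "\<delta> \<le> 1"
  shows "((\<lambda>n. bailey_weight p \<rho> \<delta> n * (rqp p (int n - r) * rqp p (int n + r + int \<delta>))) has_sum W r) UNIV"
proof (cases "r \<ge> 0")
  case True
  then obtain m where "r = int m" using nonneg_int_cases by blast
  then show ?thesis using bailey_weight_sum_nat[OF p \<rho>] by (simp add: W)
next
  case False
  then have "- r - int \<delta> \<ge> 0" using \<delta> by simp
  then obtain m where m: "- r - int \<delta> = int m" using nonneg_int_cases by blast
  then have "W r = W (int m)" using sym[of r] by simp
  moreover have "int n - int m = int n + r + int \<delta>" "int n + int m + int \<delta> = int n - r" for n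
    using m by auto
  then have "((\<lambda>n. bailey_weight p \<rho> \<delta> n * (rqp p (int n + r + int \<delta>) * rqp p (int n - r))) has_sum W (int m)) UNIV"
    using bailey_weight_sum_nat[OF p \<rho>, of \<delta> m] by (simp only: W)
  ultimately show ?thesis
    by (simp only: mult.commute[of "rqp p (int n - r)" for n])
qed

section \<open>Slater type identities\<close>

lemma two_choose_two: "2 * (n choose 2) + n = n\<^sup>2"
  by (induction n) (simp_all add: Suc_choose_2 power2_eq_square numeral_2_eq_2[symmetric])

lemma two_tri_multiples:
  "2 * tri (3 * j) = 9 * j\<^sup>2 - 3 * j" "2 * tri (3 * j + 1) = 9 * j\<^sup>2 + 3 * j" "2 * tri j = j\<^sup>2 - j"
  using two_tri[of "3 * j"] two_tri[of "3 * j + 1"] two_tri[of j]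
  by (simp_all add: algebra_simps power2_eq_square)

lemma rqp_even: "rqp p (2 * int n + int 0) = inverse (qpoch p p (2 * n))"
  using rqp_of_nat[of p "2 * n"] by simp

lemma rqp_odd: "rqp p (2 * int n + int 1) = inverse (qpoch p p (2 * n + 1))"
  using rqp_of_nat[of p "2 * n + 1"] by (simp add: add.commute)

lemma two_quint_exp: "2 * quint_exp a m k = 6 * int a * k + int m * (3 * k\<^sup>2 - k)"
proof -
  have "2 * quint_exp a m k = 6 * int a * k + int m * (3 * (2 * tri k) + 2 * k)"
    by (simp add: quint_exp_def algebra_simps)
  then show ?thesis unfolding two_tri by (simp add: algebra_simps power2_eq_square)
qed

context
  fixes q p :: complex
  assumes q: "norm q < 1" "q \<noteq> 0" and p_def: "p = q\<^sup>2"
begin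

lemma p_bounds: "norm p < 1" "p \<noteq> 0"
  using norm_power_less_1[OF q(1), of 2] q by (auto simp: p_def)

lemma p_powi: "p powi k = q powi (2 * k)"
  by (simp only: p_def power_int_of_power of_nat_numeral)

lemma odd_weight: "bailey_weight p (- q) 0 n = qpoch (- q) p n * q ^ n\<^sup>2"
proof -
  have "- (p ^ (1 + 0) / - q) = q" using q by (simp add: p_def power2_eq_square)
  moreover have "p ^ (n choose 2) * q ^ n = q ^ n\<^sup>2"
    unfolding p_def power_mult[symmetric] power_add[symmetric] two_choose_two ..
  ultimately show ?thesis by (simp only: bailey_weight_def mult.assoc)
qed

text \<open>For \<open>\<rho> = - q\<close> one has \<open>p / \<rho> = \<rho>\<close>: the finite
  product and the tail join to the full \<open>(-q; p)_\<infinity>\<close>, and only the power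
  \<open>q^(r^2)\<close> depends on \<open>r\<close>.\<close>

lemma odd_weight_sum:
  "((\<lambda>n. bailey_weight p (- q) 0 n * (rqp p (int n - r) * rqp p (int n + r + int 0)))
     has_sum (q powi r\<^sup>2 * (qpoch_inf (- q) p / qpoch_inf p p))) UNIV"
proof (rule bailey_weight_sum[OF p_bounds])
  fix r :: nat
  have "p ^ (r + 0 + 1) / - q = - q * p ^ r" using q by (simp add: p_def power2_eq_square)
  moreover have "qpoch_inf (- q) p = qpoch (- q) p r * qpoch_inf (- q * p ^ r) p"
    by (rule qpoch_inf_split[OF p_bounds(1)])
  moreover have "q powi (int r)\<^sup>2 = q ^ r\<^sup>2" by (simp flip: of_nat_power)
  ultimately show "q powi (int r)\<^sup>2 * (qpoch_inf (- q) p / qpoch_inf p p) =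
         bailey_weight p (- q) 0 r * qpoch_inf (p ^ (r + 0 + 1) / - q) p / qpoch_inf p p"
    by (simp only: odd_weight) (simp add: mult_ac)
qed (use q in auto)

text \<open>\<open>odd_weight_sum\<close> with the pair of \<open>gsum_bailey1\<close>: the indices
  \<open>3j\<close> and \<open>3j+1\<close> produce the two halves of the quintuple series.\<close>

lemma slater_117:
  "((\<lambda>n. q ^ n\<^sup>2 * qpoch (- q) p n * inverse (qpoch p p (2 * n)))
     has_sum (qpoch_inf (- q) p / qpoch_inf p p * quint_prod 3 14 q)) UNIV"
proof -
  define K where "K = qpoch_inf (- q) p / qpoch_inf p p"
  have "((\<lambda>n. bailey_weight p (- q) 0 n * rqp p (2 * int n + int 0)) has_sum (K * quint_prod 3 14 q)) UNIV"
  proof (rule bailey_sum[OF p_bounds summable_bailey_weight[OF p_bounds(1)] odd_weight_sum])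
    show "gsum p (2 * int n + int 0) (int n) 1 - p * gsum p (2 * int n + int 0) (int n - 1) 5
        = rqp p (2 * int n + int 0)" for n
      using gsum_bailey1[OF p_bounds, of n] by simp
    have "((\<lambda>j. K * q powi quint_exp 3 14 j - K * q powi (quint_exp 3 14 j + int 3 + int 14 * j))
        has_sum (K * quint_prod 3 14 q)) UNIV"
      by (rule quint_has_sum[OF q]) auto
    moreover have "p powi (6 * j\<^sup>2 + 1 * j) * (q powi (3 * j)\<^sup>2 * (qpoch_inf (- q) p / qpoch_inf p p))
        - p * (p powi (6 * j\<^sup>2 + 5 * j) * (q powi (3 * j + 1)\<^sup>2 * (qpoch_inf (- q) p / qpoch_inf p p)))
      = K * q powi quint_exp 3 14 j - K * q powi (quint_exp 3 14 j + int 3 + int 14 * j)" for j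
    proof -
      have e1: "quint_exp 3 14 j = 2 * (6 * j\<^sup>2 + 1 * j) + (3 * j)\<^sup>2"
        using two_quint_exp[of 3 14 j] by (simp add: algebra_simps power2_eq_square)
      have e2: "quint_exp 3 14 j + int 3 + int 14 * j = 2 + (2 * (6 * j\<^sup>2 + 5 * j) + (3 * j + 1)\<^sup>2)"
        unfolding e1 by (simp add: algebra_simps power2_eq_square)
      have "x * (a * k) - p * (y * (c * k)) = k * (x * a) - k * (p * (y * c))" for a c k x y :: complex
        by (simp add: algebra_simps)
      moreover have "q powi (2 * (6 * j\<^sup>2 + 1 * j) + (3 * j)\<^sup>2) = q powi (2 * (6 * j\<^sup>2 + 1 * j)) * q powi (3 * j)\<^sup>2"
        "q powi (2 * (6 * j\<^sup>2 + 5 * j) + (3 * j + 1)\<^sup>2) = q powi (2 * (6 * j\<^sup>2 + 5 * j)) * q powi (3 * j + 1)\<^sup>2"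
        using q by (intro power_int_add; simp)+
      moreover have "q powi (2 + (2 * (6 * j\<^sup>2 + 5 * j) + (3 * j + 1)\<^sup>2)) = p * q powi (2 * (6 * j\<^sup>2 + 5 * j) + (3 * j + 1)\<^sup>2)"
        using q by (subst power_int_add) (simp_all add: p_def)
      ultimately show ?thesis unfolding e2 unfolding e1 p_powi K_def
        by (simp only:)
    qed
    ultimately show "((\<lambda>j. p powi (6 * j\<^sup>2 + 1 * j) * (q powi (3 * j)\<^sup>2 * (qpoch_inf (- q) p / qpoch_inf p p))
        - p * (p powi (6 * j\<^sup>2 + 5 * j) * (q powi (3 * j + 1)\<^sup>2 * (qpoch_inf (- q) p / qpoch_inf p p))))
       has_sum (K * quint_prod 3 14 q)) UNIV" by (simp only:)
  qed auto
  then show ?thesis unfolding odd_weight rqp_even K_def by (simp add: mult_ac)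
qed

text \<open>\<open>odd_weight_sum\<close> with the pair of \<open>gsum_bailey3\<close>; the first
  half of the quintuple series appears reversed.\<close>

lemma slater_119:
  "((\<lambda>n. q ^ n\<^sup>2 * p ^ n * qpoch (- q) p n * inverse (qpoch p p (2 * n)))
     has_sum (qpoch_inf (- q) p / qpoch_inf p p * quint_prod 1 14 q)) UNIV"
proof -
  define K where "K = qpoch_inf (- q) p / qpoch_inf p p"
  have "((\<lambda>n. bailey_weight p (- q) 0 n * (p ^ n * rqp p (2 * int n + int 0))) has_sum (K * quint_prod 1 14 q)) UNIV"
  proof (rule bailey_sum[OF p_bounds summable_bailey_weight[OF p_bounds(1)] odd_weight_sum])
    show "gsum p (2 * int n + int 0) (int n) 2 - 1 * gsum p (2 * int n + int 0) (int n - 1) 2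
        = (p ^ n * rqp p (2 * int n + int 0))" for n
      using gsum_bailey3[OF p_bounds, of n] by simp
    have "((\<lambda>j. K * q powi quint_exp 1 14 (- j) - K * q powi (quint_exp 1 14 j + int 1 + int 14 * j)) has_sum (K * quint_prod 1 14 q)) UNIV"
      by (rule quint_has_sum[OF q]) auto
    moreover have "p powi (6 * j\<^sup>2 + 2 * j) * (q powi (3 * j)\<^sup>2 * (qpoch_inf (- q) p / qpoch_inf p p)) - 1 * (p powi (6 * j\<^sup>2 + 2 * j) * (q powi (3 * j + 1)\<^sup>2 * (qpoch_inf (- q) p / qpoch_inf p p)))
      = K * q powi quint_exp 1 14 (- j) - K * q powi (quint_exp 1 14 j + int 1 + int 14 * j)" for j
    proof -
      have e1: "quint_exp 1 14 (- j) = 2 * (6 * j\<^sup>2 + 2 * j) + (3 * j)\<^sup>2"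
        using two_quint_exp[of 1 14 "- j"] by (simp add: algebra_simps power2_eq_square)
      have e2: "quint_exp 1 14 j + int 1 + int 14 * j = 2 * (6 * j\<^sup>2 + 2 * j) + (3 * j + 1)\<^sup>2"
        using two_quint_exp[of 1 14 j] by (simp add: algebra_simps power2_eq_square)
      have "x * (a * k) - 1 * (x * (c * k)) = k * (x * a) - k * (x * c)" for a c k x :: complex
        by (simp add: algebra_simps)
      moreover have "q powi (2 * (6 * j\<^sup>2 + 2 * j) + (3 * j)\<^sup>2) = q powi (2 * (6 * j\<^sup>2 + 2 * j)) * q powi (3 * j)\<^sup>2"
        "q powi (2 * (6 * j\<^sup>2 + 2 * j) + (3 * j + 1)\<^sup>2) = q powi (2 * (6 * j\<^sup>2 + 2 * j)) * q powi (3 * j + 1)\<^sup>2"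
        using q by (intro power_int_add; simp)+
      ultimately show ?thesis unfolding e2 unfolding e1 p_powi K_def
        by (simp only:)
    qed
    ultimately show "((\<lambda>j. p powi (6 * j\<^sup>2 + 2 * j) * (q powi (3 * j)\<^sup>2 * (qpoch_inf (- q) p / qpoch_inf p p)) - 1 * (p powi (6 * j\<^sup>2 + 2 * j) * (q powi (3 * j + 1)\<^sup>2 * (qpoch_inf (- q) p / qpoch_inf p p))))
       has_sum (K * quint_prod 1 14 q)) UNIV" by (simp only:)
  qed auto
  then show ?thesis unfolding odd_weight rqp_even K_def by (simp add: mult_ac)
qed

lemma odd_weight': "bailey_weight p (- (q ^ 3)) 1 n = qpoch (- (q ^ 3)) p n * q ^ n\<^sup>2"
proof -
  have "- (p ^ (1 + 1) / - (q ^ 3)) = q" using q by (simp add: p_def eval_nat_numeral)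
  moreover have "p ^ (n choose 2) * q ^ n = q ^ n\<^sup>2"
    unfolding p_def power_mult[symmetric] power_add[symmetric] two_choose_two ..
  ultimately show ?thesis by (simp only: bailey_weight_def mult.assoc)
qed

lemma one_plus_q: "1 + q \<noteq> 0"
  using q by (metis add_eq_0_iff norm_minus_cancel norm_one order_less_irrefl)

lemma qpoch_minus_q_Suc: "qpoch (- q) p (Suc n) = (1 + q) * qpoch (- (q ^ 3)) p n"
  by (simp add: qpoch_Suc' p_def eval_nat_numeral)

text \<open>For \<open>\<delta> = 1\<close> and \<open>\<rho> = - (q ^ 3)\<close> one has
  \<open>p^2 / \<rho> = - q\<close>, and \<open>(1 + q) (-q^3; p)_r = (-q; p)_r (1 + q p^r)\<close>.
  The last factor is what turns a single power of \<open>q\<close> into two.\<close>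

lemma odd_weight_sum':
  "((\<lambda>n. bailey_weight p (- (q ^ 3)) 1 n * (rqp p (int n - r) * rqp p (int n + r + int 1)))
     has_sum ((q powi r\<^sup>2 + q powi (r + 1)\<^sup>2) * (qpoch_inf (- q) p / qpoch_inf p p / (1 + q)))) UNIV"
proof (rule bailey_weight_sum[OF p_bounds])
  fix r :: nat
  have 1: "p ^ (r + 1 + 1) / - (q ^ 3) = - q * p ^ r" using q by (simp add: p_def eval_nat_numeral)
  have 2: "(1 + q) * qpoch (- (q ^ 3)) p r = qpoch (- q) p r * (1 + q * p ^ r)"
    using qpoch_minus_q_Suc[of r] by (simp add: qpoch_Suc)
  have 3: "qpoch_inf (- q) p = qpoch (- q) p r * qpoch_inf (- q * p ^ r) p"
    by (rule qpoch_inf_split[OF p_bounds(1)])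
  have 4: "q powi (int r)\<^sup>2 = q ^ r\<^sup>2" by (simp flip: of_nat_power)
  have 5: "q powi (int r + 1)\<^sup>2 = q ^ r\<^sup>2 * (q * p ^ r)"
  proof -
    have "(int r + 1)\<^sup>2 = int (r\<^sup>2 + (1 + 2 * r))" by (simp add: power2_eq_square algebra_simps)
    then show ?thesis by (simp only: power_int_of_nat) (simp add: power_add power_mult p_def)
  qed
  have "(1 + q) * ((q ^ r\<^sup>2 + q ^ r\<^sup>2 * (q * p ^ r)) * (qpoch_inf (- q) p / qpoch_inf p p / (1 + q)))
      = q ^ r\<^sup>2 * (qpoch (- q) p r * (1 + q * p ^ r)) * qpoch_inf (- q * p ^ r) p / qpoch_inf p p"
  proof -
    have "(1 + q) * (u * (v / (1 + q))) = u * v" for u v using one_plus_q by simp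
    then show ?thesis by (simp only: 3) (simp add: algebra_simps add_divide_distrib)
  qed
  also have "\<dots> = (1 + q) * (qpoch (- (q ^ 3)) p r * q ^ r\<^sup>2 * qpoch_inf (- q * p ^ r) p / qpoch_inf p p)"
    unfolding 2[symmetric] by (simp add: mult_ac)
  finally show "(q powi (int r)\<^sup>2 + q powi (int r + 1)\<^sup>2) * (qpoch_inf (- q) p / qpoch_inf p p / (1 + q)) =
         bailey_weight p (- (q ^ 3)) 1 r * qpoch_inf (p ^ (r + 1 + 1) / - (q ^ 3)) p / qpoch_inf p p"
    unfolding odd_weight' 1 4 5 using mult_left_cancel[OF one_plus_q] by blast
next
  fix r :: int
  have "(- r - int 1)\<^sup>2 = (r + 1)\<^sup>2" "(- r - int 1 + 1)\<^sup>2 = r\<^sup>2"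
    by (simp_all add: power2_eq_square algebra_simps)
  then show "(q powi (- r - int 1)\<^sup>2 + q powi (- r - int 1 + 1)\<^sup>2) * (qpoch_inf (- q) p / qpoch_inf p p / (1 + q))
      = (q powi r\<^sup>2 + q powi (r + 1)\<^sup>2) * (qpoch_inf (- q) p / qpoch_inf p p / (1 + q))"
    by (simp only: add.commute)
qed (use q in auto)

text \<open>Both sums in \<open>gsum_bailey4\<close> have the same \<open>e\<close>, so of the four
  powers the two with \<open>(3j+1)^2\<close> cancel and a quintuple series is left. The denominator
  \<open>1 + q\<close> is absorbed into the numerator of length \<open>Suc n\<close>.\<close>

lemma slater_118:
  "((\<lambda>n. q ^ n\<^sup>2 * p ^ n * qpoch (- q) p (Suc n) * inverse (qpoch p p (2 * n + 1)))
     has_sum (qpoch_inf (- q) p / qpoch_inf p p * quint_prod 5 14 q)) UNIV"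
proof -
  define K where "K = qpoch_inf (- q) p / qpoch_inf p p / (1 + q)"
  have "((\<lambda>n. bailey_weight p (- (q ^ 3)) 1 n * (p ^ n * rqp p (2 * int n + int 1))) has_sum (K * quint_prod 5 14 q)) UNIV"
  proof (rule bailey_sum[OF p_bounds summable_bailey_weight[OF p_bounds(1)] odd_weight_sum'])
    show "gsum p (2 * int n + int 1) (int n) 4 - 1 * gsum p (2 * int n + int 1) (int n - 1) 4
        = (p ^ n * rqp p (2 * int n + int 1))" for n
      using gsum_bailey4[OF p_bounds, of n] by simp
    have "((\<lambda>j. K * q powi quint_exp 5 14 j - K * q powi (quint_exp 5 14 (- 1 - j) + int 5 + int 14 * (- 1 - j))) has_sum (K * quint_prod 5 14 q)) UNIV"
      by (rule quint_has_sum[OF q]) auto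
    moreover have "p powi (6 * j\<^sup>2 + 4 * j) * ((q powi (3 * j)\<^sup>2 + q powi (3 * j + 1)\<^sup>2) * (qpoch_inf (- q) p / qpoch_inf p p / (1 + q))) - 1 * (p powi (6 * j\<^sup>2 + 4 * j) * ((q powi (3 * j + 1)\<^sup>2 + q powi (3 * j + 1 + 1)\<^sup>2) * (qpoch_inf (- q) p / qpoch_inf p p / (1 + q))))
      = K * q powi quint_exp 5 14 j - K * q powi (quint_exp 5 14 (- 1 - j) + int 5 + int 14 * (- 1 - j))" for j
    proof -
      have e1: "quint_exp 5 14 j = 2 * (6 * j\<^sup>2 + 4 * j) + (3 * j)\<^sup>2"
        using two_quint_exp[of 5 14 j] by (simp add: algebra_simps power2_eq_square)
      have e2: "quint_exp 5 14 (- 1 - j) + int 5 + int 14 * (- 1 - j) = 2 * (6 * j\<^sup>2 + 4 * j) + (3 * j + 1 + 1)\<^sup>2"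
        using two_quint_exp[of 5 14 "- 1 - j"] by (simp add: algebra_simps power2_eq_square)
      have "x * ((a + b) * k) - 1 * (x * ((b + c) * k)) = k * (x * a) - k * (x * c)" for a b c k x :: complex
        by (simp add: algebra_simps)
      moreover have "q powi (2 * (6 * j\<^sup>2 + 4 * j) + (3 * j)\<^sup>2) = q powi (2 * (6 * j\<^sup>2 + 4 * j)) * q powi (3 * j)\<^sup>2"
        "q powi (2 * (6 * j\<^sup>2 + 4 * j) + (3 * j + 1 + 1)\<^sup>2) = q powi (2 * (6 * j\<^sup>2 + 4 * j)) * q powi (3 * j + 1 + 1)\<^sup>2"
        using q by (intro power_int_add; simp)+
      ultimately show ?thesis unfolding e2 unfolding e1 p_powi K_def
        by (simp only:)
    qed
    ultimately show "((\<lambda>j. p powi (6 * j\<^sup>2 + 4 * j) * ((q powi (3 * j)\<^sup>2 + q powi (3 * j + 1)\<^sup>2) * (qpoch_inf (- q) p / qpoch_inf p p / (1 + q))) - 1 * (p powi (6 * j\<^sup>2 + 4 * j) * ((q powi (3 * j + 1)\<^sup>2 + q powi (3 * j + 1 + 1)\<^sup>2) * (qpoch_inf (- q) p / qpoch_inf p p / (1 + q)))))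
       has_sum (K * quint_prod 5 14 q)) UNIV" by (simp only:)
  qed auto
  from has_sum_cmult_right[OF this, of "1 + q"]
  have "((\<lambda>n. q ^ n\<^sup>2 * p ^ n * ((1 + q) * qpoch (- (q ^ 3)) p n) * inverse (qpoch p p (2 * n + 1)))
     has_sum (((1 + q) * K) * quint_prod 5 14 q)) UNIV"
    unfolding odd_weight' rqp_odd by (simp only: mult_ac)
  moreover have "(1 + q) * K = qpoch_inf (- q) p / qpoch_inf p p"
    using one_plus_q by (simp add: K_def)
  ultimately show ?thesis by (simp only: qpoch_minus_q_Suc)
qed

end

context
  fixes p :: complex
  assumes p: "norm p < 1" "p \<noteq> 0"
begin

lemma even_weight: "bailey_weight p (- p) \<delta> n = qpoch (- p) p n * p ^ ((n choose 2) + \<delta> * n)"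
proof -
  have "- (p ^ (1 + \<delta>) / - p) = p ^ \<delta>" using p by simp
  then show ?thesis by (simp only: bailey_weight_def power_add power_mult mult.assoc)
qed

text \<open>Here \<open>p / \<rho> = - 1\<close>, so the tail \<open>(-p^r; p)_\<infinity>\<close>
  begins one factor early; its first factor \<open>1 + p ^ r\<close> gives the two powers.\<close>

lemma even_weight_sum0:
  "((\<lambda>n. bailey_weight p (- p) 0 n * (rqp p (int n - r) * rqp p (int n + r + int 0)))
     has_sum ((p powi tri r + p powi (tri r + r)) * (qpoch_inf (- p) p / qpoch_inf p p))) UNIV"
proof (rule bailey_weight_sum[OF p])
  fix r :: nat
  have 1: "p ^ (r + 0 + 1) / - p = - (p ^ r)" using p by simp
  have 2: "qpoch_inf (- (p ^ r)) p = (1 + p ^ r) * qpoch_inf (- p * p ^ r) p"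
    using qpoch_inf_rec[OF p(1), of "- (p ^ r)"] by (simp add: mult.commute)
  have 3: "qpoch_inf (- p) p = qpoch (- p) p r * qpoch_inf (- p * p ^ r) p"
    by (rule qpoch_inf_split[OF p(1)])
  have 4: "p powi (tri (int r) + int r) = p ^ (r choose 2) * p ^ r"
    using p by (simp add: tri_of_nat power_int_add)
  show "(p powi tri (int r) + p powi (tri (int r) + int r)) * (qpoch_inf (- p) p / qpoch_inf p p) =
         bailey_weight p (- p) 0 r * qpoch_inf (p ^ (r + 0 + 1) / - p) p / qpoch_inf p p"
    unfolding even_weight 1 2 3 4 by (simp add: tri_of_nat algebra_simps add_divide_distrib)
next
  fix r :: int
  show "(p powi tri (- r - int 0) + p powi (tri (- r - int 0) + (- r - int 0))) * (qpoch_inf (- p) p / qpoch_inf p p)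
      = (p powi tri r + p powi (tri r + r)) * (qpoch_inf (- p) p / qpoch_inf p p)"
    by (simp add: tri_uminus add.commute)
qed (use p in auto)

text \<open>With \<open>\<delta> = 1\<close> one has \<open>p^2 / \<rho> = \<rho>\<close>, so finite
  product and tail fit together and a single power remains.\<close>

lemma even_weight_sum1:
  "((\<lambda>n. bailey_weight p (- p) 1 n * (rqp p (int n - r) * rqp p (int n + r + int 1)))
     has_sum (p powi (tri r + r) * (qpoch_inf (- p) p / qpoch_inf p p))) UNIV"
proof (rule bailey_weight_sum[OF p])
  fix r :: nat
  have 1: "p ^ (r + 1 + 1) / - p = - p * p ^ r" using p by simp
  have 3: "qpoch_inf (- p) p = qpoch (- p) p r * qpoch_inf (- p * p ^ r) p"
    by (rule qpoch_inf_split[OF p(1)])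
  have 4: "p powi (tri (int r) + int r) = p ^ ((r choose 2) + 1 * r)"
    using p by (simp add: tri_of_nat power_int_add power_add)
  show "p powi (tri (int r) + int r) * (qpoch_inf (- p) p / qpoch_inf p p) =
         bailey_weight p (- p) 1 r * qpoch_inf (p ^ (r + 1 + 1) / - p) p / qpoch_inf p p"
    unfolding even_weight 1 3 4 by (simp add: mult_ac)
next
  fix r :: int
  have "2 * (tri (- r - int 1) + (- r - int 1)) = 2 * (tri r + r)"
    unfolding distrib_left two_tri by (simp add: algebra_simps)
  then have "tri (- r - int 1) + (- r - int 1) = tri r + r"
    by (rule mult_left_cancel[THEN iffD1, rotated]) simp
  then show "p powi (tri (- r - int 1) + (- r - int 1)) * (qpoch_inf (- p) p / qpoch_inf p p)
      = p powi (tri r + r) * (qpoch_inf (- p) p / qpoch_inf p p)"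
    by (simp only:)
qed (use p in auto)

text \<open>The pair is that of \<open>gsum_bailey3\<close>, and
  \<open>tri (3 * j + 1) = tri (3 * j) + 3 * j\<close> makes the two middle ones of the four powers
  cancel.\<close>

lemma slater_81:
  "((\<lambda>n. p ^ (n choose 2) * p ^ n * qpoch (- p) p n * inverse (qpoch p p (2 * n)))
     has_sum (qpoch_inf (- p) p / qpoch_inf p p * quint_prod 1 7 p)) UNIV"
proof -
  define K where "K = qpoch_inf (- p) p / qpoch_inf p p"
  have "((\<lambda>n. bailey_weight p (- p) 0 n * (p ^ n * rqp p (2 * int n + int 0))) has_sum (K * quint_prod 1 7 p)) UNIV"
  proof (rule bailey_sum[OF p summable_bailey_weight[OF p(1)] even_weight_sum0])
    show "gsum p (2 * int n + int 0) (int n) 2 - 1 * gsum p (2 * int n + int 0) (int n - 1) 2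
        = (p ^ n * rqp p (2 * int n + int 0))" for n
      using gsum_bailey3[OF p, of n] by simp
    have "((\<lambda>j. K * p powi quint_exp 1 7 (- j) - K * p powi (quint_exp 1 7 j + int 1 + int 7 * j)) has_sum (K * quint_prod 1 7 p)) UNIV"
      by (rule quint_has_sum[OF p]) auto
    moreover have "p powi (6 * j\<^sup>2 + 2 * j) * ((p powi tri (3 * j) + p powi (tri (3 * j) + 3 * j)) * (qpoch_inf (- p) p / qpoch_inf p p)) - 1 * (p powi (6 * j\<^sup>2 + 2 * j) * ((p powi tri (3 * j + 1) + p powi (tri (3 * j + 1) + (3 * j + 1))) * (qpoch_inf (- p) p / qpoch_inf p p)))
      = K * p powi quint_exp 1 7 (- j) - K * p powi (quint_exp 1 7 j + int 1 + int 7 * j)" for j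
    proof -
      have e1: "quint_exp 1 7 (- j) = 6 * j\<^sup>2 + 2 * j + tri (3 * j)"
        using two_quint_exp[of 1 7 "- j"] two_tri_multiples(1)[of j] by (simp add: algebra_simps power2_eq_square)
      have e2: "quint_exp 1 7 j + int 1 + int 7 * j = 6 * j\<^sup>2 + 2 * j + (tri (3 * j + 1) + (3 * j + 1))"
        using two_quint_exp[of 1 7 j] two_tri_multiples(2)[of j] by (simp add: algebra_simps power2_eq_square)
      have e3: "tri (3 * j + 1) = tri (3 * j) + 3 * j"
        using two_tri_multiples[of j] by simp
      have "x * ((a + b) * k) - 1 * (x * ((b + c) * k)) = k * (x * a) - k * (x * c)" for a b c k x :: complex
        by (simp add: algebra_simps)
      moreover have "p powi (6 * j\<^sup>2 + 2 * j + tri (3 * j)) = p powi (6 * j\<^sup>2 + 2 * j) * p powi tri (3 * j)"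
        "p powi (6 * j\<^sup>2 + 2 * j + (tri (3 * j) + 3 * j + (3 * j + 1))) = p powi (6 * j\<^sup>2 + 2 * j) * p powi (tri (3 * j) + 3 * j + (3 * j + 1))"
        using p by (intro power_int_add; simp)+
      ultimately show ?thesis unfolding e2 unfolding e1 e3 K_def
        by (simp only:)
    qed
    ultimately show "((\<lambda>j. p powi (6 * j\<^sup>2 + 2 * j) * ((p powi tri (3 * j) + p powi (tri (3 * j) + 3 * j)) * (qpoch_inf (- p) p / qpoch_inf p p)) - 1 * (p powi (6 * j\<^sup>2 + 2 * j) * ((p powi tri (3 * j + 1) + p powi (tri (3 * j + 1) + (3 * j + 1))) * (qpoch_inf (- p) p / qpoch_inf p p))))
       has_sum (K * quint_prod 1 7 p)) UNIV" by (simp only:)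
  qed auto
  then show ?thesis unfolding even_weight rqp_even K_def by (simp add: mult_ac)
qed

text \<open>\<open>even_weight_sum1\<close> with the pair of \<open>gsum_bailey2\<close>, where each
  index contributes one power.\<close>

lemma slater_80:
  "((\<lambda>n. p ^ (n choose 2) * p ^ n * qpoch (- p) p n * inverse (qpoch p p (2 * n + 1)))
     has_sum (qpoch_inf (- p) p / qpoch_inf p p * quint_prod 2 7 p)) UNIV"
proof -
  define K where "K = qpoch_inf (- p) p / qpoch_inf p p"
  have "((\<lambda>n. bailey_weight p (- p) 1 n * rqp p (2 * int n + int 1)) has_sum (K * quint_prod 2 7 p)) UNIV"
  proof (rule bailey_sum[OF p summable_bailey_weight[OF p(1)] even_weight_sum1])
    show "gsum p (2 * int n + int 1) (int n) 1 - p * gsum p (2 * int n + int 1) (int n - 1) 5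
        = rqp p (2 * int n + int 1)" for n
      using gsum_bailey2[OF p, of n] by simp
    have "((\<lambda>j. K * p powi quint_exp 2 7 j - K * p powi (quint_exp 2 7 j + int 2 + int 7 * j)) has_sum (K * quint_prod 2 7 p)) UNIV"
      by (rule quint_has_sum[OF p]) auto
    moreover have "p powi (6 * j\<^sup>2 + 1 * j) * (p powi (tri (3 * j) + 3 * j) * (qpoch_inf (- p) p / qpoch_inf p p)) - p * (p powi (6 * j\<^sup>2 + 5 * j) * (p powi (tri (3 * j + 1) + (3 * j + 1)) * (qpoch_inf (- p) p / qpoch_inf p p)))
      = K * p powi quint_exp 2 7 j - K * p powi (quint_exp 2 7 j + int 2 + int 7 * j)" for j
    proof -
      have e1: "quint_exp 2 7 j = 6 * j\<^sup>2 + 1 * j + (tri (3 * j) + 3 * j)"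
        using two_quint_exp[of 2 7 j] two_tri_multiples(1)[of j] by (simp add: algebra_simps power2_eq_square)
      have e2: "quint_exp 2 7 j + int 2 + int 7 * j = 1 + (6 * j\<^sup>2 + 5 * j + (tri (3 * j + 1) + (3 * j + 1)))"
        using two_quint_exp[of 2 7 j] two_tri_multiples(2)[of j] by (simp add: algebra_simps power2_eq_square)
      have "x * (a * k) - p * (y * (c * k)) = k * (x * a) - k * (p * (y * c))" for a c k x y :: complex
        by (simp add: algebra_simps)
      moreover have "p powi (6 * j\<^sup>2 + 1 * j + (tri (3 * j) + 3 * j)) = p powi (6 * j\<^sup>2 + 1 * j) * p powi (tri (3 * j) + 3 * j)"
        "p powi (6 * j\<^sup>2 + 5 * j + (tri (3 * j + 1) + (3 * j + 1))) = p powi (6 * j\<^sup>2 + 5 * j) * p powi (tri (3 * j + 1) + (3 * j + 1))"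
        using p by (intro power_int_add; simp)+
      moreover have "p powi (1 + (6 * j\<^sup>2 + 5 * j + (tri (3 * j + 1) + (3 * j + 1)))) = p * p powi (6 * j\<^sup>2 + 5 * j + (tri (3 * j + 1) + (3 * j + 1)))"
        using p by (subst power_int_add) simp_all
      ultimately show ?thesis unfolding e2 unfolding e1 K_def
        by (simp only:)
    qed
    ultimately show "((\<lambda>j. p powi (6 * j\<^sup>2 + 1 * j) * (p powi (tri (3 * j) + 3 * j) * (qpoch_inf (- p) p / qpoch_inf p p)) - p * (p powi (6 * j\<^sup>2 + 5 * j) * (p powi (tri (3 * j + 1) + (3 * j + 1)) * (qpoch_inf (- p) p / qpoch_inf p p))))
       has_sum (K * quint_prod 2 7 p)) UNIV" by (simp only:)
  qed auto
  then show ?thesis unfolding even_weight rqp_odd K_def by (simp add: power_add mult_2 mult_ac)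
qed

text \<open>\<open>even_weight_sum1\<close> with the pair of \<open>gsum_bailey4\<close>; the second
  half of the quintuple series appears under \<open>j\<close> to \<open>- 1 - j\<close>.\<close>

lemma slater_82:
  "((\<lambda>n. p ^ (n choose 2) * p ^ (2 * n) * qpoch (- p) p n * inverse (qpoch p p (2 * n + 1)))
     has_sum (qpoch_inf (- p) p / qpoch_inf p p * quint_prod 3 7 p)) UNIV"
proof -
  define K where "K = qpoch_inf (- p) p / qpoch_inf p p"
  have "((\<lambda>n. bailey_weight p (- p) 1 n * (p ^ n * rqp p (2 * int n + int 1))) has_sum (K * quint_prod 3 7 p)) UNIV"
  proof (rule bailey_sum[OF p summable_bailey_weight[OF p(1)] even_weight_sum1])
    show "gsum p (2 * int n + int 1) (int n) 4 - 1 * gsum p (2 * int n + int 1) (int n - 1) 4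
        = (p ^ n * rqp p (2 * int n + int 1))" for n
      using gsum_bailey4[OF p, of n] by simp
    have "((\<lambda>j. K * p powi quint_exp 3 7 j - K * p powi (quint_exp 3 7 (- 1 - j) + int 3 + int 7 * (- 1 - j))) has_sum (K * quint_prod 3 7 p)) UNIV"
      by (rule quint_has_sum[OF p]) auto
    moreover have "p powi (6 * j\<^sup>2 + 4 * j) * (p powi (tri (3 * j) + 3 * j) * (qpoch_inf (- p) p / qpoch_inf p p)) - 1 * (p powi (6 * j\<^sup>2 + 4 * j) * (p powi (tri (3 * j + 1) + (3 * j + 1)) * (qpoch_inf (- p) p / qpoch_inf p p)))
      = K * p powi quint_exp 3 7 j - K * p powi (quint_exp 3 7 (- 1 - j) + int 3 + int 7 * (- 1 - j))" for j
    proof -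
      have e1: "quint_exp 3 7 j = 6 * j\<^sup>2 + 4 * j + (tri (3 * j) + 3 * j)"
        using two_quint_exp[of 3 7 j] two_tri_multiples(1)[of j] by (simp add: algebra_simps power2_eq_square)
      have e2: "quint_exp 3 7 (- 1 - j) + int 3 + int 7 * (- 1 - j) = 6 * j\<^sup>2 + 4 * j + (tri (3 * j + 1) + (3 * j + 1))"
        using two_quint_exp[of 3 7 "- 1 - j"] two_tri_multiples(2)[of j] by (simp add: algebra_simps power2_eq_square)
      have "x * (a * k) - 1 * (x * (c * k)) = k * (x * a) - k * (x * c)" for a c k x :: complex
        by (simp add: algebra_simps)
      moreover have "p powi (6 * j\<^sup>2 + 4 * j + (tri (3 * j) + 3 * j)) = p powi (6 * j\<^sup>2 + 4 * j) * p powi (tri (3 * j) + 3 * j)"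
        "p powi (6 * j\<^sup>2 + 4 * j + (tri (3 * j + 1) + (3 * j + 1))) = p powi (6 * j\<^sup>2 + 4 * j) * p powi (tri (3 * j + 1) + (3 * j + 1))"
        using p by (intro power_int_add; simp)+
      ultimately show ?thesis unfolding e2 unfolding e1 K_def
        by (simp only:)
    qed
    ultimately show "((\<lambda>j. p powi (6 * j\<^sup>2 + 4 * j) * (p powi (tri (3 * j) + 3 * j) * (qpoch_inf (- p) p / qpoch_inf p p)) - 1 * (p powi (6 * j\<^sup>2 + 4 * j) * (p powi (tri (3 * j + 1) + (3 * j + 1)) * (qpoch_inf (- p) p / qpoch_inf p p))))
       has_sum (K * quint_prod 3 7 p)) UNIV" by (simp only:)
  qed auto
  moreover have "p ^ (2 * n) = p ^ n * p ^ n" for n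
    by (simp add: mult_2 power_add)
  ultimately show ?thesis unfolding even_weight rqp_odd K_def by (simp add: power_add mult_ac)
qed

end

section \<open>The double sums\<close>

lemma has_sum_even_odd:
  fixes f :: "nat \<Rightarrow> complex"
  assumes "((\<lambda>m. f (2 * m)) has_sum S) UNIV" "((\<lambda>m. f (2 * m + 1)) has_sum T) UNIV"
  shows "(f has_sum (S + T)) UNIV"
proof -
  have "(f has_sum S) (range (\<lambda>m. 2 * m))" "(f has_sum T) (range (\<lambda>m. 2 * m + 1))"
    using assms by (subst has_sum_reindex; simp add: inj_on_def o_def)+
  then have "(f has_sum (S + T)) (range (\<lambda>m. 2 * m) \<union> range (\<lambda>m. 2 * m + 1))"
    by (rule has_sum_Un_disjoint) (auto, presburger)
  also have "range (\<lambda>m. 2 * m) \<union> range (\<lambda>m. 2 * m + 1) = (UNIV :: nat set)"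
    by (auto simp: image_iff) presburger
  finally show ?thesis .
qed

definition nahm_term :: "complex \<Rightarrow> int \<Rightarrow> int \<Rightarrow> nat \<times> nat \<Rightarrow> complex" where
  "nahm_term q b1 b2 = (\<lambda>(i, j). q powi ((int i)\<^sup>2 + 2 * (int j)\<^sup>2 - 2 * int i * int j + b1 * int i + b2 * int j)
     / (qpoch (q ^ 4) (q ^ 4) i * qpoch (q ^ 4) (q ^ 4) j))"

text \<open>Odd and even refer to the powers of \<open>q^2\<close>, not to the parity of the
  summation index \<open>i\<close>: for \<open>b2 = - 2\<close> even \<open>i\<close> leads to
  \<open>K_even\<close> and odd \<open>i\<close> to \<open>K_odd\<close>.\<close>

definition K_odd :: "complex \<Rightarrow> complex" where
  "K_odd q = qpoch_inf (- (q ^ 2)) (q ^ 4)"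

definition K_even :: "complex \<Rightarrow> complex" where
  "K_even q = qpoch_inf (- (q ^ 4)) (q ^ 4)"

context
  fixes q :: complex
  assumes q: "norm q < 1" "q \<noteq> 0"
begin

lemma q4_bounds: "norm (q ^ 4) < 1" "q ^ 4 \<noteq> 0"
  using norm_power_less_1[OF q(1), of 4] q by auto

lemma q_powi_add: "q powi (a + b) = q powi a * q powi b"
  using q by (simp add: power_int_add)

text \<open>The first \<open>m\<close> factors are
  \<open>1 + q^(2-4k) = q^(2-4k) (1 + q^(4k-2))\<close> for \<open>k = 1, ..., m\<close>; the
  extracted exponents add up to \<open>- 2 m^2\<close>.\<close>

lemma qpoch_inf_shift_odd:
  "qpoch_inf (- (q powi (2 - 4 * int m))) (q ^ 4)
    = q powi (- 2 * (int m)\<^sup>2) * qpoch (- (q ^ 2)) (q ^ 4) m * qpoch_inf (- (q ^ 2)) (q ^ 4)"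
proof (induction m)
  case (Suc m)
  have "qpoch_inf (- (q powi (2 - 4 * int (Suc m)))) (q ^ 4)
      = (1 + q powi (- 2 - 4 * int m)) * qpoch_inf (- (q powi (2 - 4 * int (Suc m))) * q ^ 4) (q ^ 4)"
    by (subst qpoch_inf_rec[OF q4_bounds(1)]) (simp add: algebra_simps)
  also have "- (q powi (2 - 4 * int (Suc m))) * q ^ 4 = - (q powi (2 - 4 * int m))"
    using q_powi_add[of "2 - 4 * int (Suc m)" 4] by simp
  also have "1 + q powi (- 2 - 4 * int m) = q powi (- 2 - 4 * int m) * (1 + q ^ 2 * (q ^ 4) ^ m)"
  proof -
    have "q ^ 2 * (q ^ 4) ^ m = q powi (2 + 4 * int m)"
      using q by (simp add: power_int_add power_int_mult)
    then show ?thesis using q_powi_add[of "- 2 - 4 * int m" "2 + 4 * int m"] by (simp add: distrib_left)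
  qed
  also have "q powi (- 2 * (int (Suc m))\<^sup>2) = q powi (- 2 - 4 * int m) * q powi (- 2 * (int m)\<^sup>2)"
    unfolding q_powi_add[symmetric] by (simp add: power2_eq_square algebra_simps)
  ultimately show ?case unfolding Suc by (simp add: qpoch_Suc mult_ac)
qed simp

text \<open>As in the odd case, but the exponents pass through 0; that factor \<open>1 + 1\<close>
  is the 2 in front of the even terms of the theorem.\<close>

lemma qpoch_inf_shift_even:
  "qpoch_inf (- (q powi (- 4 * int m))) (q ^ 4)
    = 2 * q powi (- 2 * (int m)\<^sup>2 - 2 * int m) * qpoch (- (q ^ 4)) (q ^ 4) m * qpoch_inf (- (q ^ 4)) (q ^ 4)"
proof (induction m)
  case 0
  show ?case using qpoch_inf_rec[OF q4_bounds(1), of "- 1"] by simp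
next
  case (Suc m)
  have "qpoch_inf (- (q powi (- 4 * int (Suc m)))) (q ^ 4)
      = (1 + q powi (- 4 - 4 * int m)) * qpoch_inf (- (q powi (- 4 * int (Suc m))) * q ^ 4) (q ^ 4)"
    by (subst qpoch_inf_rec[OF q4_bounds(1)]) (simp add: algebra_simps)
  also have "- (q powi (- 4 * int (Suc m))) * q ^ 4 = - (q powi (- 4 * int m))"
    using q_powi_add[of "- 4 * int (Suc m)" 4] by simp
  also have "1 + q powi (- 4 - 4 * int m) = q powi (- 4 - 4 * int m) * (1 + q ^ 4 * (q ^ 4) ^ m)"
  proof -
    have "q ^ 4 * (q ^ 4) ^ m = q powi (4 + 4 * int m)"
      using q by (simp add: power_int_add power_int_mult)
    then show ?thesis using q_powi_add[of "- 4 - 4 * int m" "4 + 4 * int m"] by (simp add: distrib_left)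
  qed
  also have "q powi (- 2 * (int (Suc m))\<^sup>2 - 2 * int (Suc m)) = q powi (- 4 - 4 * int m) * q powi (- 2 * (int m)\<^sup>2 - 2 * int m)"
    unfolding q_powi_add[symmetric] by (simp add: power2_eq_square algebra_simps)
  ultimately show ?case unfolding Suc by (simp add: qpoch_Suc mult_ac)
qed

text \<open>For fixed \<open>i\<close> the exponent equals
  \<open>4 (j choose 2) + (2 + b2 - 2i) j\<close> up to a constant, so the sum over \<open>j\<close>
  is Euler's series in base \<open>q ^ 4\<close>.\<close>

lemma nahm_term_inner:
  "((\<lambda>j. nahm_term q b1 b2 (i, j)) has_sum
     (q powi ((int i)\<^sup>2 + b1 * int i) * inverse (qpoch (q ^ 4) (q ^ 4) i)
       * qpoch_inf (- (q powi (2 + b2 - 2 * int i))) (q ^ 4))) UNIV"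
proof -
  define z where "z = q powi (2 + b2 - 2 * int i)"
  have "((\<lambda>j. (q ^ 4) ^ (j choose 2) * inverse (qpoch (q ^ 4) (q ^ 4) j) * z ^ j) has_sum qpoch_inf (- z) (q ^ 4)) UNIV"
    by (rule norm_summable_imp_has_sum[OF norm_summable_euler[OF q4_bounds(1)] euler_sums[OF q4_bounds(1)]])
  from has_sum_cmult_right[OF this, of "q powi ((int i)\<^sup>2 + b1 * int i) * inverse (qpoch (q ^ 4) (q ^ 4) i)"]
  have "((\<lambda>j. q powi ((int i)\<^sup>2 + b1 * int i) * inverse (qpoch (q ^ 4) (q ^ 4) i)
      * ((q ^ 4) ^ (j choose 2) * inverse (qpoch (q ^ 4) (q ^ 4) j) * z ^ j))
    has_sum (q powi ((int i)\<^sup>2 + b1 * int i) * inverse (qpoch (q ^ 4) (q ^ 4) i) * qpoch_inf (- z) (q ^ 4))) UNIV" .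
  moreover have "q powi ((int i)\<^sup>2 + b1 * int i) * inverse (qpoch (q ^ 4) (q ^ 4) i)
      * ((q ^ 4) ^ (j choose 2) * inverse (qpoch (q ^ 4) (q ^ 4) j) * z ^ j) = nahm_term q b1 b2 (i, j)" for j
  proof -
    have "(q ^ 4) ^ (j choose 2) * z ^ j = q powi (2 * (int j)\<^sup>2 + (b2 - 2 * int i) * int j)"
    proof -
      have "(q ^ 4) ^ (j choose 2) = q powi (4 * int (j choose 2))"
        by (simp add: power_int_mult)
      moreover have "z ^ j = q powi ((2 + b2 - 2 * int i) * int j)"
        by (simp add: z_def power_int_mult)
      moreover have "4 * int (j choose 2) + (2 + b2 - 2 * int i) * int j = 2 * (int j)\<^sup>2 + (b2 - 2 * int i) * int j"
        using two_tri[of "int j"] by (simp add: tri_of_nat algebra_simps power2_eq_square)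
      ultimately show ?thesis by (simp only: q_powi_add[symmetric])
    qed
    moreover have "q powi ((int i)\<^sup>2 + 2 * (int j)\<^sup>2 - 2 * int i * int j + b1 * int i + b2 * int j)
       = q powi ((int i)\<^sup>2 + b1 * int i) * q powi (2 * (int j)\<^sup>2 + (b2 - 2 * int i) * int j)"
      unfolding q_powi_add[symmetric] by (simp add: algebra_simps)
    ultimately show ?thesis
      unfolding nahm_term_def by (simp add: divide_inverse mult_ac)
  qed
  ultimately show ?thesis by (simp only: z_def)
qed

text \<open>Writing \<open>norm q = s\<^sup>2\<close> turns the linear lower bound for twice the
  exponent into a product of two geometric series in \<open>s\<close>; the slack 2 costs the
  constant factor \<open>1 / s\<^sup>2\<close>.\<close>

lemma nahm_term_summable:
  assumes "\<And>i j. int i + int j \<le> 2 * ((int i)\<^sup>2 + 2 * (int j)\<^sup>2 - 2 * int i * int j + b1 * int i + b2 * int j) + 2"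
  shows "nahm_term q b1 b2 summable_on UNIV \<times> UNIV"
proof -
  obtain C where C: "C > 0" "\<And>n. norm (inverse (qpoch (q ^ 4) (q ^ 4) n)) \<le> C"
    using bounded_inverse_qpoch[OF q4_bounds(1) q4_bounds(1)] by blast
  define s where "s = sqrt (norm q)"
  have s: "0 < s" "s < 1" "s\<^sup>2 = norm q" using q by (auto simp: s_def)
  have geo: "(\<lambda>n. norm (complex_of_real s ^ n)) summable_on UNIV"
    using s by (simp add: summable_on_UNIV_nonneg_real_iff norm_power summable_geometric)
  have "(\<lambda>z. (C * C / s\<^sup>2) * norm (complex_of_real s ^ fst z * complex_of_real s ^ snd z)) summable_on UNIV \<times> (UNIV :: nat set)"
    by (intro summable_on_cmult_right abs_summable_times geo)
  then have "(\<lambda>z. norm (nahm_term q b1 b2 z)) summable_on UNIV \<times> UNIV"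
  proof (rule summable_on_comparison_test)
    fix z :: "nat \<times> nat"
    obtain i j where z: "z = (i, j)" by (cases z)
    define e where "e = (int i)\<^sup>2 + 2 * (int j)\<^sup>2 - 2 * int i * int j + b1 * int i + b2 * int j"
    have "norm (q powi e) = s powi (2 * e)"
      unfolding norm_power_int s(3)[symmetric] by (simp add: power_int_mult)
    also have "\<dots> \<le> s powi (int i + int j - 2)"
      using assms[of i j] s by (intro power_int_decreasing) (auto simp: e_def)
    also have "\<dots> = s ^ i * s ^ j / s\<^sup>2"
      using s by (simp add: power_int_diff power_int_add)
    finally have "norm (q powi e) * (norm (inverse (qpoch (q ^ 4) (q ^ 4) i)) * norm (inverse (qpoch (q ^ 4) (q ^ 4) j)))
       \<le> s ^ i * s ^ j / s\<^sup>2 * (C * C)"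
      using C s by (intro mult_mono) (auto simp: less_imp_le)
    moreover have "norm (nahm_term q b1 b2 z)
      = norm (q powi e) * (norm (inverse (qpoch (q ^ 4) (q ^ 4) i)) * norm (inverse (qpoch (q ^ 4) (q ^ 4) j)))"
      by (simp only: z nahm_term_def e_def prod.case divide_inverse inverse_mult_distrib norm_mult)
    ultimately show "norm (nahm_term q b1 b2 z) \<le> (C * C / s\<^sup>2) * norm (complex_of_real s ^ fst z * complex_of_real s ^ snd z)"
      using s by (simp add: z norm_mult norm_power mult_ac)
  qed (rule norm_ge_zero)
  then show ?thesis by (rule abs_summable_summable)
qed

lemma nahm_term_has_sum:
  assumes "\<And>i j. int i + int j \<le> 2 * ((int i)\<^sup>2 + 2 * (int j)\<^sup>2 - 2 * int i * int j + b1 * int i + b2 * int j) + 2"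
    and E: "((\<lambda>m. q powi ((2 * int m)\<^sup>2 + b1 * (2 * int m)) * inverse (qpoch (q ^ 4) (q ^ 4) (2 * m))
       * qpoch_inf (- (q powi (2 + b2 - 4 * int m))) (q ^ 4)) has_sum S) UNIV"
    and O: "((\<lambda>m. q powi ((2 * int m + 1)\<^sup>2 + b1 * (2 * int m + 1)) * inverse (qpoch (q ^ 4) (q ^ 4) (2 * m + 1))
       * qpoch_inf (- (q powi (b2 - 4 * int m))) (q ^ 4)) has_sum T) UNIV"
  shows "(nahm_term q b1 b2 has_sum (S + T)) UNIV"
proof -
  have "(nahm_term q b1 b2 has_sum (S + T)) (UNIV \<times> UNIV)"
  proof (rule has_sum_SigmaI[OF nahm_term_inner _ nahm_term_summable[OF assms(1)]])
    show "((\<lambda>i. q powi ((int i)\<^sup>2 + b1 * int i) * inverse (qpoch (q ^ 4) (q ^ 4) i)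
       * qpoch_inf (- (q powi (2 + b2 - 2 * int i))) (q ^ 4)) has_sum (S + T)) UNIV"
    proof (rule has_sum_even_odd)
      have "2 + b2 - 2 * int (2 * m) = 2 + b2 - 4 * int m" "int (2 * m) = 2 * int m"
        "2 + b2 - 2 * int (2 * m + 1) = b2 - 4 * int m" "int (2 * m + 1) = 2 * int m + 1" for m
        by simp_all
      note eqs = this
      show "((\<lambda>m. q powi ((int (2 * m))\<^sup>2 + b1 * int (2 * m)) * inverse (qpoch (q ^ 4) (q ^ 4) (2 * m))
         * qpoch_inf (- (q powi (2 + b2 - 2 * int (2 * m)))) (q ^ 4)) has_sum S) UNIV"
        using E by (simp only: eqs(1)) (simp only: eqs(2))
      show "((\<lambda>m. q powi ((int (2 * m + 1))\<^sup>2 + b1 * int (2 * m + 1)) * inverse (qpoch (q ^ 4) (q ^ 4) (2 * m + 1))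
         * qpoch_inf (- (q powi (2 + b2 - 2 * int (2 * m + 1)))) (q ^ 4)) has_sum T) UNIV"
        using O by (simp only: eqs(3)) (simp only: eqs(4))
    qed
  qed
  then show ?thesis by simp
qed

lemma int_le_power2: "(x :: int) \<le> x\<^sup>2"
proof (cases "x \<le> 0")
  case False
  then have "x * 1 \<le> x * x" by (intro mult_left_mono) auto
  then show ?thesis by (simp add: power2_eq_square)
qed (use zero_le_power2[of x] in linarith)

text \<open>The exponents are \<open>(i-j)^2 + j^2\<close>, \<open>(i-j+1)^2 + j^2 - 1\<close> and
  \<open>(i-j)^2 + j^2 + 2i\<close>; each square is bounded below by its base. The slack 2 pays for
  the \<open>- 1\<close> in the second case.\<close>

lemma nahm_exponent_bounds:
  fixes i j :: nat
  shows "int i + int j \<le> 2 * ((int i)\<^sup>2 + 2 * (int j)\<^sup>2 - 2 * int i * int j + 0 * int i + 0 * int j) + 2"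
    and "int i + int j \<le> 2 * ((int i)\<^sup>2 + 2 * (int j)\<^sup>2 - 2 * int i * int j + 2 * int i + (- 2) * int j) + 2"
    and "int i + int j \<le> 2 * ((int i)\<^sup>2 + 2 * (int j)\<^sup>2 - 2 * int i * int j + 2 * int i + 0 * int j) + 2"
  using int_le_power2[of "int i - int j"] int_le_power2[of "int i - int j + 1"] int_le_power2[of "int j"]
    zero_le_power2[of "int i - int j"] zero_le_power2[of "int i - int j + 1"]
  by (simp_all add: power2_eq_square algebra_simps)

lemma q_powi_nat: "q powi int n = q ^ n" by simp

lemma q2_bounds: "norm (q\<^sup>2) < 1" "q\<^sup>2 \<noteq> 0" "q ^ 4 = (q\<^sup>2)\<^sup>2"
  using norm_power_less_1[OF q(1), of 2] q by (auto simp: power_mult[symmetric])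

lemma nahm1:
  "(nahm_term q 0 0 has_sum (K_odd q * (K_odd q / qpoch_inf (q ^ 4) (q ^ 4) * quint_prod 3 14 (q\<^sup>2))
      + (2 * q * K_even q) * (K_even q / qpoch_inf (q ^ 4) (q ^ 4) * quint_prod 2 7 (q ^ 4)))) UNIV"
proof (rule nahm_term_has_sum[OF nahm_exponent_bounds(1)])
  have "((\<lambda>m. K_odd q * ((q\<^sup>2) ^ m\<^sup>2 * qpoch (- (q\<^sup>2)) (q ^ 4) m * inverse (qpoch (q ^ 4) (q ^ 4) (2 * m))))
     has_sum K_odd q * (K_odd q / qpoch_inf (q ^ 4) (q ^ 4) * quint_prod 3 14 (q\<^sup>2))) UNIV"
    unfolding K_odd_def by (intro has_sum_cmult_right slater_117 q2_bounds)
  moreover have "K_odd q * ((q\<^sup>2) ^ m\<^sup>2 * qpoch (- (q\<^sup>2)) (q ^ 4) m * inverse (qpoch (q ^ 4) (q ^ 4) (2 * m)))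
    = q powi ((2 * int m)\<^sup>2 + 0 * (2 * int m)) * inverse (qpoch (q ^ 4) (q ^ 4) (2 * m))
       * qpoch_inf (- (q powi (2 + 0 - 4 * int m))) (q ^ 4)" for m
  proof -
    have e: "(2 * int m)\<^sup>2 + 0 * (2 * int m) + (- 2 * (int m)\<^sup>2) = int (2 * m\<^sup>2)"
      using two_tri[of "int m"] by (simp add: tri_of_nat power2_eq_square algebra_simps)
    have "q powi ((2 * int m)\<^sup>2 + 0 * (2 * int m)) * q powi (- 2 * (int m)\<^sup>2) = q powi int (2 * m\<^sup>2)"
      unfolding q_powi_add[symmetric] e ..
    also have "\<dots> = (q\<^sup>2) ^ m\<^sup>2"
      by (simp only: q_powi_nat power_mult power_add power_one_right mult.assoc)
    finally show ?thesis
      using qpoch_inf_shift_odd[of m] by (simp add: K_odd_def mult_ac)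
  qed
  ultimately show "((\<lambda>m. q powi ((2 * int m)\<^sup>2 + 0 * (2 * int m)) * inverse (qpoch (q ^ 4) (q ^ 4) (2 * m))
       * qpoch_inf (- (q powi (2 + 0 - 4 * int m))) (q ^ 4))
     has_sum K_odd q * (K_odd q / qpoch_inf (q ^ 4) (q ^ 4) * quint_prod 3 14 (q\<^sup>2))) UNIV"
    by (simp only:)
next
  have "((\<lambda>m. (2 * q * K_even q) * ((q ^ 4) ^ (m choose 2) * (q ^ 4) ^ m * qpoch (- (q ^ 4)) (q ^ 4) m * inverse (qpoch (q ^ 4) (q ^ 4) (2 * m + 1))))
     has_sum (2 * q * K_even q) * (K_even q / qpoch_inf (q ^ 4) (q ^ 4) * quint_prod 2 7 (q ^ 4))) UNIV"
    unfolding K_even_def by (intro has_sum_cmult_right slater_80 q4_bounds)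
  moreover have "(2 * q * K_even q) * ((q ^ 4) ^ (m choose 2) * (q ^ 4) ^ m * qpoch (- (q ^ 4)) (q ^ 4) m * inverse (qpoch (q ^ 4) (q ^ 4) (2 * m + 1)))
    = q powi ((2 * int m + 1)\<^sup>2 + 0 * (2 * int m + 1)) * inverse (qpoch (q ^ 4) (q ^ 4) (2 * m + 1))
       * qpoch_inf (- (q powi (0 - 4 * int m))) (q ^ 4)" for m
  proof -
    have e: "(2 * int m + 1)\<^sup>2 + 0 * (2 * int m + 1) + (- 2 * (int m)\<^sup>2 - 2 * int m) = int (1 + (4 * (m choose 2) + 4 * m))"
      using two_tri[of "int m"] by (simp add: tri_of_nat power2_eq_square algebra_simps)
    have "q powi ((2 * int m + 1)\<^sup>2 + 0 * (2 * int m + 1)) * q powi (- 2 * (int m)\<^sup>2 - 2 * int m) = q powi int (1 + (4 * (m choose 2) + 4 * m))"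
      unfolding q_powi_add[symmetric] e ..
    also have "\<dots> = q * ((q ^ 4) ^ (m choose 2) * (q ^ 4) ^ m)"
      by (simp only: q_powi_nat power_mult power_add power_one_right mult.assoc)
    finally show ?thesis
      using qpoch_inf_shift_even[of m] by (simp add: K_even_def mult_ac)
  qed
  ultimately show "((\<lambda>m. q powi ((2 * int m + 1)\<^sup>2 + 0 * (2 * int m + 1)) * inverse (qpoch (q ^ 4) (q ^ 4) (2 * m + 1))
       * qpoch_inf (- (q powi (0 - 4 * int m))) (q ^ 4))
     has_sum (2 * q * K_even q) * (K_even q / qpoch_inf (q ^ 4) (q ^ 4) * quint_prod 2 7 (q ^ 4))) UNIV"
    by (simp only:)
qed

lemma nahm2:
  "(nahm_term q 2 (- 2) has_sum ((2 * K_even q) * (K_even q / qpoch_inf (q ^ 4) (q ^ 4) * quint_prod 1 7 (q ^ 4))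
      + (q * K_odd q) * (K_odd q / qpoch_inf (q ^ 4) (q ^ 4) * quint_prod 5 14 (q\<^sup>2)))) UNIV"
proof (rule nahm_term_has_sum[OF nahm_exponent_bounds(2)])
  have "((\<lambda>m. (2 * K_even q) * ((q ^ 4) ^ (m choose 2) * (q ^ 4) ^ m * qpoch (- (q ^ 4)) (q ^ 4) m * inverse (qpoch (q ^ 4) (q ^ 4) (2 * m))))
     has_sum (2 * K_even q) * (K_even q / qpoch_inf (q ^ 4) (q ^ 4) * quint_prod 1 7 (q ^ 4))) UNIV"
    unfolding K_even_def by (intro has_sum_cmult_right slater_81 q4_bounds)
  moreover have "(2 * K_even q) * ((q ^ 4) ^ (m choose 2) * (q ^ 4) ^ m * qpoch (- (q ^ 4)) (q ^ 4) m * inverse (qpoch (q ^ 4) (q ^ 4) (2 * m)))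
    = q powi ((2 * int m)\<^sup>2 + 2 * (2 * int m)) * inverse (qpoch (q ^ 4) (q ^ 4) (2 * m))
       * qpoch_inf (- (q powi (2 + (- 2) - 4 * int m))) (q ^ 4)" for m
  proof -
    have e: "(2 * int m)\<^sup>2 + 2 * (2 * int m) + (- 2 * (int m)\<^sup>2 - 2 * int m) = int (4 * (m choose 2) + 4 * m)"
      using two_tri[of "int m"] by (simp add: tri_of_nat power2_eq_square algebra_simps)
    have "q powi ((2 * int m)\<^sup>2 + 2 * (2 * int m)) * q powi (- 2 * (int m)\<^sup>2 - 2 * int m) = q powi int (4 * (m choose 2) + 4 * m)"
      unfolding q_powi_add[symmetric] e ..
    also have "\<dots> = (q ^ 4) ^ (m choose 2) * (q ^ 4) ^ m"
      by (simp only: q_powi_nat power_mult power_add power_one_right mult.assoc)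
    finally show ?thesis
      using qpoch_inf_shift_even[of m] by (simp add: K_even_def mult_ac)
  qed
  ultimately show "((\<lambda>m. q powi ((2 * int m)\<^sup>2 + 2 * (2 * int m)) * inverse (qpoch (q ^ 4) (q ^ 4) (2 * m))
       * qpoch_inf (- (q powi (2 + (- 2) - 4 * int m))) (q ^ 4))
     has_sum (2 * K_even q) * (K_even q / qpoch_inf (q ^ 4) (q ^ 4) * quint_prod 1 7 (q ^ 4))) UNIV"
    by (simp only:)
next
  have "((\<lambda>m. (q * K_odd q) * ((q\<^sup>2) ^ m\<^sup>2 * (q ^ 4) ^ m * qpoch (- (q\<^sup>2)) (q ^ 4) (Suc m) * inverse (qpoch (q ^ 4) (q ^ 4) (2 * m + 1))))
     has_sum (q * K_odd q) * (K_odd q / qpoch_inf (q ^ 4) (q ^ 4) * quint_prod 5 14 (q\<^sup>2))) UNIV"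
    unfolding K_odd_def by (intro has_sum_cmult_right slater_118 q2_bounds)
  moreover have "(q * K_odd q) * ((q\<^sup>2) ^ m\<^sup>2 * (q ^ 4) ^ m * qpoch (- (q\<^sup>2)) (q ^ 4) (Suc m) * inverse (qpoch (q ^ 4) (q ^ 4) (2 * m + 1)))
    = q powi ((2 * int m + 1)\<^sup>2 + 2 * (2 * int m + 1)) * inverse (qpoch (q ^ 4) (q ^ 4) (2 * m + 1))
       * qpoch_inf (- (q powi ((- 2) - 4 * int m))) (q ^ 4)" for m
  proof -
    \<comment> \<open>For odd \<open>i\<close> and \<open>b2 = - 2\<close> the exponent is
      \<open>- 2 - 4 m = 2 - 4 (m + 1)\<close>. The shift therefore takes \<open>Suc m\<close>
      steps, which matches the longer numerator in \<open>slater_118\<close>.\<close>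
    have e: "(2 * int m + 1)\<^sup>2 + 2 * (2 * int m + 1) + (- 2 * (int (Suc m))\<^sup>2) = int (1 + (2 * m\<^sup>2 + 4 * m))"
      using two_tri[of "int m"] by (simp add: tri_of_nat power2_eq_square algebra_simps)
    have "q powi ((2 * int m + 1)\<^sup>2 + 2 * (2 * int m + 1)) * q powi (- 2 * (int (Suc m))\<^sup>2) = q powi int (1 + (2 * m\<^sup>2 + 4 * m))"
      unfolding q_powi_add[symmetric] e ..
    also have "\<dots> = q * ((q\<^sup>2) ^ m\<^sup>2 * (q ^ 4) ^ m)"
      by (simp only: q_powi_nat power_mult power_add power_one_right mult.assoc)
    finally show ?thesis
      using qpoch_inf_shift_odd[of "Suc m"] by (simp add: K_odd_def mult_ac)
  qed
  ultimately show "((\<lambda>m. q powi ((2 * int m + 1)\<^sup>2 + 2 * (2 * int m + 1)) * inverse (qpoch (q ^ 4) (q ^ 4) (2 * m + 1))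
       * qpoch_inf (- (q powi ((- 2) - 4 * int m))) (q ^ 4))
     has_sum (q * K_odd q) * (K_odd q / qpoch_inf (q ^ 4) (q ^ 4) * quint_prod 5 14 (q\<^sup>2))) UNIV"
    by (simp only:)
qed

lemma nahm3:
  "(nahm_term q 2 0 has_sum (K_odd q * (K_odd q / qpoch_inf (q ^ 4) (q ^ 4) * quint_prod 1 14 (q\<^sup>2))
      + (2 * q ^ 3 * K_even q) * (K_even q / qpoch_inf (q ^ 4) (q ^ 4) * quint_prod 3 7 (q ^ 4)))) UNIV"
proof (rule nahm_term_has_sum[OF nahm_exponent_bounds(3)])
  have "((\<lambda>m. K_odd q * ((q\<^sup>2) ^ m\<^sup>2 * (q ^ 4) ^ m * qpoch (- (q\<^sup>2)) (q ^ 4) m * inverse (qpoch (q ^ 4) (q ^ 4) (2 * m))))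
     has_sum K_odd q * (K_odd q / qpoch_inf (q ^ 4) (q ^ 4) * quint_prod 1 14 (q\<^sup>2))) UNIV"
    unfolding K_odd_def by (intro has_sum_cmult_right slater_119 q2_bounds)
  moreover have "K_odd q * ((q\<^sup>2) ^ m\<^sup>2 * (q ^ 4) ^ m * qpoch (- (q\<^sup>2)) (q ^ 4) m * inverse (qpoch (q ^ 4) (q ^ 4) (2 * m)))
    = q powi ((2 * int m)\<^sup>2 + 2 * (2 * int m)) * inverse (qpoch (q ^ 4) (q ^ 4) (2 * m))
       * qpoch_inf (- (q powi (2 + 0 - 4 * int m))) (q ^ 4)" for m
  proof -
    have e: "(2 * int m)\<^sup>2 + 2 * (2 * int m) + (- 2 * (int m)\<^sup>2) = int (2 * m\<^sup>2 + 4 * m)"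
      using two_tri[of "int m"] by (simp add: tri_of_nat power2_eq_square algebra_simps)
    have "q powi ((2 * int m)\<^sup>2 + 2 * (2 * int m)) * q powi (- 2 * (int m)\<^sup>2) = q powi int (2 * m\<^sup>2 + 4 * m)"
      unfolding q_powi_add[symmetric] e ..
    also have "\<dots> = (q\<^sup>2) ^ m\<^sup>2 * (q ^ 4) ^ m"
      by (simp only: q_powi_nat power_mult power_add power_one_right mult.assoc)
    finally show ?thesis
      using qpoch_inf_shift_odd[of m] by (simp add: K_odd_def mult_ac)
  qed
  ultimately show "((\<lambda>m. q powi ((2 * int m)\<^sup>2 + 2 * (2 * int m)) * inverse (qpoch (q ^ 4) (q ^ 4) (2 * m))
       * qpoch_inf (- (q powi (2 + 0 - 4 * int m))) (q ^ 4))
     has_sum K_odd q * (K_odd q / qpoch_inf (q ^ 4) (q ^ 4) * quint_prod 1 14 (q\<^sup>2))) UNIV"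
    by (simp only:)
next
  have "((\<lambda>m. (2 * q ^ 3 * K_even q) * ((q ^ 4) ^ (m choose 2) * (q ^ 4) ^ (2 * m) * qpoch (- (q ^ 4)) (q ^ 4) m * inverse (qpoch (q ^ 4) (q ^ 4) (2 * m + 1))))
     has_sum (2 * q ^ 3 * K_even q) * (K_even q / qpoch_inf (q ^ 4) (q ^ 4) * quint_prod 3 7 (q ^ 4))) UNIV"
    unfolding K_even_def by (intro has_sum_cmult_right slater_82 q4_bounds)
  moreover have "(2 * q ^ 3 * K_even q) * ((q ^ 4) ^ (m choose 2) * (q ^ 4) ^ (2 * m) * qpoch (- (q ^ 4)) (q ^ 4) m * inverse (qpoch (q ^ 4) (q ^ 4) (2 * m + 1)))
    = q powi ((2 * int m + 1)\<^sup>2 + 2 * (2 * int m + 1)) * inverse (qpoch (q ^ 4) (q ^ 4) (2 * m + 1))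
       * qpoch_inf (- (q powi (0 - 4 * int m))) (q ^ 4)" for m
  proof -
    have e: "(2 * int m + 1)\<^sup>2 + 2 * (2 * int m + 1) + (- 2 * (int m)\<^sup>2 - 2 * int m) = int (3 + (4 * (m choose 2) + 4 * (2 * m)))"
      using two_tri[of "int m"] by (simp add: tri_of_nat power2_eq_square algebra_simps)
    have "q powi ((2 * int m + 1)\<^sup>2 + 2 * (2 * int m + 1)) * q powi (- 2 * (int m)\<^sup>2 - 2 * int m) = q powi int (3 + (4 * (m choose 2) + 4 * (2 * m)))"
      unfolding q_powi_add[symmetric] e ..
    also have "\<dots> = q ^ 3 * ((q ^ 4) ^ (m choose 2) * (q ^ 4) ^ (2 * m))"
      by (simp only: q_powi_nat power_mult power_add power_one_right mult.assoc)
    finally show ?thesis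
      using qpoch_inf_shift_even[of m] by (simp add: K_even_def mult_ac)
  qed
  ultimately show "((\<lambda>m. q powi ((2 * int m + 1)\<^sup>2 + 2 * (2 * int m + 1)) * inverse (qpoch (q ^ 4) (q ^ 4) (2 * m + 1))
       * qpoch_inf (- (q powi (0 - 4 * int m))) (q ^ 4))
     has_sum (2 * q ^ 3 * K_even q) * (K_even q / qpoch_inf (q ^ 4) (q ^ 4) * quint_prod 3 7 (q ^ 4))) UNIV"
    by (simp only:)
qed

end

section \<open>The infinite products in terms of \<open>J\<close> and \<open>JJ\<close>\<close>

context
  fixes q :: complex
  assumes q: "norm q < 1"
begin

lemma J_nonzero: "m > 0 \<Longrightarrow> J m q \<noteq> 0"
  unfolding J_def by (intro qpoch_inf_nonzero norm_power_less_1 q)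

lemma qpoch_inf_powers_nonzero: "a > 0 \<Longrightarrow> m > 0 \<Longrightarrow> qpoch_inf (q ^ a) (q ^ m) \<noteq> 0"
  by (intro qpoch_inf_nonzero norm_power_less_1 q)

lemma JJ_nonzero: "0 < a \<Longrightarrow> a < m \<Longrightarrow> JJ a m q \<noteq> 0"
  by (simp add: JJ_def qpoch_inf_powers_nonzero)

lemma J_dissect:
  assumes "m > 0" "k > 0"
  shows "J m q = (\<Prod>i<k. qpoch_inf (q ^ (m * Suc i)) (q ^ (m * k)))"
proof -
  have "J m q = (\<Prod>i<k. qpoch_inf (q ^ m * (q ^ m) ^ i) ((q ^ m) ^ k))"
    unfolding J_def by (intro qpoch_inf_dissect norm_power_less_1 q assms)
  then show ?thesis by (simp only: power_mult power_Suc)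
qed

lemma qpoch_inf_bisect:
  assumes "m > 0"
  shows "qpoch_inf (q ^ a) (q ^ m) = qpoch_inf (q ^ a) (q ^ (2 * m)) * qpoch_inf (q ^ (a + m)) (q ^ (2 * m))"
  using qpoch_inf_dissect[OF norm_power_less_1[OF q assms], of 2 "q ^ a"]
  by (simp add: eval_nat_numeral power_add power_mult[symmetric] mult.commute)

lemma K_odd_J: "K_odd q = J 4 q ^ 2 / (J 2 q * J 8 q)"
proof -
  have 1: "qpoch_inf (q ^ 2) (q ^ 4) * K_odd q = qpoch_inf (q ^ 4) (q ^ 8)"
    using qpoch_inf_minus[OF norm_power_less_1[OF q, of 4], of "q ^ 2"]
    by (simp add: K_odd_def power_mult[symmetric])
  have 2: "J 2 q = qpoch_inf (q ^ 2) (q ^ 4) * J 4 q" "J 4 q = qpoch_inf (q ^ 4) (q ^ 8) * J 8 q"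
    using qpoch_inf_bisect[of 2 2] qpoch_inf_bisect[of 4 4] by (simp_all add: J_def)
  have "K_odd q = qpoch_inf (q ^ 4) (q ^ 8) / qpoch_inf (q ^ 2) (q ^ 4)"
    using 1 qpoch_inf_powers_nonzero[of 2 4] by (simp add: field_simps)
  moreover have "qpoch_inf (q ^ 4) (q ^ 8) = J 4 q / J 8 q" "qpoch_inf (q ^ 2) (q ^ 4) = J 2 q / J 4 q"
    using 2 J_nonzero[of 4] J_nonzero[of 8] by (auto simp: field_simps)
  ultimately show ?thesis by (simp add: power2_eq_square)
qed

lemma K_even_J: "K_even q = J 8 q / J 4 q"
proof -
  have "J 4 q * K_even q = J 8 q"
    using qpoch_inf_minus[OF norm_power_less_1[OF q, of 4], of "q ^ 4"]
    by (simp add: K_even_def J_def power_mult[symmetric])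
  then show ?thesis using J_nonzero[of 4] by (simp add: field_simps)
qed

lemma J_8_56:
  "J 8 q = qpoch_inf (q ^ 8) (q ^ 56) * qpoch_inf (q ^ 16) (q ^ 56) * qpoch_inf (q ^ 24) (q ^ 56)
     * qpoch_inf (q ^ 32) (q ^ 56) * qpoch_inf (q ^ 40) (q ^ 56) * qpoch_inf (q ^ 48) (q ^ 56) * J 56 q"
  using J_dissect[of 8 7] by (simp add: lessThan_nat_numeral lessThan_Suc J_def mult_ac)

lemma J_4_56:
  "J 4 q = qpoch_inf (q ^ 4) (q ^ 56) * qpoch_inf (q ^ 12) (q ^ 56) * qpoch_inf (q ^ 20) (q ^ 56)
     * qpoch_inf (q ^ 28) (q ^ 56) * qpoch_inf (q ^ 36) (q ^ 56) * qpoch_inf (q ^ 44) (q ^ 56)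
     * qpoch_inf (q ^ 52) (q ^ 56) * J 8 q"
  using J_dissect[of 4 14] unfolding J_8_56 by (simp add: lessThan_nat_numeral lessThan_Suc J_def mult_ac)

lemma J_28_56: "J 28 q = qpoch_inf (q ^ 28) (q ^ 56) * J 56 q"
  using qpoch_inf_bisect[of 28 28] by (simp add: J_def)

lemmas P_nonzero = qpoch_inf_powers_nonzero[where m = 56] J_nonzero

lemma quint_prod_odd:
  "quint_prod 3 14 (q\<^sup>2) = JJ 6 28 q * (qpoch_inf (q ^ 40) (q ^ 56) * qpoch_inf (q ^ 16) (q ^ 56))"
  "quint_prod 5 14 (q\<^sup>2) = J 28 q * qpoch_inf (q ^ 10) (q ^ 28) * qpoch_inf (q ^ 18) (q ^ 28)
      * (qpoch_inf (q ^ 48) (q ^ 56) * qpoch_inf (q ^ 8) (q ^ 56))"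
  "quint_prod 1 14 (q\<^sup>2) = J 28 q * qpoch_inf (q ^ 2) (q ^ 28) * qpoch_inf (q ^ 26) (q ^ 28)
      * (qpoch_inf (q ^ 32) (q ^ 56) * qpoch_inf (q ^ 24) (q ^ 56))"
  by (simp_all add: quint_prod_def JJ_def J_def power_mult[symmetric] mult_ac)

lemma quint_prod_even:
  "quint_prod 1 7 (q ^ 4) = J 28 q * qpoch_inf (q ^ 4) (q ^ 28) * qpoch_inf (q ^ 24) (q ^ 28)
      * (qpoch_inf (q ^ 36) (q ^ 56) * qpoch_inf (q ^ 20) (q ^ 56))"
  "quint_prod 2 7 (q ^ 4) = J 28 q * qpoch_inf (q ^ 8) (q ^ 28) * qpoch_inf (q ^ 20) (q ^ 28)
      * (qpoch_inf (q ^ 44) (q ^ 56) * qpoch_inf (q ^ 12) (q ^ 56))"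
  "quint_prod 3 7 (q ^ 4) = J 28 q * qpoch_inf (q ^ 12) (q ^ 28) * qpoch_inf (q ^ 16) (q ^ 28)
      * (qpoch_inf (q ^ 52) (q ^ 56) * qpoch_inf (q ^ 4) (q ^ 56))"
  by (simp_all add: quint_prod_def J_def power_mult[symmetric])

text \<open>\<open>J 8\<close> runs over the multiples of 8 modulo 56. Those outside
  \<open>JJ 8 56\<close> and \<open>JJ 24 56\<close> are 16 and 40, the residues that the quintuple
  product contributes.\<close>

lemma product_odd_1:
  "K_odd q * (K_odd q / qpoch_inf (q ^ 4) (q ^ 4) * quint_prod 3 14 (q\<^sup>2))
    = J 4 q ^ 3 * J 56 q * JJ 6 28 q / (J 2 q ^ 2 * J 8 q * JJ 8 56 q * JJ 24 56 q)"
proof -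
  have "JJ 8 56 q * JJ 24 56 q * (qpoch_inf (q ^ 40) (q ^ 56) * qpoch_inf (q ^ 16) (q ^ 56)) = J 8 q * J 56 q"
    unfolding J_8_56 by (simp add: JJ_def J_def)
  moreover have "JJ 8 56 q \<noteq> 0" "JJ 24 56 q \<noteq> 0" by (simp_all add: JJ_def P_nonzero)
  ultimately have 1: "qpoch_inf (q ^ 40) (q ^ 56) * qpoch_inf (q ^ 16) (q ^ 56) = J 8 q * J 56 q / (JJ 8 56 q * JJ 24 56 q)"
    by (simp add: field_simps)
  show ?thesis unfolding quint_prod_odd 1 K_odd_J J_def[symmetric]
    using J_nonzero[of 2] J_nonzero[of 4] J_nonzero[of 8] by (simp add: divide_simps eval_nat_numeral)
qed

text \<open>The residues 8 and 48 are expressed as in \<open>product_odd_1\<close>; those modulo 28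
  are split modulo 56, which completes \<open>JJ 10 56\<close> and \<open>JJ 18 56\<close>.\<close>

lemma product_odd_2:
  "K_odd q * (K_odd q / qpoch_inf (q ^ 4) (q ^ 4) * quint_prod 5 14 (q\<^sup>2))
    = J 4 q ^ 3 * J 28 q * JJ 10 56 q * JJ 18 56 q / (J 2 q ^ 2 * J 8 q * J 56 q * JJ 16 56 q * JJ 24 56 q)"
proof -
  have "JJ 16 56 q * JJ 24 56 q * (qpoch_inf (q ^ 48) (q ^ 56) * qpoch_inf (q ^ 8) (q ^ 56)) = J 8 q * J 56 q"
    unfolding J_8_56 by (simp add: JJ_def J_def)
  moreover have "JJ 16 56 q \<noteq> 0" "JJ 24 56 q \<noteq> 0" by (simp_all add: JJ_def P_nonzero)
  ultimately have 1: "qpoch_inf (q ^ 48) (q ^ 56) * qpoch_inf (q ^ 8) (q ^ 56) = J 8 q * J 56 q / (JJ 16 56 q * JJ 24 56 q)"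
    by (simp add: field_simps)
  have 2: "JJ 10 56 q * JJ 18 56 q = qpoch_inf (q ^ 10) (q ^ 28) * qpoch_inf (q ^ 18) (q ^ 28) * J 56 q ^ 2"
    using qpoch_inf_bisect[of 28 10] qpoch_inf_bisect[of 28 18] by (simp add: JJ_def J_def power2_eq_square)
  have 3: "J 4 q ^ 3 * J 28 q * JJ 10 56 q * JJ 18 56 q = J 4 q ^ 3 * J 28 q * (JJ 10 56 q * JJ 18 56 q)"
    by (simp only: mult.assoc)
  show ?thesis unfolding quint_prod_odd 1 3 2 K_odd_J J_def[symmetric]
    using J_nonzero[of 2] J_nonzero[of 4] J_nonzero[of 8] J_nonzero[of 56] by (simp add: divide_simps eval_nat_numeral)
qed

lemma product_odd_3:
  "K_odd q * (K_odd q / qpoch_inf (q ^ 4) (q ^ 4) * quint_prod 1 14 (q\<^sup>2))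
    = J 4 q ^ 3 * J 28 q * JJ 2 56 q * JJ 26 56 q / (J 2 q ^ 2 * J 8 q * J 56 q * JJ 8 56 q * JJ 16 56 q)"
proof -
  have "JJ 8 56 q * JJ 16 56 q * (qpoch_inf (q ^ 32) (q ^ 56) * qpoch_inf (q ^ 24) (q ^ 56)) = J 8 q * J 56 q"
    unfolding J_8_56 by (simp add: JJ_def J_def)
  moreover have "JJ 8 56 q \<noteq> 0" "JJ 16 56 q \<noteq> 0" by (simp_all add: JJ_def P_nonzero)
  ultimately have 1: "qpoch_inf (q ^ 32) (q ^ 56) * qpoch_inf (q ^ 24) (q ^ 56) = J 8 q * J 56 q / (JJ 8 56 q * JJ 16 56 q)"
    by (simp add: field_simps)
  have 2: "JJ 2 56 q * JJ 26 56 q = qpoch_inf (q ^ 2) (q ^ 28) * qpoch_inf (q ^ 26) (q ^ 28) * J 56 q ^ 2"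
    using qpoch_inf_bisect[of 28 2] qpoch_inf_bisect[of 28 26] by (simp add: JJ_def J_def power2_eq_square)
  have 3: "J 4 q ^ 3 * J 28 q * JJ 2 56 q * JJ 26 56 q = J 4 q ^ 3 * J 28 q * (JJ 2 56 q * JJ 26 56 q)"
    by (simp only: mult.assoc)
  show ?thesis unfolding quint_prod_odd 1 3 2 K_odd_J J_def[symmetric]
    using J_nonzero[of 2] J_nonzero[of 4] J_nonzero[of 8] J_nonzero[of 56] by (simp add: divide_simps eval_nat_numeral)
qed

text \<open>After splitting residues modulo 28 into residues modulo 56, the odd multiples of 4
  together with \<open>J 8\<close> make up \<open>J 4\<close>; the two remaining residues form the
  theta product in the numerator.\<close>

lemma product_even:
  "K_even q * (K_even q / qpoch_inf (q ^ 4) (q ^ 4) * quint_prod 2 7 (q ^ 4)) = J 8 q * J 56 q * JJ 8 56 q / (J 4 q ^ 2 * JJ 4 56 q)" (is "?A1 = ?B1")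
  "K_even q * (K_even q / qpoch_inf (q ^ 4) (q ^ 4) * quint_prod 1 7 (q ^ 4)) = J 8 q * J 56 q * JJ 24 56 q / (J 4 q ^ 2 * JJ 12 56 q)" (is "?A2 = ?B2")
  "K_even q * (K_even q / qpoch_inf (q ^ 4) (q ^ 4) * quint_prod 3 7 (q ^ 4)) = J 8 q * J 56 q * JJ 16 56 q / (J 4 q ^ 2 * JJ 20 56 q)" (is "?A3 = ?B3")
proof -
  have eq: "K_even q * (K_even q / qpoch_inf (q ^ 4) (q ^ 4) * x) = J 8 q * (J 8 q * x) / (J 4 q ^ 2 * J 4 q)" for x
    unfolding K_even_J by (simp add: J_def power2_eq_square)
  have aux: "J 8 q * x / (J 4 q ^ 2 * J 4 q) = J 8 q * J 56 q * y / (J 4 q ^ 2 * z)"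
    if "x * z = J 4 q * (J 56 q * y)" "z \<noteq> 0" for x y z
    using that J_nonzero[of 4] by (simp add: divide_simps mult_ac)
  show "?A1 = ?B1" unfolding eq
  proof (rule aux)
    show "J 8 q * quint_prod 2 7 (q ^ 4) * JJ 4 56 q = J 4 q * (J 56 q * JJ 8 56 q)"
      using qpoch_inf_bisect[of 28 8] qpoch_inf_bisect[of 28 20] J_28_56
      unfolding quint_prod_even J_4_56 JJ_def by (simp, (simp add: J_def mult_ac)?)
  qed (simp add: JJ_def P_nonzero)
  show "?A2 = ?B2" unfolding eq
  proof (rule aux)
    show "J 8 q * quint_prod 1 7 (q ^ 4) * JJ 12 56 q = J 4 q * (J 56 q * JJ 24 56 q)"
      using qpoch_inf_bisect[of 28 4] qpoch_inf_bisect[of 28 24] J_28_56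
      unfolding quint_prod_even J_4_56 JJ_def by (simp, (simp add: J_def mult_ac)?)
  qed (simp add: JJ_def P_nonzero)
  show "?A3 = ?B3" unfolding eq
  proof (rule aux)
    show "J 8 q * quint_prod 3 7 (q ^ 4) * JJ 20 56 q = J 4 q * (J 56 q * JJ 16 56 q)"
      using qpoch_inf_bisect[of 28 12] qpoch_inf_bisect[of 28 16] J_28_56
      unfolding quint_prod_even J_4_56 JJ_def by (simp, (simp add: J_def mult_ac)?)
  qed (simp add: JJ_def P_nonzero)
qed

end

definition rhs1 :: "complex \<Rightarrow> complex" where
  "rhs1 q = J 4 q ^ 3 * J 56 q * JJ 6 28 q / (J 2 q ^ 2 * J 8 q * JJ 8 56 q * JJ 24 56 q)
         + 2 * q * (J 8 q * J 56 q * JJ 8 56 q / (J 4 q ^ 2 * JJ 4 56 q))"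

definition rhs2 :: "complex \<Rightarrow> complex" where
  "rhs2 q = 2 * (J 8 q * J 56 q * JJ 24 56 q / (J 4 q ^ 2 * JJ 12 56 q))
         + q * (J 4 q ^ 3 * J 28 q * JJ 10 56 q * JJ 18 56 q
                / (J 2 q ^ 2 * J 8 q * J 56 q * JJ 16 56 q * JJ 24 56 q))"

definition rhs3 :: "complex \<Rightarrow> complex" where
  "rhs3 q = J 4 q ^ 3 * J 28 q * JJ 2 56 q * JJ 26 56 q
                / (J 2 q ^ 2 * J 8 q * J 56 q * JJ 8 56 q * JJ 16 56 q)
         + 2 * q ^ 3 * (J 8 q * J 56 q * JJ 16 56 q / (J 4 q ^ 2 * JJ 20 56 q))"

lemma J_0: "m > 0 \<Longrightarrow> J m 0 = 1"
  by (simp add: J_def power_0_left)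

lemma JJ_0: "0 < a \<Longrightarrow> a < m \<Longrightarrow> JJ a m 0 = 1"
  by (simp add: JJ_def power_0_left)

text \<open>The theta series need \<open>q \<noteq> 0\<close>. At \<open>q = 0\<close> the
  convention \<open>0 powi 0 = 1\<close> leaves just the terms with exponent 0.\<close>

theorem identity1:
  fixes q :: complex
  assumes q: "norm q < 1"
  shows "((\<lambda>(i, j). q powi ((int i)^2 + 2 * (int j)^2 - 2 * int i * int j)
          / (qpoch (q^4) (q^4) i * qpoch (q^4) (q^4) j)) has_sum rhs1 q) (UNIV :: (nat \<times> nat) set)"
proof (cases "q = 0")
  case True
  show ?thesis
  proof (rule has_sum_finite_neutralI[of "{(0, 0)}"])
    fix z :: "nat \<times> nat" assume z: "z \<in> UNIV - {(0, 0)}"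
    obtain i j where ij: "z = (i, j)" by (cases z)
    have eq: "(int i)^2 + 2 * (int j)^2 - 2 * int i * int j = (int i - int j)\<^sup>2 + (int j)\<^sup>2"
      by (simp add: power2_eq_square algebra_simps)
    have "(int i)^2 + 2 * (int j)^2 - 2 * int i * int j \<noteq> 0"
      unfolding eq using z ij by (auto simp: sum_power2_eq_zero_iff)
    then show "(case z of (i, j) \<Rightarrow> q powi ((int i)^2 + 2 * (int j)^2 - 2 * int i * int j)
          / (qpoch (q^4) (q^4) i * qpoch (q^4) (q^4) j)) = 0"
      unfolding ij prod.case True by (simp only: power_int_0_left_if if_False div_0)
  qed (simp_all add: True rhs1_def J_0 JJ_0)
next
  case False
  have "(nahm_term q 0 0 has_sum (K_odd q * (K_odd q / qpoch_inf (q ^ 4) (q ^ 4) * quint_prod 3 14 (q\<^sup>2)) + 2 * q * (K_even q * (K_even q / qpoch_inf (q ^ 4) (q ^ 4) * quint_prod 2 7 (q ^ 4))))) UNIV"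
    using nahm1[OF q False] by (simp only: mult.assoc)
  then have "(nahm_term q 0 0 has_sum rhs1 q) UNIV"
    by (simp only: rhs1_def product_odd_1[OF q] product_even(1)[OF q])
  then show ?thesis by (simp add: nahm_term_def)
qed

theorem identity2:
  fixes q :: complex
  assumes q: "norm q < 1"
  shows "((\<lambda>(i, j). q powi ((int i)^2 + 2 * (int j)^2 - 2 * int i * int j + 2 * int i - 2 * int j)
          / (qpoch (q^4) (q^4) i * qpoch (q^4) (q^4) j)) has_sum rhs2 q) (UNIV :: (nat \<times> nat) set)"
proof (cases "q = 0")
  case True
  show ?thesis
  \<comment> \<open>Here the exponent vanishes at two points, since
    \<open>(i - j + 1)\<^sup>2 + j\<^sup>2 = 1\<close> has the solutions \<open>(0, 0)\<close> and
    \<open>(0, 1)\<close>. They account for the constant 2 of \<open>rhs2\<close>.\<close>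
  proof (rule has_sum_finite_neutralI[of "{(0, 0), (0, 1)}"])
    fix z :: "nat \<times> nat" assume z: "z \<in> UNIV - {(0, 0), (0, 1)}"
    obtain i j where ij: "z = (i, j)" by (cases z)
    have "(int i)^2 + 2 * (int j)^2 - 2 * int i * int j + 2 * int i - 2 * int j \<noteq> 0"
    proof
      assume "(int i)^2 + 2 * (int j)^2 - 2 * int i * int j + 2 * int i - 2 * int j = 0"
      then have eq: "(int i - int j + 1)\<^sup>2 + (int j)\<^sup>2 = 1"
        by (simp add: power2_eq_square algebra_simps)
      have "int j < 2"
      proof (rule ccontr)
        assume "\<not> int j < 2"
        then have "2 * 2 \<le> int j * int j" by (intro mult_mono) auto
        then show False
          using eq zero_le_power2[of "int i - int j + 1"] unfolding power2_eq_square by linarith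
      qed
      then have "j = 0 \<or> j = 1" by auto
      then show False
      proof
        assume j: "j = 0"
        then have "(int i + 1)\<^sup>2 = 1" using eq by simp
        then have "i = 0" by (simp add: power2_eq_1_iff)
        then show False using z ij j by simp
      next
        assume j: "j = 1"
        then have "i = 0" using eq by simp
        then show False using z ij j by simp
      qed
    qed
    then show "(case z of (i, j) \<Rightarrow> q powi ((int i)^2 + 2 * (int j)^2 - 2 * int i * int j + 2 * int i - 2 * int j)
          / (qpoch (q^4) (q^4) i * qpoch (q^4) (q^4) j)) = 0"
      unfolding ij prod.case True by (simp only: power_int_0_left_if if_False div_0)
  qed (simp_all add: True rhs2_def J_0 JJ_0 qpoch_def)
next
  case False
  have "(nahm_term q 2 (- 2) has_sum (2 * (K_even q * (K_even q / qpoch_inf (q ^ 4) (q ^ 4) * quint_prod 1 7 (q ^ 4))) + q * (K_odd q * (K_odd q / qpoch_inf (q ^ 4) (q ^ 4) * quint_prod 5 14 (q\<^sup>2))))) UNIV"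
    using nahm2[OF q False] by (simp only: mult.assoc)
  then have "(nahm_term q 2 (- 2) has_sum rhs2 q) UNIV"
    by (simp only: rhs2_def product_odd_2[OF q] product_even(2)[OF q])
  then show ?thesis by (simp add: nahm_term_def)
qed

theorem identity3:
  fixes q :: complex
  assumes q: "norm q < 1"
  shows "((\<lambda>(i, j). q powi ((int i)^2 + 2 * (int j)^2 - 2 * int i * int j + 2 * int i)
          / (qpoch (q^4) (q^4) i * qpoch (q^4) (q^4) j)) has_sum rhs3 q) (UNIV :: (nat \<times> nat) set)"
proof (cases "q = 0")
  case True
  show ?thesis
  proof (rule has_sum_finite_neutralI[of "{(0, 0)}"])
    fix z :: "nat \<times> nat" assume z: "z \<in> UNIV - {(0, 0)}"
    obtain i j where ij: "z = (i, j)" by (cases z)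
    have "(int i)^2 + 2 * (int j)^2 - 2 * int i * int j + 2 * int i \<noteq> 0"
    proof
      assume eq: "(int i)^2 + 2 * (int j)^2 - 2 * int i * int j + 2 * int i = 0"
      have "(int i)^2 + 2 * (int j)^2 - 2 * int i * int j = (int i - int j)\<^sup>2 + (int j)\<^sup>2"
        by (simp add: power2_eq_square algebra_simps)
      then have "(int j)\<^sup>2 = 0" "int i = 0"
        using eq zero_le_power2[of "int i - int j"] zero_le_power2[of "int j"] by linarith+
      then show False using z ij by simp
    qed
    then show "(case z of (i, j) \<Rightarrow> q powi ((int i)^2 + 2 * (int j)^2 - 2 * int i * int j + 2 * int i)
          / (qpoch (q^4) (q^4) i * qpoch (q^4) (q^4) j)) = 0"
      unfolding ij prod.case True by (simp only: power_int_0_left_if if_False div_0)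
  qed (simp_all add: True rhs3_def J_0 JJ_0)
next
  case False
  have "(nahm_term q 2 0 has_sum (K_odd q * (K_odd q / qpoch_inf (q ^ 4) (q ^ 4) * quint_prod 1 14 (q\<^sup>2)) + 2 * q ^ 3 * (K_even q * (K_even q / qpoch_inf (q ^ 4) (q ^ 4) * quint_prod 3 7 (q ^ 4))))) UNIV"
    using nahm3[OF q False] by (simp only: mult.assoc)
  then have "(nahm_term q 2 0 has_sum rhs3 q) UNIV"
    by (simp only: rhs3_def product_odd_3[OF q] product_even(3)[OF q])
  then show ?thesis by (simp add: nahm_term_def)
qed

section \<open>Klein forms\<close>

definition ee :: "complex \<Rightarrow> complex" where
  "ee z = exp (2 * of_real pi * \<i> * z)"

lemma ee_add: "ee (a + b) = ee a * ee b"
  by (simp add: ee_def distrib_left exp_add)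

lemma ee_diff: "ee (a - b) = ee a / ee b"
  by (simp add: ee_def right_diff_distrib exp_diff)

lemma ee_0 [simp]: "ee 0 = 1" by (simp add: ee_def)

lemma ee_nonzero [simp]: "ee z \<noteq> 0" by (simp add: ee_def)

lemma ee_minus: "ee (- z) = inverse (ee z)" by (simp add: ee_def exp_minus)

lemma ee_of_nat_mult: "ee (of_nat n * z) = ee z ^ n"
  by (simp add: ee_def exp_of_nat_mult[symmetric] mult_ac)

lemma ee_of_int_mult: "ee (of_int n * z) = ee z powi n"
  by (cases n rule: int_cases2) (simp_all add: ee_of_nat_mult power_int_minus ee_minus)

lemma ee_eq_1_iff: "ee z = 1 \<longleftrightarrow> (\<exists>n::int. z = of_int n)"
proof -
  have "ee z = 1 \<longleftrightarrow> (\<exists>n::int. Re z = of_int n \<and> Im z = 0)"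
    unfolding ee_def exp_eq_1 by auto
  also have "\<dots> \<longleftrightarrow> (\<exists>n::int. z = of_int n)"
    by (auto simp: complex_eq_iff)
  finally show ?thesis .
qed

lemma ee_of_int [simp]: "ee (of_int n) = 1"
  using ee_eq_1_iff by blast

lemma ee_half: "ee (1 / 2) = - 1"
  by (simp add: ee_def mult.commute)

lemma ee_half_int: "ee (of_int n / 2) = (- 1) powi n"
  using ee_of_int_mult[of n "1 / 2"] by (simp add: ee_half)

lemma norm_ee: "norm (ee z) = exp (- (2 * pi * Im z))"
  by (simp add: ee_def)

lemma norm_ee_less_1: "Im z > 0 \<Longrightarrow> norm (ee z) < 1"
  by (simp add: norm_ee)

lemma holomorphic_ee [holomorphic_intros]: "f holomorphic_on A \<Longrightarrow> (\<lambda>z. ee (f z)) holomorphic_on A"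
  unfolding ee_def by (intro holomorphic_intros)

text \<open>Up to a constant this is the theta function with a simple zero at the lattice points,
  divided by the cube of eta. The powers \<open>q^(1/8)\<close> of both cancel, so no root of the
  nome has to be chosen.\<close>

definition kphi :: "complex \<Rightarrow> complex \<Rightarrow> complex" where
  "kphi z \<tau> = ee (- z / 2) * qpoch_inf (ee z) (ee \<tau>) * qpoch_inf (ee (\<tau> - z)) (ee \<tau>)
      / (qpoch_inf (ee \<tau>) (ee \<tau>))\<^sup>2"

context
  fixes \<tau> :: complex
  assumes \<tau>: "Im \<tau> > 0"
begin

lemma norm_nome: "norm (ee \<tau>) < 1"
  by (rule norm_ee_less_1[OF \<tau>])

lemma kphi_holomorphic: "(\<lambda>z. kphi z \<tau>) holomorphic_on A"
proof -
  have "(\<lambda>z. kphi z \<tau>) holomorphic_on UNIV"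
    unfolding kphi_def
    by (intro holomorphic_intros) (use norm_nome qpoch_inf_nonzero[OF norm_nome norm_nome] in auto)
  then show ?thesis by (rule holomorphic_on_subset) auto
qed

lemma kphi_add_int: "kphi (z + of_int n) \<tau> = (- 1) powi n * kphi z \<tau>"
proof -
  have "ee (z + of_int n) = ee z" "ee (\<tau> - (z + of_int n)) = ee (\<tau> - z)"
    by (simp_all add: ee_add ee_diff)
  moreover have "ee (- (z + of_int n) / 2) = (- 1) powi n * ee (- z / 2)"
  proof -
    have "- (z + of_int n) / 2 = of_int (- n) / 2 + - z / 2" by (simp add: field_simps)
    then have "ee (- (z + of_int n) / 2) = ee (of_int (- n) / 2) * ee (- z / 2)" by (simp only: ee_add)
    then show ?thesis unfolding ee_half_int by (simp add: neg_one_powi)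
  qed
  ultimately show ?thesis by (simp add: kphi_def)
qed

lemma kphi_add_\<tau>: "kphi (z + \<tau>) \<tau> = - ee (- z - \<tau> / 2) * kphi z \<tau>"
proof -
  define w where "w = ee z"
  define q where "q = ee \<tau>"
  have q: "norm q < 1" unfolding q_def by (rule norm_nome)
  have 1: "qpoch_inf w q = (1 - w) * qpoch_inf (w * q) q" by (rule qpoch_inf_rec[OF q])
  have 2: "qpoch_inf (1 / w) q = (1 - 1 / w) * qpoch_inf (q / w) q"
    using qpoch_inf_rec[OF q, of "1 / w"] by (simp add: w_def)
  have w: "w \<noteq> 0" by (simp add: w_def)
  obtain u where u: "1 - w = u" by blast
  have 6: "1 - 1 / w = - (1 - w) / w" using w by (simp add: field_simps)
  have 3: "ee (- (z + \<tau>) / 2) = ee (- z / 2) * ee (- \<tau> / 2)"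
    unfolding ee_add[symmetric] by (simp add: field_simps)
  have 4: "ee (- z - \<tau> / 2) = ee (- \<tau> / 2) / w"
  proof -
    have "- z - \<tau> / 2 = - \<tau> / 2 - z" by simp
    then show ?thesis by (simp only: ee_diff w_def)
  qed
  have 5: "ee (z + \<tau>) = w * q" "ee (\<tau> - (z + \<tau>)) = 1 / w" "ee (\<tau> - z) = q / w"
    by (simp_all add: w_def q_def ee_add ee_diff ee_minus divide_inverse)
  show ?thesis
    unfolding kphi_def 3 4 5 w_def[symmetric] q_def[symmetric] 1 2 6 u by (simp add: mult_ac)
qed

lemma kphi_sub_\<tau>: "kphi (z - \<tau>) \<tau> = - ee (z - \<tau> / 2) * kphi z \<tau>"
proof -
  have "kphi z \<tau> = - ee (- (z - \<tau>) - \<tau> / 2) * kphi (z - \<tau>) \<tau>"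
    using kphi_add_\<tau>[of "z - \<tau>"] by simp
  moreover have "ee (- (z - \<tau>) - \<tau> / 2) * ee (z - \<tau> / 2) = 1"
    unfolding ee_add[symmetric] by (simp add: algebra_simps)
  ultimately show ?thesis by (simp add: algebra_simps)
qed

lemma kphi_add_int_\<tau>: "kphi (z + of_int m * \<tau>) \<tau> = (- 1) powi m * ee (- of_int m * z - (of_int m)\<^sup>2 * \<tau> / 2) * kphi z \<tau>"
proof (induction m rule: int_induct[where k = 0])
  case (step1 m)
  have "kphi (z + of_int (m + 1) * \<tau>) \<tau> = kphi ((z + of_int m * \<tau>) + \<tau>) \<tau>"
    by (simp add: algebra_simps)
  also have "\<dots> = - ((- 1) powi m) * (ee (- (z + of_int m * \<tau>) - \<tau> / 2) * ee (- of_int m * z - (of_int m)\<^sup>2 * \<tau> / 2)) * kphi z \<tau>"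
    unfolding kphi_add_\<tau> step1(2) by simp
  also have "ee (- (z + of_int m * \<tau>) - \<tau> / 2) * ee (- of_int m * z - (of_int m)\<^sup>2 * \<tau> / 2)
      = ee (- of_int (m + 1) * z - (of_int (m + 1))\<^sup>2 * \<tau> / 2)"
    unfolding ee_add[symmetric]
    by (simp add: algebra_simps power2_eq_square add_divide_distrib diff_divide_distrib)
  also have "- ((- 1) powi m) = (- 1 :: complex) powi (m + 1)" by (simp add: neg_one_powi)
  finally show ?case .
next
  case (step2 m)
  have "kphi (z + of_int (m - 1) * \<tau>) \<tau> = kphi ((z + of_int m * \<tau>) - \<tau>) \<tau>"
    by (simp add: algebra_simps)
  also have "\<dots> = - ((- 1) powi m) * (ee ((z + of_int m * \<tau>) - \<tau> / 2) * ee (- of_int m * z - (of_int m)\<^sup>2 * \<tau> / 2)) * kphi z \<tau>"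
    unfolding kphi_sub_\<tau> step2(2) by simp
  also have "ee ((z + of_int m * \<tau>) - \<tau> / 2) * ee (- of_int m * z - (of_int m)\<^sup>2 * \<tau> / 2)
      = ee (- of_int (m - 1) * z - (of_int (m - 1))\<^sup>2 * \<tau> / 2)"
    unfolding ee_add[symmetric]
    by (simp add: algebra_simps power2_eq_square add_divide_distrib diff_divide_distrib)
  also have "- ((- 1) powi m) = (- 1 :: complex) powi (m - 1)" by (simp add: neg_one_powi)
  finally show ?case .
qed simp

lemma kphi_add_lattice:
  "kphi (z + (of_int m * \<tau> + of_int n)) \<tau>
     = (- 1) powi (m + n) * ee (- of_int m * z - (of_int m)\<^sup>2 * \<tau> / 2) * kphi z \<tau>"
proof -
  have "kphi (z + (of_int m * \<tau> + of_int n)) \<tau> = kphi ((z + of_int m * \<tau>) + of_int n) \<tau>"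
    by (simp only: add.assoc)
  also have "\<dots> = (- 1) powi n * ((- 1) powi m * ee (- of_int m * z - (of_int m)\<^sup>2 * \<tau> / 2) * kphi z \<tau>)"
    by (simp only: kphi_add_int kphi_add_int_\<tau>)
  finally show ?thesis by (simp add: power_int_add mult_ac)
qed

lemma kphi_eq_0_iff: "kphi z \<tau> = 0 \<longleftrightarrow> (\<exists>m n. z = of_int m * \<tau> + of_int n)"
proof
  assume "kphi z \<tau> = 0"
  then have "qpoch_inf (ee z) (ee \<tau>) = 0 \<or> qpoch_inf (ee (\<tau> - z)) (ee \<tau>) = 0"
    using qpoch_inf_nonzero[OF norm_nome norm_nome] by (simp add: kphi_def)
  then show "\<exists>m n. z = of_int m * \<tau> + of_int n"
  proof
    assume "qpoch_inf (ee z) (ee \<tau>) = 0"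
    then obtain k where "ee z * ee \<tau> ^ k = 1" using qpoch_inf_eq_0_iff[OF norm_nome] by blast
    then have "ee (z + of_nat k * \<tau>) = 1" by (simp add: ee_add ee_of_nat_mult)
    then obtain n :: int where "z + of_nat k * \<tau> = of_int n" unfolding ee_eq_1_iff by blast
    then have "z = of_int (- int k) * \<tau> + of_int n" by (simp add: algebra_simps)
    then show ?thesis by blast
  next
    assume "qpoch_inf (ee (\<tau> - z)) (ee \<tau>) = 0"
    then obtain k where "ee (\<tau> - z) * ee \<tau> ^ k = 1" using qpoch_inf_eq_0_iff[OF norm_nome] by blast
    then have "ee ((\<tau> - z) + of_nat k * \<tau>) = 1" by (simp only: ee_add ee_of_nat_mult)
    then obtain n :: int where "(\<tau> - z) + of_nat k * \<tau> = of_int n" unfolding ee_eq_1_iff by blast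
    then have "z = of_int (1 + int k) * \<tau> + of_int (- n)" by (simp add: algebra_simps)
    then show ?thesis by blast
  qed
next
  assume "\<exists>m n. z = of_int m * \<tau> + of_int n"
  then obtain m n where "z = of_int m * \<tau> + of_int n" by blast
  then have z: "z = 0 + (of_int m * \<tau> + of_int n)" by simp
  have "qpoch_inf 1 (ee \<tau>) = 0"
    using qpoch_inf_eq_0_iff[OF norm_nome] by (metis mult_1 power_0)
  then have "kphi 0 \<tau> = 0" by (simp add: kphi_def)
  then show "kphi z \<tau> = 0" unfolding z by (simp only: kphi_add_lattice mult_zero_right)
qed

lemma kphi_0: "kphi 0 \<tau> = 0"
proof -
  have "0 = of_int 0 * \<tau> + of_int 0" by simp
  then show ?thesis unfolding kphi_eq_0_iff by blast
qed

text \<open>The derivative at 0 is the same for all \<tau>. This normalisation is what makes the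
  constant in the transformation law equal to 1.\<close>

lemma kphi_deriv_0: "((\<lambda>z. kphi z \<tau> / z) \<longlongrightarrow> - (2 * of_real pi * \<i>)) (at 0)"
proof -
  define q where "q = ee \<tau>"
  have q: "norm q < 1" unfolding q_def by (rule norm_nome)
  define h where "h z = ee (- z / 2) * qpoch_inf (ee z * q) q * qpoch_inf (ee (\<tau> - z)) q / (qpoch_inf q q)\<^sup>2" for z
  have "h holomorphic_on UNIV"
    unfolding h_def by (intro holomorphic_intros) (use q qpoch_inf_nonzero[OF q q] in auto)
  then have "isCont h 0"
    using holomorphic_on_imp_continuous_on[of h UNIV] by (simp add: continuous_on_eq_continuous_at)
  then have h: "(h \<longlongrightarrow> h 0) (at 0)" by (simp add: isCont_def)
  have "h 0 = 1"
    using qpoch_inf_nonzero[OF q q] by (simp add: h_def q_def power2_eq_square)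
  have "(ee has_field_derivative 2 * of_real pi * \<i>) (at 0)"
    unfolding ee_def[abs_def] by (auto intro!: derivative_eq_intros)
  then have "((\<lambda>z. (ee z - 1) / z) \<longlongrightarrow> 2 * of_real pi * \<i>) (at 0)"
    by (simp add: DERIV_def)
  then have "((\<lambda>z. - ((ee z - 1) / z) * h z) \<longlongrightarrow> - (2 * of_real pi * \<i>) * h 0) (at 0)"
    by (intro tendsto_intros h)
  moreover have "kphi z \<tau> / z = - ((ee z - 1) / z) * h z" for z
  proof -
    have "kphi z \<tau> = (1 - ee z) * h z"
      using qpoch_inf_rec[OF q, of "ee z"] by (simp add: kphi_def h_def q_def)
    moreover have "1 - ee z = - (ee z - 1)" by simp
    ultimately show ?thesis by (simp only: times_divide_eq_left mult_minus_left minus_divide_left)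
  qed
  ultimately show ?thesis using \<open>h 0 = 1\<close> by simp
qed

end

lemma Im_moebius:
  fixes a b c d :: int
  assumes "a * d - b * c = 1" "Im \<tau> > 0"
  shows "of_int c * \<tau> + of_int d \<noteq> 0"
    and "Im ((of_int a * \<tau> + of_int b) / (of_int c * \<tau> + of_int d)) > 0"
proof -
  define j where "j = of_int c * \<tau> + of_int d"
  show nz: "of_int c * \<tau> + of_int d \<noteq> 0"
  proof
    assume "of_int c * \<tau> + of_int d = 0"
    then have "Im (of_int c * \<tau> + of_int d) = 0" "Re (of_int c * \<tau> + of_int d) = 0" by simp_all
    then have "c = 0" "d = 0" using assms(2) by auto
    then show False using assms(1) by simp
  qed
  have "Im ((of_int a * \<tau> + of_int b) / j) = Im \<tau> * (of_int (a * d - b * c)) / (norm j)\<^sup>2"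
    unfolding Im_divide j_def cmod_power2 by (simp add: algebra_simps)
  then show "Im ((of_int a * \<tau> + of_int b) / (of_int c * \<tau> + of_int d)) > 0"
    using assms nz by (simp add: j_def)
qed

text \<open>By the determinant, \<open>a\<close> and \<open>c\<close> are not both even, so
  \<open>(1 + a) * (1 + c)\<close> is even and the total sign, with exponent
  \<open>a + c + a * c\<close> up to parity, is -1.\<close>

lemma neg_one_powi_coprime:
  fixes a c :: int
  assumes "a * d - b * c = 1"
  shows "(- 1) powi (a + c) * ee (- (of_int a * of_int c) / 2) = - 1"
proof -
  have odd: "odd a \<or> odd c"
  proof (rule ccontr)
    assume "\<not> (odd a \<or> odd c)"
    then have "even (a * d - b * c)" by simp
    then show False using assms by simp
  qed
  have "ee (- (of_int a * of_int c) / 2) = ee (of_int (- (a * c)) / 2)" by simp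
  also have "\<dots> = (- 1) powi (- (a * c))" by (rule ee_half_int)
  finally show ?thesis using odd by (auto simp: neg_one_powi)
qed

text \<open>Both sides are entire in \<open>z\<close>, with the same simple zeros and the same multipliers under
  the translations by \<open>1\<close> and \<open>\<tau>\<close>. Their quotient is constant by Liouville's theorem, and the
  constant is found at \<open>z = 0\<close>.\<close>

theorem kphi_modular:
  fixes a b c d :: int
  assumes det: "a * d - b * c = 1" and \<tau>: "Im \<tau> > 0"
  defines "j \<equiv> of_int c * \<tau> + of_int d"
  defines "\<tau>' \<equiv> (of_int a * \<tau> + of_int b) / j"
  shows "kphi (z / j) \<tau>' = inverse j * ee (of_int c * z\<^sup>2 / (2 * j)) * kphi z \<tau>"
proof -
  have j: "j \<noteq> 0" and \<tau>': "Im \<tau>' > 0"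
    using Im_moebius[OF det \<tau>] unfolding \<tau>'_def j_def by auto
  have det': "of_int a * of_int d - of_int b * of_int c = (1 :: complex)"
    using det by (metis of_int_1 of_int_diff of_int_mult)
  \<comment> \<open>Division by \<open>j\<close> carries the periods \<open>1\<close> and \<tau> to
    lattice vectors of \<open>\<tau>'\<close>; the coordinates are entries of the inverse
    matrix.\<close>
  have inv_j: "1 / j = of_int (- c) * \<tau>' + of_int a"
  proof -
    have "of_int (- c) * \<tau>' + of_int a = (of_int a * j - of_int c * (of_int a * \<tau> + of_int b)) / j"
      using j by (simp add: \<tau>'_def field_simps)
    also have "of_int a * j - of_int c * (of_int a * \<tau> + of_int b) = of_int a * of_int d - of_int b * of_int c"
      by (simp add: j_def algebra_simps)
    finally show ?thesis by (simp add: det')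
  qed
  have \<tau>_j: "\<tau> / j = of_int d * \<tau>' + of_int (- b)"
  proof -
    have "of_int d * \<tau>' + of_int (- b) = (of_int d * (of_int a * \<tau> + of_int b) - of_int b * j) / j"
      using j by (simp add: \<tau>'_def field_simps)
    also have "of_int d * (of_int a * \<tau> + of_int b) - of_int b * j = (of_int a * of_int d - of_int b * of_int c) * \<tau>"
      by (simp add: j_def algebra_simps)
    finally show ?thesis by (simp add: det')
  qed
  \<comment> \<open>The exponential compensates the terms by which the multipliers of
    \<open>kphi (z / j) \<tau>'\<close> differ from those of \<open>kphi z \<tau>\<close>, and
    \<open>j\<close> normalises the derivative at 0.\<close>
  define h where "h z = j * ee (- (of_int c * z\<^sup>2 / (2 * j))) * kphi (z / j) \<tau>'" for z
  have h_hol: "h holomorphic_on A" for A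
  proof -
    have "(\<lambda>z. z / j) holomorphic_on A" using j by (intro holomorphic_intros) auto
    then have "(\<lambda>z. kphi (z / j) \<tau>') holomorphic_on A"
      using holomorphic_on_compose[OF _ kphi_holomorphic[OF \<tau>']] by (simp add: o_def)
    then show ?thesis unfolding h_def using j by (intro holomorphic_intros) auto
  qed
  have h_1: "h (z + 1) = - h z" for z
  proof -
    have "(z + 1) / j = z / j + (of_int (- c) * \<tau>' + of_int a)"
      by (simp only: add_divide_distrib inv_j)
    then have "h (z + 1) = j * (ee (- (of_int c * (z + 1)\<^sup>2 / (2 * j)))
        * ((- 1) powi (- c + a) * ee (- of_int (- c) * (z / j) - (of_int (- c))\<^sup>2 * \<tau>' / 2) * kphi (z / j) \<tau>'))"
      by (simp only: h_def kphi_add_lattice[OF \<tau>'] mult.assoc)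
    also have "\<dots> = j * ((- 1) powi (a + c) * (ee (- (of_int c * (z + 1)\<^sup>2 / (2 * j)))
        * ee (- of_int (- c) * (z / j) - (of_int (- c))\<^sup>2 * \<tau>' / 2))) * kphi (z / j) \<tau>'"
      by (simp add: neg_one_powi)
    also have "ee (- (of_int c * (z + 1)\<^sup>2 / (2 * j))) * ee (- of_int (- c) * (z / j) - (of_int (- c))\<^sup>2 * \<tau>' / 2)
        = ee (- (of_int a * of_int c) / 2) * ee (- (of_int c * z\<^sup>2 / (2 * j)))"
    proof -
      have "of_int c * \<tau>' = of_int a - 1 / j" unfolding inv_j by simp
      then have 1: "(of_int c)\<^sup>2 * \<tau>' = of_int c * (of_int a - 1 / j)"
        by (simp only: power2_eq_square mult.assoc)
      show ?thesis unfolding ee_add[symmetric] of_int_minus power2_minus 1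
        using j by (intro arg_cong[of _ _ ee]) (simp add: field_simps power2_eq_square)
    qed
    also have "(- 1) powi (a + c) * (ee (- (of_int a * of_int c) / 2) * ee (- (of_int c * z\<^sup>2 / (2 * j))))
        = - ee (- (of_int c * z\<^sup>2 / (2 * j)))"
      unfolding mult.assoc[symmetric] neg_one_powi_coprime[OF det] by simp
    finally show ?thesis by (simp add: h_def)
  qed
  have h_\<tau>: "h (z + \<tau>) = - ee (- z - \<tau> / 2) * h z" for z
  proof -
    have "(z + \<tau>) / j = z / j + (of_int d * \<tau>' + of_int (- b))"
      by (simp only: add_divide_distrib \<tau>_j)
    then have "h (z + \<tau>) = j * (ee (- (of_int c * (z + \<tau>)\<^sup>2 / (2 * j)))
        * ((- 1) powi (d + - b) * ee (- of_int d * (z / j) - (of_int d)\<^sup>2 * \<tau>' / 2) * kphi (z / j) \<tau>'))"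
      by (simp only: h_def kphi_add_lattice[OF \<tau>'] mult.assoc)
    also have "\<dots> = j * ((- 1) powi (d + b) * (ee (- (of_int c * (z + \<tau>)\<^sup>2 / (2 * j)))
        * ee (- of_int d * (z / j) - (of_int d)\<^sup>2 * \<tau>' / 2))) * kphi (z / j) \<tau>'"
      by (simp add: neg_one_powi)
    also have "ee (- (of_int c * (z + \<tau>)\<^sup>2 / (2 * j))) * ee (- of_int d * (z / j) - (of_int d)\<^sup>2 * \<tau>' / 2)
        = ee (- (of_int d * of_int b) / 2) * (ee (- z - \<tau> / 2) * ee (- (of_int c * z\<^sup>2 / (2 * j))))"
    proof -
      have "of_int d * \<tau>' = \<tau> / j + of_int b" unfolding \<tau>_j by simp
      then have 1: "(of_int d)\<^sup>2 * \<tau>' = of_int d * (\<tau> / j + of_int b)"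
        by (simp only: power2_eq_square mult.assoc)
      have 2: "of_int d = j - of_int c * \<tau>" by (simp add: j_def)
      have 3: "- (of_int c * (z + \<tau>)\<^sup>2 / (2 * j)) + (- D * (z / j) - D * (\<tau> / j + B) / 2)
          = - (D * B) / 2 + (- z - \<tau> / 2 + - (of_int c * z\<^sup>2 / (2 * j)))"
        if "D = j - of_int c * \<tau>" for D B
        unfolding that using j by (simp add: field_simps power2_eq_square)
      show ?thesis unfolding ee_add[symmetric] 1 3[OF 2] ..
    qed
    also have "(- 1) powi (d + b) * (ee (- (of_int d * of_int b) / 2) * (ee (- z - \<tau> / 2) * ee (- (of_int c * z\<^sup>2 / (2 * j)))))
        = - (ee (- z - \<tau> / 2) * ee (- (of_int c * z\<^sup>2 / (2 * j))))"
      unfolding mult.assoc[symmetric] using neg_one_powi_coprime[of d a c b] det by (simp add: mult.commute)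
    finally show ?thesis by (simp add: h_def)
  qed
  define \<Lambda> where "\<Lambda> = {z. kphi z \<tau> = 0}"
  \<comment> \<open>The value 1 is the limit of the quotient at 0; by double periodicity the
    removability at 0 passes to every lattice point.\<close>
  define G where "G z = (if z \<in> \<Lambda> then 1 else h z / kphi z \<tau>)" for z
  have k_1: "kphi (z + 1) \<tau> = - kphi z \<tau>" for z
    using kphi_add_int[OF \<tau>, of z 1] by simp
  have G_1: "G (z + 1) = G z" for z
    by (simp add: G_def \<Lambda>_def k_1 h_1)
  have G_\<tau>: "G (z + \<tau>) = G z" for z
    by (simp add: G_def \<Lambda>_def kphi_add_\<tau>[OF \<tau>] h_\<tau>)
  have G_int: "G (z + of_int n) = G z" for z n
  proof (induction n rule: int_induct[where k = 0])
    case (step1 n)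
    then show ?case using G_1[of "z + of_int n"] by (simp add: add.assoc)
  next
    case (step2 n)
    then show ?case using G_1[of "z + of_int (n - 1)"] by (simp add: algebra_simps)
  qed simp
  have G_int_\<tau>: "G (z + of_int m * \<tau>) = G z" for z m
  proof (induction m rule: int_induct[where k = 0])
    case (step1 n)
    then show ?case using G_\<tau>[of "z + of_int n * \<tau>"] by (simp add: algebra_simps)
  next
    case (step2 n)
    then show ?case using G_\<tau>[of "z + of_int (n - 1) * \<tau>"] by (simp add: algebra_simps)
  qed simp
  have G_lat: "G (z + (of_int m * \<tau> + of_int n)) = G z" for z m n
    using G_int[of "z + of_int m * \<tau>" n] G_int_\<tau>[of z m] by (simp add: add.assoc)
  have open_\<Lambda>: "open (- \<Lambda>)"
  proof -
    have "continuous_on UNIV (\<lambda>z. kphi z \<tau>)"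
      by (intro holomorphic_on_imp_continuous_on kphi_holomorphic \<tau>)
    then have "closed \<Lambda>" unfolding \<Lambda>_def by (intro closed_Collect_eq) auto
    then show ?thesis by (simp add: open_closed)
  qed
  have G_off: "G holomorphic_on (- \<Lambda>)"
  proof -
    have "(\<lambda>z. h z / kphi z \<tau>) holomorphic_on (- \<Lambda>)"
      by (intro holomorphic_intros h_hol kphi_holomorphic \<tau>) (auto simp: \<Lambda>_def)
    then show ?thesis by (rule holomorphic_transform) (auto simp: G_def)
  qed
  have G_lim: "(G \<longlongrightarrow> 1) (at 0)" and iso: "eventually (\<lambda>z. z \<notin> \<Lambda>) (at 0)"
  proof -
    have phi0: "((\<lambda>z. kphi z \<tau> / z) \<longlongrightarrow> - (2 * of_real pi * \<i>)) (at 0)"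
      by (rule kphi_deriv_0[OF \<tau>])
    have ev: "eventually (\<lambda>z. kphi z \<tau> / z \<noteq> 0) (at 0)"
      by (rule tendsto_imp_eventually_ne[OF phi0]) simp
    then show iso: "eventually (\<lambda>z. z \<notin> \<Lambda>) (at 0)"
      by eventually_elim (auto simp: \<Lambda>_def)
    have "filterlim (\<lambda>z. z / j) (at 0) (at 0)"
      by (rule filterlim_atI) (use j in \<open>auto intro!: tendsto_eq_intros simp: eventually_at_filter\<close>)
    then have 1: "((\<lambda>z. kphi (z / j) \<tau>' / (z / j)) \<longlongrightarrow> - (2 * of_real pi * \<i>)) (at 0)"
      by (rule filterlim_compose[OF kphi_deriv_0[OF \<tau>']])
    have "(\<lambda>z. ee (- (of_int c * z\<^sup>2 / (2 * j)))) holomorphic_on UNIV"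
      using j by (intro holomorphic_intros) auto
    then have "continuous_on UNIV (\<lambda>z. ee (- (of_int c * z\<^sup>2 / (2 * j))))"
      by (rule holomorphic_on_imp_continuous_on)
    then have "isCont (\<lambda>z. ee (- (of_int c * z\<^sup>2 / (2 * j)))) 0"
      by (simp add: continuous_on_eq_continuous_at)
    then have 2: "((\<lambda>z. ee (- (of_int c * z\<^sup>2 / (2 * j)))) \<longlongrightarrow> 1) (at 0)"
      by (simp add: isCont_def)
    have "((\<lambda>z. ee (- (of_int c * z\<^sup>2 / (2 * j))) * (kphi (z / j) \<tau>' / (z / j)) / (kphi z \<tau> / z))
        \<longlongrightarrow> 1 * (- (2 * of_real pi * \<i>)) / (- (2 * of_real pi * \<i>))) (at 0)"
      by (intro tendsto_divide tendsto_mult 1 2 phi0) simp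
    then have lim: "((\<lambda>z. ee (- (of_int c * z\<^sup>2 / (2 * j))) * (kphi (z / j) \<tau>' / (z / j)) / (kphi z \<tau> / z))
        \<longlongrightarrow> 1) (at 0)" by simp
    have "eventually (\<lambda>z. ee (- (of_int c * z\<^sup>2 / (2 * j))) * (kphi (z / j) \<tau>' / (z / j)) / (kphi z \<tau> / z) = G z) (at 0)"
      using iso eventually_neq_at_within[of 0 0 UNIV]
      by eventually_elim (use j in \<open>simp add: G_def h_def\<close>)
    with lim show "(G \<longlongrightarrow> 1) (at 0)" by (rule Lim_transform_eventually)
  qed
  have zero_\<Lambda>: "0 \<in> \<Lambda>" by (simp add: \<Lambda>_def kphi_0[OF \<tau>])
  obtain e where e: "e > 0" "\<And>z. z \<in> ball 0 e \<Longrightarrow> z \<noteq> 0 \<Longrightarrow> z \<notin> \<Lambda>"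
    using iso unfolding eventually_at by (force simp: dist_commute)
  have G_0: "G holomorphic_on ball 0 e"
  proof (rule no_isolated_singularity[of _ _ "{0}"])
    show hol: "G holomorphic_on ball 0 e - {0}"
      by (rule holomorphic_on_subset[OF G_off]) (use e in auto)
    have "isCont G 0" using G_lim zero_\<Lambda> by (simp add: isCont_def G_def)
    moreover have "continuous_on (ball 0 e - {0}) G"
      using hol by (rule holomorphic_on_imp_continuous_on)
    then have "isCont G z" if "z \<in> ball 0 e" "z \<noteq> 0" for z
      using that by (subst (asm) continuous_on_eq_continuous_at) (auto intro: open_delete)
    ultimately show "continuous_on (ball 0 e) G"
      by (intro continuous_at_imp_continuous_on) metis
  qed auto
  have G_diff: "G field_differentiable at z" for z
  proof (cases "z \<in> \<Lambda>")
    case False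
    then show ?thesis using holomorphic_on_imp_differentiable_at[OF G_off open_\<Lambda>] by simp
  next
    case True
    then obtain m n where z: "z = of_int m * \<tau> + of_int n"
      using kphi_eq_0_iff[OF \<tau>] unfolding \<Lambda>_def by blast
    have "G field_differentiable at 0"
      using holomorphic_on_imp_differentiable_at[OF G_0] e by simp
    then have "(G \<circ> (\<lambda>w. w - z)) field_differentiable at z"
      by (intro field_differentiable_compose) (auto intro!: derivative_intros simp: field_differentiable_diff)
    also have "G \<circ> (\<lambda>w. w - z) = G"
      using G_lat[of "w - z" m n for w] by (simp add: o_def z fun_eq_iff)
    finally show ?thesis .
  qed
  have G_hol: "G holomorphic_on UNIV"
    using G_diff by (simp add: holomorphic_on_def field_differentiable_at_within)
  define K where "K = (\<lambda>(s, t). of_real s * \<tau> + of_real t) ` ({0..1} \<times> {0..1})"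
  have "compact K" unfolding K_def
    by (intro compact_continuous_image compact_Times compact_Icc)
       (auto simp: case_prod_unfold intro!: continuous_intros)
  moreover have "continuous_on K G"
    by (rule holomorphic_on_imp_continuous_on[OF holomorphic_on_subset[OF G_hol]]) auto
  ultimately have "bounded (G ` K)"
    by (intro compact_imp_bounded compact_continuous_image)
  moreover have "range G \<subseteq> G ` K"
  proof safe
    fix z
    define s where "s = Im z / Im \<tau>"
    define t where "t = Re z - s * Re \<tau>"
    have z: "z = of_real s * \<tau> + of_real t"
      using \<tau> by (simp add: complex_eq_iff s_def t_def)
    define w where "w = of_real (frac s) * \<tau> + of_real (frac t)"
    have "z = w + (of_int \<lfloor>s\<rfloor> * \<tau> + of_int \<lfloor>t\<rfloor>)"
      unfolding z w_def frac_def by (simp add: algebra_simps)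
    then have "G z = G w" using G_lat by simp
    moreover have "w \<in> K"
      unfolding K_def w_def by (rule image_eqI[of _ _ "(frac s, frac t)"]) (auto simp: frac_lt_1 less_imp_le)
    ultimately show "G z \<in> G ` K" by simp
  qed
  ultimately have "bounded (range G)" by (rule bounded_subset)
  then obtain k where k: "\<And>z. G z = k"
    using Liouville_theorem[OF G_hol] unfolding constant_on_def by auto
  have "k = 1" using k[of 0] zero_\<Lambda> by (simp add: G_def)
  have h_eq: "h z = kphi z \<tau>" for z
  proof (cases "z \<in> \<Lambda>")
    case False
    then show ?thesis using k[of z] \<open>k = 1\<close> by (simp add: G_def \<Lambda>_def)
  next
    case True
    then obtain m n where z: "z = of_int m * \<tau> + of_int n"
      using kphi_eq_0_iff[OF \<tau>] unfolding \<Lambda>_def by blast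
    have "z / j = of_int m * (\<tau> / j) + of_int n * (1 / j)"
      unfolding z by (simp add: add_divide_distrib)
    also have "\<dots> = of_int (m * d - n * c) * \<tau>' + of_int (n * a - m * b)"
      unfolding \<tau>_j inv_j by (simp add: algebra_simps)
    finally have "kphi (z / j) \<tau>' = 0" using kphi_eq_0_iff[OF \<tau>'] by blast
    then show ?thesis using True by (simp add: h_def \<Lambda>_def)
  qed
  have "ee (of_int c * z\<^sup>2 / (2 * j)) * ee (- (of_int c * z\<^sup>2 / (2 * j))) = 1"
    unfolding ee_add[symmetric] by simp
  moreover have "inverse j * ee (of_int c * z\<^sup>2 / (2 * j)) * h z
    = (inverse j * j) * (ee (of_int c * z\<^sup>2 / (2 * j)) * ee (- (of_int c * z\<^sup>2 / (2 * j)))) * kphi (z / j) \<tau>'"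
    unfolding h_def by (simp only: mult_ac)
  ultimately show ?thesis using j by (simp add: h_eq)
qed

lemma qpow_ee: "qpow x \<tau> = ee (of_rat x * \<tau>)"
  by (simp add: qpow_def ee_def mult.assoc)

text \<open>The Klein form with characteristic \<open>(r, s)\<close>, up to a constant. The
  exponential factor absorbs the one in \<open>kphi_modular\<close>, so that a matrix acts just by
  weight -1 and by right multiplication on the row \<open>(r, s)\<close>.\<close>

definition klein :: "rat \<Rightarrow> rat \<Rightarrow> complex \<Rightarrow> complex" where
  "klein r s \<tau> = ee (of_rat r * (of_rat r * \<tau> + of_rat s) / 2) * kphi (of_rat r * \<tau> + of_rat s) \<tau>"

lemma klein_modular:
  fixes a b c d :: int
  assumes det: "a * d - b * c = 1" and \<tau>: "Im \<tau> > 0"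
  shows "klein r s ((of_int a * \<tau> + of_int b) / (of_int c * \<tau> + of_int d))
    = inverse (of_int c * \<tau> + of_int d) * klein (r * of_int a + s * of_int c) (r * of_int b + s * of_int d) \<tau>"
proof -
  define j where "j = of_int c * \<tau> + of_int d"
  define \<tau>' where "\<tau>' = (of_int a * \<tau> + of_int b) / j"
  define r' s' where "r' = r * of_int a + s * of_int c" and "s' = r * of_int b + s * of_int d"
  define R S R' S' :: complex where "R = of_rat r" and "S = of_rat s" and "R' = of_rat r'" and "S' = of_rat s'"
  define z where "z = R' * \<tau> + S'"
  have j: "j \<noteq> 0" using Im_moebius[OF det \<tau>] by (simp add: j_def)
  have R': "R' = R * of_int a + S * of_int c" and S': "S' = R * of_int b + S * of_int d"
    by (simp_all add: R'_def S'_def R_def S_def r'_def s'_def of_rat_add of_rat_mult)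
  have det': "of_int a * of_int d - of_int b * of_int c = (1 :: complex)"
    using det by (metis of_int_1 of_int_diff of_int_mult)
  have z: "R * \<tau>' + S = z / j"
    using j by (simp add: z_def \<tau>'_def R' S' field_simps) (simp add: j_def algebra_simps)
  have key: "R + of_int c * z = R' * j"
  proof -
    have "R' * j - of_int c * z = R * (of_int a * of_int d - of_int b * of_int c)"
      by (simp add: z_def j_def R' S' algebra_simps)
    then show ?thesis by (simp add: det' algebra_simps)
  qed
  have "klein r s \<tau>' = ee (R * (z / j) / 2) * kphi (z / j) \<tau>'"
    unfolding klein_def R_def[symmetric] S_def[symmetric] z ..
  also have "kphi (z / j) \<tau>' = inverse j * ee (of_int c * z\<^sup>2 / (2 * j)) * kphi z \<tau>"
    unfolding \<tau>'_def j_def by (rule kphi_modular[OF det \<tau>])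
  also have "ee (R * (z / j) / 2) * (inverse j * ee (of_int c * z\<^sup>2 / (2 * j)) * kphi z \<tau>)
    = inverse j * ((ee (R * (z / j) / 2) * ee (of_int c * z\<^sup>2 / (2 * j))) * kphi z \<tau>)"
    by (simp only: mult_ac)
  also have "ee (R * (z / j) / 2) * ee (of_int c * z\<^sup>2 / (2 * j)) = ee (R' * z / 2)"
  proof -
    have "R * (z / j) / 2 + of_int c * z\<^sup>2 / (2 * j) = (R + of_int c * z) * z / (2 * j)"
      using j by (simp add: field_simps power2_eq_square)
    also have "\<dots> = R' * z / 2" unfolding key using j by simp
    finally show ?thesis by (simp only: ee_add[symmetric])
  qed
  finally show ?thesis
    unfolding \<tau>'_def j_def klein_def r'_def[symmetric] s'_def[symmetric] R'_def[symmetric] S'_def[symmetric] z_def .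
qed

text \<open>For rational characteristics the factor is an explicit root of unity. It is the only
  multiplier that occurs in the whole argument.\<close>

lemma klein_shift:
  assumes "Im \<tau> > 0"
  shows "klein (r + of_int m) (s + of_int n) \<tau>
    = (- 1) powi (m + n + m * n) * ee ((of_rat r * of_int n - of_rat s * of_int m) / 2) * klein r s \<tau>"
proof -
  define R S :: complex where "R = of_rat r" and "S = of_rat s"
  define z where "z = R * \<tau> + S"
  have z: "(R + of_int m) * \<tau> + (S + of_int n) = z + (of_int m * \<tau> + of_int n)"
    by (simp add: z_def algebra_simps)
  have "klein (r + of_int m) (s + of_int n) \<tau>
     = ee ((R + of_int m) * (z + (of_int m * \<tau> + of_int n)) / 2)
       * ((- 1) powi (m + n) * ee (- of_int m * z - (of_int m)\<^sup>2 * \<tau> / 2) * kphi z \<tau>)"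
    unfolding klein_def of_rat_add of_rat_of_int_eq R_def[symmetric] S_def[symmetric] z
    by (simp only: kphi_add_lattice[OF assms])
  also have "\<dots> = (- 1) powi (m + n) * (ee ((R + of_int m) * (z + (of_int m * \<tau> + of_int n)) / 2)
      * ee (- of_int m * z - (of_int m)\<^sup>2 * \<tau> / 2)) * kphi z \<tau>"
    by (simp only: mult_ac)
  also have "ee ((R + of_int m) * (z + (of_int m * \<tau> + of_int n)) / 2) * ee (- of_int m * z - (of_int m)\<^sup>2 * \<tau> / 2)
     = ee (of_int (m * n) / 2) * ee ((R * of_int n - S * of_int m) / 2) * ee (R * z / 2)"
  proof -
    have "(R + of_int m) * (z + (of_int m * \<tau> + of_int n)) / 2 + (- of_int m * z - (of_int m)\<^sup>2 * \<tau> / 2)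
       = of_int (m * n) / 2 + (R * of_int n - S * of_int m) / 2 + R * z / 2"
      by (simp add: z_def algebra_simps add_divide_distrib diff_divide_distrib power2_eq_square)
    then show ?thesis by (simp only: ee_add[symmetric])
  qed
  finally show ?thesis
    unfolding klein_def R_def[symmetric] S_def[symmetric] z_def[symmetric] ee_half_int
    by (simp add: power_int_add mult_ac)
qed

section \<open>Behaviour at the cusps\<close>

text \<open>The condition of \<open>meromorphic_at_cusp\<close> for a function already moved to
  infinity. The width \<open>h\<close> stays free so that fractional exponents are covered.\<close>

definition cusp_mero :: "(complex \<Rightarrow> complex) \<Rightarrow> bool" where
  "cusp_mero f \<longleftrightarrow> (\<exists>h::nat. h > 0 \<and> (\<exists>g Y. g meromorphic_on {0} \<and>
     (\<forall>\<tau>. Im \<tau> > Y \<longrightarrow> f \<tau> = g (ee (\<tau> / of_nat h)))))"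

lemma meromorphic_power_compose:
  assumes "g meromorphic_on {0}" "k > 0"
  shows "(\<lambda>w. g (w ^ k)) meromorphic_on {0}"
  by (rule meromorphic_on_compose[OF assms(1)]) (use assms(2) in \<open>auto intro!: analytic_intros simp: power_0_left\<close>)

lemma ee_div_power: "k > 0 \<Longrightarrow> ee (\<tau> / of_nat (h * k)) ^ k = ee (\<tau> / of_nat h)"
  unfolding ee_of_nat_mult[symmetric] by simp

text \<open>The product of the two widths serves as a common one.\<close>

lemma cusp_mero_binop:
  assumes "cusp_mero f1" "cusp_mero f2"
    and op: "\<And>g1 g2. g1 meromorphic_on {0} \<Longrightarrow> g2 meromorphic_on {0} \<Longrightarrow> (\<lambda>w. F (g1 w) (g2 w)) meromorphic_on {0 :: complex}"
  shows "cusp_mero (\<lambda>\<tau>. F (f1 \<tau>) (f2 \<tau>))"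
proof -
  obtain h1 g1 Y1 where 1: "h1 > 0" "g1 meromorphic_on {0}" "\<And>\<tau>. Im \<tau> > Y1 \<Longrightarrow> f1 \<tau> = g1 (ee (\<tau> / of_nat h1))"
    using assms(1) unfolding cusp_mero_def by blast
  obtain h2 g2 Y2 where 2: "h2 > 0" "g2 meromorphic_on {0}" "\<And>\<tau>. Im \<tau> > Y2 \<Longrightarrow> f2 \<tau> = g2 (ee (\<tau> / of_nat h2))"
    using assms(2) unfolding cusp_mero_def by blast
  have "F (f1 \<tau>) (f2 \<tau>) = F (g1 (ee (\<tau> / of_nat (h1 * h2)) ^ h2)) (g2 (ee (\<tau> / of_nat (h1 * h2)) ^ h1))"
    if "Im \<tau> > max Y1 Y2" for \<tau>
    using 1(3)[of \<tau>] 2(3)[of \<tau>] that ee_div_power[OF 2(1), of \<tau> h1] ee_div_power[OF 1(1), of \<tau> h2]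
    by (simp add: mult.commute)
  moreover have "(\<lambda>w. F (g1 (w ^ h2)) (g2 (w ^ h1))) meromorphic_on {0}"
    by (intro op meromorphic_power_compose 1 2)
  ultimately show ?thesis
    unfolding cusp_mero_def using 1(1) 2(1)
    by (intro exI[of _ "h1 * h2"] conjI exI[of _ "\<lambda>w. F (g1 (w ^ h2)) (g2 (w ^ h1))"] exI[of _ "max Y1 Y2"]) auto
qed

lemma cusp_mero_mult: "cusp_mero f \<Longrightarrow> cusp_mero g \<Longrightarrow> cusp_mero (\<lambda>\<tau>. f \<tau> * g \<tau>)"
  by (rule cusp_mero_binop) (auto intro: meromorphic_intros)

lemma cusp_mero_add: "cusp_mero f \<Longrightarrow> cusp_mero g \<Longrightarrow> cusp_mero (\<lambda>\<tau>. f \<tau> + g \<tau>)"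
  by (rule cusp_mero_binop) (auto intro: meromorphic_intros)

lemma cusp_mero_divide: "cusp_mero f \<Longrightarrow> cusp_mero g \<Longrightarrow> cusp_mero (\<lambda>\<tau>. f \<tau> / g \<tau>)"
  by (rule cusp_mero_binop) (auto intro: meromorphic_intros)

lemma cusp_mero_const: "cusp_mero (\<lambda>\<tau>. c)"
  unfolding cusp_mero_def by (intro exI[of _ 1] conjI exI[of _ "\<lambda>w. c"]) auto

lemma cusp_mero_cong:
  assumes "cusp_mero f" "\<And>\<tau>. Im \<tau> > 0 \<Longrightarrow> f \<tau> = g \<tau>"
  shows "cusp_mero g"
proof -
  obtain h G Y where 1: "h > 0" "G meromorphic_on {0}" "\<And>\<tau>. Im \<tau> > Y \<Longrightarrow> f \<tau> = G (ee (\<tau> / of_nat h))"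
    using assms(1) unfolding cusp_mero_def by blast
  have "g \<tau> = G (ee (\<tau> / of_nat h))" if "Im \<tau> > max Y 0" for \<tau>
    using 1(3)[of \<tau>] assms(2)[of \<tau>] that by simp
  then show ?thesis unfolding cusp_mero_def using 1(1,2) by blast
qed

lemma ee_rat_power:
  fixes x :: rat and h :: nat
  assumes "h > 0" "x * of_nat h = of_int X"
  shows "ee (of_rat x * \<tau>) = ee (\<tau> / of_nat h) powi X"
proof -
  have "of_rat x * of_nat h = (of_int X :: complex)"
    using arg_cong[OF assms(2), of "of_rat :: rat \<Rightarrow> complex"] by (simp add: of_rat_mult)
  then have "of_int X * (\<tau> / of_nat h) = of_rat x * \<tau>"
    using assms(1) by (simp add: field_simps)
  then show ?thesis by (simp add: ee_of_int_mult[symmetric])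
qed

lemma rat_denominator:
  fixes x :: rat
  obtains h :: nat and X :: int where "h > 0" "x * of_nat h = of_int X"
proof -
  obtain a b where ab: "quotient_of x = (a, b)" by fastforce
  then have "b > 0" "x = of_int a / of_int b"
    using quotient_of_denom_pos quotient_of_div by auto
  then show ?thesis using that[of "nat b" a] by simp
qed

lemma cusp_mero_ee: "cusp_mero (\<lambda>\<tau>. ee (of_rat x * \<tau> + c))"
proof -
  obtain h X where h: "h > 0" "x * of_nat h = of_int X" using rat_denominator[of x] by blast
  show ?thesis unfolding cusp_mero_def
    by (intro exI[of _ h] conjI exI[of _ "\<lambda>w. w powi X * ee c"] exI[of _ 0])
       (use h in \<open>auto intro!: meromorphic_intros simp: ee_add ee_rat_power[OF h]\<close>)
qed

text \<open>In \<open>w = ee (\<tau> / h)\<close> argument and base are constant multiples of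
  \<open>w ^ m\<close> and \<open>w ^ n\<close> with \<open>n > 0\<close>. The base vanishes at
  \<open>w = 0\<close>, so the product is holomorphic there.\<close>

lemma cusp_mero_qpoch_inf:
  fixes x y :: rat
  assumes "x \<ge> 0" "y > 0"
  shows "cusp_mero (\<lambda>\<tau>. qpoch_inf (ee (of_rat x * \<tau> + c)) (ee (of_rat y * \<tau> + d)))"
proof -
  obtain h1 X where h1: "h1 > 0" "x * of_nat h1 = of_int X" using rat_denominator[of x] by blast
  obtain h2 Y where h2: "h2 > 0" "y * of_nat h2 = of_int Y" using rat_denominator[of y] by blast
  define h where "h = h1 * h2"
  have h: "h > 0" "x * of_nat h = of_int (X * int h2)" "y * of_nat h = of_int (Y * int h1)"
    using h1 h2 by (simp_all add: h_def flip: h1(2) h2(2))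
  have "of_int X \<ge> (0 :: rat)" "of_int Y > (0 :: rat)"
    using assms h1 h2 by (simp_all flip: h1(2) h2(2))
  then have XY: "X * int h2 \<ge> 0" "Y * int h1 > 0" using h1 h2 by auto
  define m n where "m = nat (X * int h2)" and "n = nat (Y * int h1)"
  have mn: "X * int h2 = int m" "Y * int h1 = int n" "n > 0"
    using XY by (auto simp: m_def n_def)
  define g where "g w = qpoch_inf (w ^ m * ee c) (w ^ n * ee d)" for w
  define A where "A = {w. norm (w ^ n * ee d) < 1}"
  have "open A" unfolding A_def by (intro open_Collect_less continuous_intros)
  have "g holomorphic_on A"
    unfolding g_def using \<open>open A\<close> by (intro holomorphic_intros) (auto simp: A_def)
  moreover have "0 \<in> A" using mn by (simp add: A_def power_0_left)
  ultimately have "g analytic_on {0}"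
    using \<open>open A\<close> analytic_at by blast
  then have "g meromorphic_on {0}" by (rule analytic_on_imp_meromorphic_on)
  moreover have "qpoch_inf (ee (of_rat x * \<tau> + c)) (ee (of_rat y * \<tau> + d)) = g (ee (\<tau> / of_nat h))" for \<tau>
    unfolding g_def ee_add ee_rat_power[OF h(1,2)] ee_rat_power[OF h(1,3)] mn by simp
  ultimately show ?thesis unfolding cusp_mero_def using h(1) by blast
qed

text \<open>Once \<open>r\<close> is replaced by its fractional part \<open>t\<close>, the exponents
  \<open>t\<close> and \<open>1 - t\<close> of the two products are nonnegative, so that
  \<open>cusp_mero_qpoch_inf\<close> applies.\<close>

lemma cusp_mero_klein:
  fixes \<alpha> \<beta> \<delta> :: int
  assumes "\<alpha> > 0" "\<delta> > 0"
  shows "cusp_mero (\<lambda>\<tau>. klein r s ((of_int \<alpha> * \<tau> + of_int \<beta>) / of_int \<delta>))"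
proof -
  define u v :: rat where "u = of_int \<alpha> / of_int \<delta>" and "v = of_int \<beta> / of_int \<delta>"
  define \<sigma> where "\<sigma> \<tau> = of_rat u * \<tau> + of_rat v" for \<tau> :: complex
  have u: "u > 0" using assms by (simp add: u_def)
  have \<sigma>: "(of_int \<alpha> * \<tau> + of_int \<beta>) / of_int \<delta> = \<sigma> \<tau>" for \<tau>
    by (simp add: \<sigma>_def u_def v_def of_rat_divide add_divide_distrib)
  define t where "t = frac r"
  have t: "0 \<le> t" "t < 1" by (simp_all add: t_def frac_lt_1)
  have Im_\<sigma>: "Im (\<sigma> \<tau>) > 0" if "Im \<tau> > 0" for \<tau>
    using that assms unfolding \<sigma>[symmetric] by simp
  have eq: "klein r s (\<sigma> \<tau>) = ((- 1) powi \<lfloor>r\<rfloor> * ee ((- of_rat s * of_int \<lfloor>r\<rfloor>) / 2)) * klein t s (\<sigma> \<tau>)"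
    if "Im \<tau> > 0" for \<tau>
    using klein_shift[OF Im_\<sigma>[OF that], of t "\<lfloor>r\<rfloor>" s 0] by (simp add: t_def frac_def)
  have "cusp_mero (\<lambda>\<tau>. ((- 1) powi \<lfloor>r\<rfloor> * ee ((- of_rat s * of_int \<lfloor>r\<rfloor>) / 2))
     * (ee (of_rat ((t * t - t) / 2 * u) * \<tau> + of_rat ((t * t - t) / 2 * v + (t - 1) * s / 2))
        * qpoch_inf (ee (of_rat (t * u) * \<tau> + of_rat (t * v + s))) (ee (of_rat u * \<tau> + of_rat v))
        * qpoch_inf (ee (of_rat ((1 - t) * u) * \<tau> + of_rat ((1 - t) * v - s))) (ee (of_rat u * \<tau> + of_rat v))
        / (qpoch_inf (ee (of_rat u * \<tau> + of_rat v)) (ee (of_rat u * \<tau> + of_rat v))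
           * qpoch_inf (ee (of_rat u * \<tau> + of_rat v)) (ee (of_rat u * \<tau> + of_rat v)))))"
    using t u by (intro cusp_mero_mult cusp_mero_divide cusp_mero_const cusp_mero_ee cusp_mero_qpoch_inf) auto
  then show ?thesis
  proof (rule cusp_mero_cong)
    fix \<tau> :: complex assume \<tau>: "Im \<tau> > 0"
    define T U V S :: complex where "T = of_rat t" and "U = of_rat u" and "V = of_rat v" and "S = of_rat s"
    have e1: "T * (T * (U * \<tau> + V) + S) / 2 + - (T * (U * \<tau> + V) + S) / 2
        = (T * T - T) / 2 * U * \<tau> + ((T * T - T) / 2 * V + (T - 1) * S / 2)"
      by (simp add: algebra_simps add_divide_distrib diff_divide_distrib)
    have e2: "T * (U * \<tau> + V) + S = T * U * \<tau> + (T * V + S)"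
      "U * \<tau> + V - (T * (U * \<tau> + V) + S) = (1 - T) * U * \<tau> + ((1 - T) * V - S)"
      by (simp_all add: algebra_simps)
    have k: "klein t s (\<sigma> \<tau>) = ee ((T * T - T) / 2 * U * \<tau> + ((T * T - T) / 2 * V + (T - 1) * S / 2))
       * qpoch_inf (ee (T * U * \<tau> + (T * V + S))) (ee (U * \<tau> + V))
       * qpoch_inf (ee ((1 - T) * U * \<tau> + ((1 - T) * V - S))) (ee (U * \<tau> + V))
       / (qpoch_inf (ee (U * \<tau> + V)) (ee (U * \<tau> + V)) * qpoch_inf (ee (U * \<tau> + V)) (ee (U * \<tau> + V)))"
      unfolding klein_def kphi_def \<sigma>_def T_def[symmetric] U_def[symmetric] V_def[symmetric] S_def[symmetric]
        e1[symmetric] e2[symmetric] power2_eq_square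
      by (simp only: ee_add times_divide_eq_right mult.assoc)
    show "((- 1) powi \<lfloor>r\<rfloor> * ee ((- of_rat s * of_int \<lfloor>r\<rfloor>) / 2))
     * (ee (of_rat ((t * t - t) / 2 * u) * \<tau> + of_rat ((t * t - t) / 2 * v + (t - 1) * s / 2))
        * qpoch_inf (ee (of_rat (t * u) * \<tau> + of_rat (t * v + s))) (ee (of_rat u * \<tau> + of_rat v))
        * qpoch_inf (ee (of_rat ((1 - t) * u) * \<tau> + of_rat ((1 - t) * v - s))) (ee (of_rat u * \<tau> + of_rat v))
        / (qpoch_inf (ee (of_rat u * \<tau> + of_rat v)) (ee (of_rat u * \<tau> + of_rat v))
           * qpoch_inf (ee (of_rat u * \<tau> + of_rat v)) (ee (of_rat u * \<tau> + of_rat v))))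
      = klein r s ((of_int \<alpha> * \<tau> + of_int \<beta>) / of_int \<delta>)"
      unfolding \<sigma> eq[OF \<tau>] k T_def U_def V_def S_def
      by (simp add: of_rat_add of_rat_mult of_rat_diff of_rat_divide)
  qed
qed

text \<open>Invariance of weight \<open>w\<close> is only required for \<open>\<gamma> \<equiv> I (mod N)\<close>. For a function of period 1
  this gives \<open>\<Gamma>\<^sub>1(N)\<close>, since \<open>\<gamma> T\<^sup>k \<equiv> I\<close> for a suitable \<open>k\<close>.\<close>

definition inv_wt :: "nat \<Rightarrow> int \<Rightarrow> (complex \<Rightarrow> complex) \<Rightarrow> bool" where
  "inv_wt N w f \<longleftrightarrow> (\<forall>a b c d a' b' c' d' \<tau>. Im \<tau> > 0 \<longrightarrow> a * d - b * c = 1 \<longrightarrow>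
     a = 1 + int N * a' \<longrightarrow> b = int N * b' \<longrightarrow> c = int N * c' \<longrightarrow> d = 1 + int N * d' \<longrightarrow>
     f ((of_int a * \<tau> + of_int b) / (of_int c * \<tau> + of_int d)) = (of_int c * \<tau> + of_int d) powi w * f \<tau>)"

text \<open>The factor \<open>c \<tau> + d\<close> is kept apart from \<open>g\<close>, since for
  \<open>c \<noteq> 0\<close> it is no function of \<open>ee (\<tau> / h)\<close>; it disappears in
  weight 0.\<close>

definition cusp_wt :: "int \<Rightarrow> (complex \<Rightarrow> complex) \<Rightarrow> bool" where
  "cusp_wt w f \<longleftrightarrow> (\<forall>a b c d. a * d - b * c = 1 \<longrightarrow> (\<exists>g. cusp_mero g \<and> (\<forall>\<tau>. Im \<tau> > 0 \<longrightarrow>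
     f ((of_int a * \<tau> + of_int b) / (of_int c * \<tau> + of_int d)) = (of_int c * \<tau> + of_int d) powi w * g \<tau>)))"

definition modular_wt :: "nat \<Rightarrow> int \<Rightarrow> (complex \<Rightarrow> complex) \<Rightarrow> bool" where
  "modular_wt N w f \<longleftrightarrow> inv_wt N w f \<and> cusp_wt w f"

lemma modular_wt_mult:
  assumes f: "modular_wt N w1 f" and g: "modular_wt N w2 g"
  shows "modular_wt N (w1 + w2) (\<lambda>\<tau>. f \<tau> * g \<tau>)"
  unfolding modular_wt_def
proof
  have f1: "inv_wt N w1 f" and g1: "inv_wt N w2 g" using f g by (auto simp: modular_wt_def)
  show "inv_wt N (w1 + w2) (\<lambda>\<tau>. f \<tau> * g \<tau>)" unfolding inv_wt_def
  proof (intro allI impI)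
    fix a b c d a' b' c' d' :: int and \<tau> :: complex
    assume H: "Im \<tau> > 0" "a * d - b * c = 1"
      "a = 1 + int N * a'" "b = int N * b'" "c = int N * c'" "d = 1 + int N * d'"
    have nz: "of_int c * \<tau> + of_int d \<noteq> 0" using Im_moebius[OF H(2,1)] by blast
    show "f ((of_int a * \<tau> + of_int b) / (of_int c * \<tau> + of_int d)) * g ((of_int a * \<tau> + of_int b) / (of_int c * \<tau> + of_int d))
       = (of_int c * \<tau> + of_int d) powi (w1 + w2) * (f \<tau> * g \<tau>)"
      unfolding f1[unfolded inv_wt_def, rule_format, OF H] g1[unfolded inv_wt_def, rule_format, OF H]
      using power_int_add[of "of_int c * \<tau> + of_int d" w1 w2] nz by (simp only: simp_thms mult_ac)
  qed
next
  show "cusp_wt (w1 + w2) (\<lambda>\<tau>. f \<tau> * g \<tau>)" unfolding cusp_wt_def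
  proof (intro allI impI)
    fix a b c d :: int assume det: "a * d - b * c = 1"
    obtain F where F: "cusp_mero F" "\<And>\<tau>. Im \<tau> > 0 \<Longrightarrow>
      f ((of_int a * \<tau> + of_int b) / (of_int c * \<tau> + of_int d)) = (of_int c * \<tau> + of_int d) powi w1 * F \<tau>"
      using f det unfolding modular_wt_def cusp_wt_def by blast
    obtain G where G: "cusp_mero G" "\<And>\<tau>. Im \<tau> > 0 \<Longrightarrow>
      g ((of_int a * \<tau> + of_int b) / (of_int c * \<tau> + of_int d)) = (of_int c * \<tau> + of_int d) powi w2 * G \<tau>"
      using g det unfolding modular_wt_def cusp_wt_def by blast
    show "\<exists>h. cusp_mero h \<and> (\<forall>\<tau>. Im \<tau> > 0 \<longrightarrow>
      f ((of_int a * \<tau> + of_int b) / (of_int c * \<tau> + of_int d)) * g ((of_int a * \<tau> + of_int b) / (of_int c * \<tau> + of_int d))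
       = (of_int c * \<tau> + of_int d) powi (w1 + w2) * h \<tau>)"
    proof (intro exI[of _ "\<lambda>\<tau>. F \<tau> * G \<tau>"] conjI allI impI cusp_mero_mult F(1) G(1))
      fix \<tau> :: complex assume \<tau>: "Im \<tau> > 0"
      have nz: "of_int c * \<tau> + of_int d \<noteq> 0" using Im_moebius[OF det \<tau>] by blast
      show "f ((of_int a * \<tau> + of_int b) / (of_int c * \<tau> + of_int d)) * g ((of_int a * \<tau> + of_int b) / (of_int c * \<tau> + of_int d))
       = (of_int c * \<tau> + of_int d) powi (w1 + w2) * (F \<tau> * G \<tau>)"
        unfolding F(2)[OF \<tau>] G(2)[OF \<tau>]
        using power_int_add[of "of_int c * \<tau> + of_int d" w1 w2] nz by (simp only: simp_thms mult_ac)
    qed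
  qed
qed

lemma modular_wt_inverse:
  assumes f: "modular_wt N w f"
  shows "modular_wt N (- w) (\<lambda>\<tau>. inverse (f \<tau>))"
  unfolding modular_wt_def
proof
  have f1: "inv_wt N w f" using f by (auto simp: modular_wt_def)
  show "inv_wt N (- w) (\<lambda>\<tau>. inverse (f \<tau>))" unfolding inv_wt_def
  proof (intro allI impI)
    fix a b c d a' b' c' d' :: int and \<tau> :: complex
    assume H: "Im \<tau> > 0" "a * d - b * c = 1"
      "a = 1 + int N * a'" "b = int N * b'" "c = int N * c'" "d = 1 + int N * d'"
    show "inverse (f ((of_int a * \<tau> + of_int b) / (of_int c * \<tau> + of_int d)))
       = (of_int c * \<tau> + of_int d) powi (- w) * inverse (f \<tau>)"
      unfolding f1[unfolded inv_wt_def, rule_format, OF H] by (simp only: inverse_mult_distrib power_int_minus)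
  qed
next
  show "cusp_wt (- w) (\<lambda>\<tau>. inverse (f \<tau>))" unfolding cusp_wt_def
  proof (intro allI impI)
    fix a b c d :: int assume det: "a * d - b * c = 1"
    obtain F where F: "cusp_mero F" "\<And>\<tau>. Im \<tau> > 0 \<Longrightarrow>
      f ((of_int a * \<tau> + of_int b) / (of_int c * \<tau> + of_int d)) = (of_int c * \<tau> + of_int d) powi w * F \<tau>"
      using f det unfolding modular_wt_def cusp_wt_def by blast
    have "cusp_mero (\<lambda>\<tau>. inverse (F \<tau>))"
      using cusp_mero_divide[OF cusp_mero_const F(1), of 1] by (simp add: divide_inverse)
    then show "\<exists>h. cusp_mero h \<and> (\<forall>\<tau>. Im \<tau> > 0 \<longrightarrow>
      inverse (f ((of_int a * \<tau> + of_int b) / (of_int c * \<tau> + of_int d)))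
       = (of_int c * \<tau> + of_int d) powi (- w) * h \<tau>)"
      by (intro exI[of _ "\<lambda>\<tau>. inverse (F \<tau>)"] conjI allI impI)
         (simp_all only: F(2) inverse_mult_distrib power_int_minus)
  qed
qed

lemma modular_wt_const: "modular_wt N 0 (\<lambda>\<tau>. k)"
  unfolding modular_wt_def inv_wt_def cusp_wt_def using cusp_mero_const by auto

lemma modular_wt_power: "modular_wt N w f \<Longrightarrow> modular_wt N (int n * w) (\<lambda>\<tau>. f \<tau> ^ n)"
proof (induction n)
  case (Suc n)
  have "modular_wt N (w + int n * w) (\<lambda>\<tau>. f \<tau> * f \<tau> ^ n)"
    by (intro modular_wt_mult Suc)
  then show ?case by (simp add: algebra_simps)
qed (simp add: modular_wt_const)

lemma modular_wt_divide:
  "modular_wt N w1 f \<Longrightarrow> modular_wt N w2 g \<Longrightarrow> modular_wt N (w1 - w2) (\<lambda>\<tau>. f \<tau> / g \<tau>)"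
  using modular_wt_mult[OF _ modular_wt_inverse] by (simp add: divide_inverse)

lemma modular_wt_cong:
  assumes f: "modular_wt N w f" and eq: "\<And>\<tau>. Im \<tau> > 0 \<Longrightarrow> f \<tau> = g \<tau>"
  shows "modular_wt N w g"
  unfolding modular_wt_def
proof
  have f1: "inv_wt N w f" using f by (auto simp: modular_wt_def)
  show "inv_wt N w g" unfolding inv_wt_def
  proof (intro allI impI)
    fix a b c d a' b' c' d' :: int and \<tau> :: complex
    assume H: "Im \<tau> > 0" "a * d - b * c = 1"
      "a = 1 + int N * a'" "b = int N * b'" "c = int N * c'" "d = 1 + int N * d'"
    show "g ((of_int a * \<tau> + of_int b) / (of_int c * \<tau> + of_int d)) = (of_int c * \<tau> + of_int d) powi w * g \<tau>"
      using f1[unfolded inv_wt_def, rule_format, OF H] eq[OF H(1)] eq[OF Im_moebius(2)[OF H(2,1)]] by simp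
  qed
  show "cusp_wt w g" unfolding cusp_wt_def
  proof (intro allI impI)
    fix a b c d :: int assume det: "a * d - b * c = 1"
    obtain F where F: "cusp_mero F" "\<And>\<tau>. Im \<tau> > 0 \<Longrightarrow>
      f ((of_int a * \<tau> + of_int b) / (of_int c * \<tau> + of_int d)) = (of_int c * \<tau> + of_int d) powi w * F \<tau>"
      using f det unfolding modular_wt_def cusp_wt_def by blast
    show "\<exists>F. cusp_mero F \<and> (\<forall>\<tau>. Im \<tau> > 0 \<longrightarrow>
      g ((of_int a * \<tau> + of_int b) / (of_int c * \<tau> + of_int d)) = (of_int c * \<tau> + of_int d) powi w * F \<tau>)"
    proof (intro exI[of _ F] conjI allI impI F(1))
      fix \<tau> :: complex assume "Im \<tau> > 0"
      then show "g ((of_int a * \<tau> + of_int b) / (of_int c * \<tau> + of_int d)) = (of_int c * \<tau> + of_int d) powi w * F \<tau>"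
        using F(2) eq[OF Im_moebius(2)[OF det]] by simp
    qed
  qed
qed

lemma modular_wt_add_0:
  assumes f: "modular_wt N 0 f" and g: "modular_wt N 0 g"
  shows "modular_wt N 0 (\<lambda>\<tau>. f \<tau> + g \<tau>)"
  unfolding modular_wt_def
proof
  have f1: "inv_wt N 0 f" and g1: "inv_wt N 0 g" using f g by (auto simp: modular_wt_def)
  show "inv_wt N 0 (\<lambda>\<tau>. f \<tau> + g \<tau>)" unfolding inv_wt_def
  proof (intro allI impI)
    fix a b c d a' b' c' d' :: int and \<tau> :: complex
    assume H: "Im \<tau> > 0" "a * d - b * c = 1"
      "a = 1 + int N * a'" "b = int N * b'" "c = int N * c'" "d = 1 + int N * d'"
    show "f ((of_int a * \<tau> + of_int b) / (of_int c * \<tau> + of_int d)) + g ((of_int a * \<tau> + of_int b) / (of_int c * \<tau> + of_int d))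
       = (of_int c * \<tau> + of_int d) powi 0 * (f \<tau> + g \<tau>)"
      unfolding f1[unfolded inv_wt_def, rule_format, OF H] g1[unfolded inv_wt_def, rule_format, OF H] by simp
  qed
next
  show "cusp_wt 0 (\<lambda>\<tau>. f \<tau> + g \<tau>)" unfolding cusp_wt_def
  proof (intro allI impI)
    fix a b c d :: int assume det: "a * d - b * c = 1"
    obtain F where F: "cusp_mero F" "\<And>\<tau>. Im \<tau> > 0 \<Longrightarrow>
      f ((of_int a * \<tau> + of_int b) / (of_int c * \<tau> + of_int d)) = (of_int c * \<tau> + of_int d) powi 0 * F \<tau>"
      using f det unfolding modular_wt_def cusp_wt_def by blast
    obtain G where G: "cusp_mero G" "\<And>\<tau>. Im \<tau> > 0 \<Longrightarrow>
      g ((of_int a * \<tau> + of_int b) / (of_int c * \<tau> + of_int d)) = (of_int c * \<tau> + of_int d) powi 0 * G \<tau>"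
      using g det unfolding modular_wt_def cusp_wt_def by blast
    show "\<exists>h. cusp_mero h \<and> (\<forall>\<tau>. Im \<tau> > 0 \<longrightarrow>
      f ((of_int a * \<tau> + of_int b) / (of_int c * \<tau> + of_int d)) + g ((of_int a * \<tau> + of_int b) / (of_int c * \<tau> + of_int d))
       = (of_int c * \<tau> + of_int d) powi 0 * h \<tau>)"
      by (intro exI[of _ "\<lambda>\<tau>. F \<tau> + G \<tau>"] conjI allI impI cusp_mero_add F(1) G(1))
         (simp add: F(2) G(2))
  qed
qed

text \<open>\<open>diag(m, 1) \<gamma> = \<gamma>' diag(m, 1)\<close>, where
  \<open>\<gamma>'\<close> has the rows \<open>(a, m b)\<close> and \<open>(c / m, d)\<close>; it is
  integral because \<open>m\<close> divides \<open>c\<close>.\<close>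

lemma klein_mult_moebius:
  fixes a b c d m c2 :: int
  assumes m: "m > 0" and c: "c = m * c2" and det: "a * d - b * c = 1" and \<tau>: "Im \<tau> > 0"
  shows "klein r s (of_int m * ((of_int a * \<tau> + of_int b) / (of_int c * \<tau> + of_int d)))
    = inverse (of_int c * \<tau> + of_int d)
        * klein (r * of_int a + s * of_int c2) (r * of_int (m * b) + s * of_int d) (of_int m * \<tau>)"
proof -
  have m\<tau>: "Im (of_int m * \<tau>) > 0" using \<tau> m by simp
  have det': "a * d - (m * b) * c2 = 1" using det c by (simp add: algebra_simps)
  have j: "of_int c2 * (of_int m * \<tau>) + of_int d = of_int c * \<tau> + of_int d"
    by (simp add: c algebra_simps)
  have "of_int m * ((of_int a * \<tau> + of_int b) / (of_int c * \<tau> + of_int d))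
    = (of_int a * (of_int m * \<tau>) + of_int (m * b)) / (of_int c2 * (of_int m * \<tau>) + of_int d)"
    unfolding j by (simp add: algebra_simps)
  then show ?thesis
    using klein_modular[OF det' m\<tau>, of r s] by (simp only: j)
qed

text \<open>\<open>diag(m, 1) \<gamma>\<close> is the product of an element of \<open>SL\<^sub>2(\<int>)\<close> and an upper triangular matrix.\<close>

lemma cusp_wt_klein:
  fixes m :: int
  assumes m: "m > 0"
  shows "cusp_wt (- 1) (\<lambda>\<tau>. klein r s (of_int m * \<tau>))"
  unfolding cusp_wt_def
proof (intro allI impI)
  fix a b c d :: int assume det: "a * d - b * c = 1"
  \<comment> \<open>The first column \<open>(m a, c)\<close> of \<open>diag(m, 1) \<gamma>\<close>
    is \<open>g (p1, p2)\<close>. Bezout completes \<open>(p1, p2)\<close> to a matrix of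
    determinant 1 with second column \<open>(-y, x)\<close>; removing that matrix on the left leaves
    the rows \<open>(g, \<beta>)\<close> and \<open>(0, \<delta>)\<close>, and determinants give
    \<open>g \<delta> = m\<close>.\<close>
  define g where "g = gcd (m * a) c"
  have ac: "m * a \<noteq> 0 \<or> c \<noteq> 0" using det m by auto
  then have g: "g > 0" unfolding g_def by (simp add: order_less_le)
  have "g dvd m * a" "g dvd c" by (simp_all add: g_def)
  then obtain p1 p2 where p: "m * a = g * p1" "c = g * p2" by (elim dvdE)
  obtain x y where "x * (m * a) + y * c = g"
    using bezout_int[of "m * a" c] unfolding g_def by blast
  then have "g * (x * p1 + y * p2) = g * 1" unfolding p by (simp add: algebra_simps)
  then have xy: "p1 * x - (- y) * p2 = 1" using g by (simp add: mult.commute)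
  define \<beta> \<delta> where "\<beta> = x * m * b + y * d" and "\<delta> = p1 * d - p2 * m * b"
  have g\<delta>: "g * \<delta> = m"
  proof -
    have "g * \<delta> = (g * p1) * d - (g * p2) * m * b" by (simp add: \<delta>_def algebra_simps)
    also have "\<dots> = m * (a * d - b * c)" unfolding p[symmetric] by (simp add: algebra_simps)
    finally show ?thesis by (simp add: det)
  qed
  then have \<delta>: "\<delta> > 0" using m g zero_less_mult_pos[of g \<delta>] by simp
  have 1: "p1 * \<beta> - y * \<delta> = m * b"
  proof -
    have "p1 * \<beta> - y * \<delta> = (p1 * x - (- y) * p2) * (m * b)" by (simp add: \<beta>_def \<delta>_def algebra_simps)
    then show ?thesis by (simp only: xy mult_1)
  qed
  have 2: "p2 * \<beta> + x * \<delta> = d"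
  proof -
    have "p2 * \<beta> + x * \<delta> = (p1 * x - (- y) * p2) * d" by (simp add: \<beta>_def \<delta>_def algebra_simps)
    then show ?thesis by (simp only: xy mult_1)
  qed
  define r' s' where "r' = r * of_int p1 + s * of_int p2" and "s' = r * of_int (- y) + s * of_int x"
  have main: "klein r s (of_int m * ((of_int a * \<tau> + of_int b) / (of_int c * \<tau> + of_int d)))
    = (of_int c * \<tau> + of_int d) powi (- 1) * (of_int \<delta> * klein r' s' ((of_int g * \<tau> + of_int \<beta>) / of_int \<delta>))"
    if \<tau>: "Im \<tau> > 0" for \<tau>
  proof -
    define \<sigma> where "\<sigma> = (of_int g * \<tau> + of_int \<beta>) / of_int \<delta>"
    have \<sigma>: "Im \<sigma> > 0" using \<tau> g \<delta> by (simp add: \<sigma>_def)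
    have \<delta>\<sigma>: "of_int \<delta> * \<sigma> = of_int g * \<tau> + of_int \<beta>" using \<delta> by (simp add: \<sigma>_def)
    have num: "of_int \<delta> * (of_int p1 * \<sigma> + of_int (- y)) = of_int m * (of_int a * \<tau> + of_int b)"
    proof -
      have "of_int \<delta> * (of_int p1 * \<sigma> + of_int (- y)) = of_int p1 * (of_int \<delta> * \<sigma>) - of_int y * of_int \<delta>"
        by (simp add: algebra_simps)
      also have "\<dots> = of_int (g * p1) * \<tau> + of_int (p1 * \<beta> - y * \<delta>)"
        unfolding \<delta>\<sigma> by (simp add: algebra_simps)
      finally show ?thesis unfolding 1 p(1)[symmetric] by (simp add: algebra_simps)
    qed
    have den: "of_int \<delta> * (of_int p2 * \<sigma> + of_int x) = of_int c * \<tau> + of_int d"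
    proof -
      have "of_int \<delta> * (of_int p2 * \<sigma> + of_int x) = of_int p2 * (of_int \<delta> * \<sigma>) + of_int x * of_int \<delta>"
        by (simp add: algebra_simps)
      also have "\<dots> = of_int (g * p2) * \<tau> + of_int (p2 * \<beta> + x * \<delta>)"
        unfolding \<delta>\<sigma> by (simp add: algebra_simps)
      finally show ?thesis unfolding 2 p(2)[symmetric] .
    qed
    have "of_int m * ((of_int a * \<tau> + of_int b) / (of_int c * \<tau> + of_int d))
        = (of_int p1 * \<sigma> + of_int (- y)) / (of_int p2 * \<sigma> + of_int x)"
      using \<delta> unfolding times_divide_eq_right num[symmetric] den[symmetric] by simp
    then have "klein r s (of_int m * ((of_int a * \<tau> + of_int b) / (of_int c * \<tau> + of_int d)))
       = inverse (of_int p2 * \<sigma> + of_int x) * klein r' s' \<sigma>"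
      unfolding r'_def s'_def by (simp only: klein_modular[OF xy \<sigma>])
    also have "inverse (of_int p2 * \<sigma> + of_int x) = of_int \<delta> * inverse (of_int c * \<tau> + of_int d)"
      unfolding den[symmetric] using \<delta> by simp
    finally show ?thesis by (simp add: power_int_minus \<sigma>_def mult_ac)
  qed
  have "cusp_mero (\<lambda>\<tau>. of_int \<delta> * klein r' s' ((of_int g * \<tau> + of_int \<beta>) / of_int \<delta>))"
    by (intro cusp_mero_mult cusp_mero_const cusp_mero_klein g \<delta>)
  then show "\<exists>g. cusp_mero g \<and> (\<forall>\<tau>. Im \<tau> > 0 \<longrightarrow>
      klein r s (of_int m * ((of_int a * \<tau> + of_int b) / (of_int c * \<tau> + of_int d)))
        = (of_int c * \<tau> + of_int d) powi (- 1) * g \<tau>)"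
    using main by (intro exI[of _ "\<lambda>\<tau>. of_int \<delta> * klein r' s' ((of_int g * \<tau> + of_int \<beta>) / of_int \<delta>)"] conjI allI impI)
qed

lemma cusp_wt_power:
  assumes "cusp_wt w f"
  shows "cusp_wt (int n * w) (\<lambda>\<tau>. f \<tau> ^ n)"
  unfolding cusp_wt_def
proof (intro allI impI)
  fix a b c d :: int assume det: "a * d - b * c = 1"
  obtain F where F: "cusp_mero F" "\<And>\<tau>. Im \<tau> > 0 \<Longrightarrow>
    f ((of_int a * \<tau> + of_int b) / (of_int c * \<tau> + of_int d)) = (of_int c * \<tau> + of_int d) powi w * F \<tau>"
    using assms det unfolding cusp_wt_def by blast
  have "cusp_mero (\<lambda>\<tau>. F \<tau> ^ n)"
    by (induction n) (simp_all add: cusp_mero_const cusp_mero_mult F(1))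
  moreover have "(x powi w) ^ n = x powi (int n * w)" for x :: complex
    by (simp add: power_int_mult mult.commute[of "int n"])
  ultimately show "\<exists>g. cusp_mero g \<and> (\<forall>\<tau>. Im \<tau> > 0 \<longrightarrow>
    f ((of_int a * \<tau> + of_int b) / (of_int c * \<tau> + of_int d)) ^ n = (of_int c * \<tau> + of_int d) powi (int n * w) * g \<tau>)"
    by (intro exI[of _ "\<lambda>\<tau>. F \<tau> ^ n"] conjI allI impI) (simp_all only: F(2) power_mult_distrib)
qed

text \<open>For a matrix congruent to the identity modulo \<open>N\<close>, both entries of
  \<open>(r, 0)\<close> change by even integers, so the sign in \<open>klein_shift\<close> is 1;
  integrality of \<open>r * m\<close> makes the exponential trivial as well.\<close>

lemma modular_wt_klein:
  fixes m :: int
  assumes m: "m > 0" "int N = m * m'" and r: "r * of_nat N = of_int (2 * R)" "r * of_int m = of_int M"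
  shows "modular_wt N (- 1) (\<lambda>\<tau>. klein r 0 (of_int m * \<tau>))"
  unfolding modular_wt_def
proof
  show "cusp_wt (- 1) (\<lambda>\<tau>. klein r 0 (of_int m * \<tau>))" by (rule cusp_wt_klein[OF m(1)])
  show "inv_wt N (- 1) (\<lambda>\<tau>. klein r 0 (of_int m * \<tau>))" unfolding inv_wt_def
  proof (intro allI impI)
    fix a b c d a' b' c' d' :: int and \<tau> :: complex
    assume H: "Im \<tau> > 0" "a * d - b * c = 1"
      "a = 1 + int N * a'" "b = int N * b'" "c = int N * c'" "d = 1 + int N * d'"
    have c: "c = m * (m' * c')" using H(5) m(2) by simp
    have m\<tau>: "Im (of_int m * \<tau>) > 0" using H(1) m by simp
    have "of_int a = (1 + of_nat N * of_int a' :: rat)" using H(3) by simp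
    then have 1: "r * of_int a + 0 * of_int (m' * c') = r + of_int (2 * R * a')"
      using r(1) by (simp add: distrib_left)
    have "of_int b = (of_nat N * of_int b' :: rat)" using H(4) by simp
    then have "r * of_int (m * b) = (r * of_nat N) * of_int (m * b')" by (simp add: mult_ac)
    then have 2: "r * of_int (m * b) + 0 * of_int d = 0 + of_int (2 * R * (m * b'))"
      using r(1) by simp
    have "of_rat r * of_int m = (of_int M :: complex)"
      using arg_cong[OF r(2), of "of_rat :: rat \<Rightarrow> complex"] by (simp add: of_rat_mult)
    then have "(of_rat r * of_int (2 * R * (m * b')) - of_rat 0 * of_int (2 * R * a')) / 2 = (of_int (R * M * b') :: complex)"
      by (simp add: mult_ac)
    then have 3: "ee ((of_rat r * of_int (2 * R * (m * b')) - of_rat 0 * of_int (2 * R * a')) / 2) = 1"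
      by (simp only: ee_of_int)
    have 4: "(- 1 :: complex) powi (2 * R * a' + 2 * R * (m * b') + 2 * R * a' * (2 * R * (m * b'))) = 1"
      by (simp add: neg_one_powi)
    show "klein r 0 (of_int m * ((of_int a * \<tau> + of_int b) / (of_int c * \<tau> + of_int d)))
      = (of_int c * \<tau> + of_int d) powi (- 1) * klein r 0 (of_int m * \<tau>)"
      unfolding klein_mult_moebius[OF m(1) c H(2,1)] 1 2 klein_shift[OF m\<tau>] 3 4
      by (simp add: power_int_minus)
  qed
qed

text \<open>With the nonzero entry in second place, the root of unity
  \<open>ee (L1 * (1 - s) * c' / 2)\<close> survives. Hypothesis \<open>e\<close> says that the
  \<open>e\<close>-th power removes it.\<close>

lemma modular_wt_klein_torsion:
  fixes m :: int
  assumes m: "m > 0" "int N = m * m'" and s: "s * of_nat N = of_int (2 * L2)" "s * of_int m' = of_int L1"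
    and e: "of_nat e * of_int L1 * (1 - s) / 2 = of_int E"
  shows "modular_wt N (- int e) (\<lambda>\<tau>. klein 0 s (of_int m * \<tau>) ^ e)"
  unfolding modular_wt_def
proof
  show "cusp_wt (- int e) (\<lambda>\<tau>. klein 0 s (of_int m * \<tau>) ^ e)"
    using cusp_wt_power[OF cusp_wt_klein[OF m(1)], of e] by simp
  show "inv_wt N (- int e) (\<lambda>\<tau>. klein 0 s (of_int m * \<tau>) ^ e)" unfolding inv_wt_def
  proof (intro allI impI)
    fix a b c d a' b' c' d' :: int and \<tau> :: complex
    assume H: "Im \<tau> > 0" "a * d - b * c = 1"
      "a = 1 + int N * a'" "b = int N * b'" "c = int N * c'" "d = 1 + int N * d'"
    have c: "c = m * (m' * c')" using H(5) m(2) by simp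
    have m\<tau>: "Im (of_int m * \<tau>) > 0" using H(1) m by simp
    have 1: "0 * of_int a + s * of_int (m' * c') = 0 + of_int (L1 * c')"
      using s(2) by (simp add: mult.assoc[symmetric])
    have "of_int d = (1 + of_nat N * of_int d' :: rat)" using H(6) by simp
    then have 2: "0 * of_int (m * b) + s * of_int d = s + of_int (2 * L2 * d')"
      using s(1) by (simp add: distrib_left)
    define \<epsilon> :: complex where "\<epsilon> = (- 1) powi (L1 * c' + 2 * L2 * d' + L1 * c' * (2 * L2 * d'))
      * ee ((of_rat 0 * of_int (2 * L2 * d') - of_rat s * of_int (L1 * c')) / 2)"
    have "\<epsilon> = ee (of_int (L1 * c') / 2) * ee ((of_rat 0 * of_int (2 * L2 * d') - of_rat s * of_int (L1 * c')) / 2)"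
      unfolding ee_half_int \<epsilon>_def by (simp add: neg_one_powi)
    also have "\<dots> = ee (of_int L1 * (1 - of_rat s) / 2 * of_int c')"
      unfolding ee_add[symmetric] by (intro arg_cong[of _ _ ee]) (simp add: algebra_simps diff_divide_distrib)
    finally have "\<epsilon> ^ e = ee (of_nat e * (of_int L1 * (1 - of_rat s) / 2 * of_int c'))"
      by (simp only: ee_of_nat_mult)
    also have "of_nat e * (of_int L1 * (1 - of_rat s) / 2 * of_int c') = (of_int (E * c') :: complex)"
    proof -
      have "of_nat e * of_int L1 * (1 - of_rat s) / 2 = (of_int E :: complex)"
        using arg_cong[OF e, of "of_rat :: rat \<Rightarrow> complex"] by (simp add: of_rat_mult of_rat_divide of_rat_diff)
      then show ?thesis by (simp add: mult_ac)
    qed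
    finally have \<epsilon>: "\<epsilon> ^ e = 1" by (simp only: ee_of_int)
    have "klein 0 s (of_int m * ((of_int a * \<tau> + of_int b) / (of_int c * \<tau> + of_int d)))
      = inverse (of_int c * \<tau> + of_int d) * (\<epsilon> * klein 0 s (of_int m * \<tau>))"
      unfolding klein_mult_moebius[OF m(1) c H(2,1)] 1 2 klein_shift[OF m\<tau>] \<epsilon>_def by (simp only: mult.assoc)
    then show "klein 0 s (of_int m * ((of_int a * \<tau> + of_int b) / (of_int c * \<tau> + of_int d))) ^ e
      = (of_int c * \<tau> + of_int d) powi (- int e) * klein 0 s (of_int m * \<tau>) ^ e"
      by (simp add: power_mult_distrib \<epsilon> power_int_minus power_inverse)
  qed
qed

section \<open>Klein forms of level 7056\<close>

definition kJ :: "nat \<Rightarrow> nat \<Rightarrow> complex \<Rightarrow> complex" where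
  "kJ a m q = JJ a m q / J m q ^ 3"

text \<open>At \<open>21 m \<tau>\<close> the nome is \<open>q ^ m\<close> and
  \<open>ee z = q ^ a\<close> for \<open>q = ee \<tau> ^ 21\<close>, the variable of the identities
  when the Nahm sum is taken at \<open>84 \<tau>\<close>.\<close>

definition kl :: "nat \<Rightarrow> nat \<Rightarrow> complex \<Rightarrow> complex" where
  "kl a m \<tau> = klein (of_nat a / of_nat m) 0 (of_int (21 * int m) * \<tau>)"

text \<open>The leading exponent of the Klein form in \<tau> is
  \<open>- 21 a (m - a) / (2 m)\<close>. For the pairs below it is a multiple of \<open>1/4\<close>,
  which is why powers of \<open>ee (\<tau> / 4)\<close> are used.\<close>

lemma kl_eq_kJ:
  assumes "0 < a" "a < m" "n * m = 42 * a * (m - a)"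
  shows "kl a m \<tau> = kJ a m (ee \<tau> ^ 21) / ee (\<tau> / 4) ^ n"
proof -
  define x :: complex where "x = of_nat a"
  define y :: complex where "y = of_nat m"
  have y: "y \<noteq> 0" using assms by (simp add: y_def)
  define q where "q = ee \<tau> ^ 21"
  have q: "q = ee (21 * \<tau>)" unfolding q_def using ee_of_nat_mult[of 21 \<tau>] by simp
  have xy: "of_nat (m - a) = y - x" using assms by (simp add: x_def y_def of_nat_diff)
  have n: "of_nat n * y = 42 * x * (y - x)"
    using arg_cong[OF assms(3), of "of_nat :: nat \<Rightarrow> complex"]
    by (simp only: of_nat_mult xy x_def[symmetric] y_def[symmetric] of_nat_numeral)
  have r: "of_rat (of_nat a / of_nat m) = x / y" by (simp add: of_rat_divide x_def y_def)
  have z: "x / y * (y * (21 * \<tau>)) + 0 = x * (21 * \<tau>)" using y by simp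
  have e1: "ee (y * (21 * \<tau>)) = q ^ m" "ee (x * (21 * \<tau>)) = q ^ a"
    "ee (y * (21 * \<tau>) - x * (21 * \<tau>)) = q ^ (m - a)"
    unfolding q ee_of_nat_mult[symmetric] xy x_def[symmetric] y_def[symmetric] left_diff_distrib by simp_all
  have e2: "ee (x / y * (x * (21 * \<tau>)) / 2) * ee (- (x * (21 * \<tau>)) / 2) = 1 / ee (\<tau> / 4) ^ n"
  proof -
    have "x / y * (x * (21 * \<tau>)) / 2 + - (x * (21 * \<tau>)) / 2 = - (of_nat n * (\<tau> / 4))"
    proof -
      have n': "of_nat n = 42 * x * (y - x) / y" using n y by (simp add: field_simps)
      show ?thesis unfolding n' using y by (simp add: field_simps)
    qed
    then show ?thesis
      unfolding ee_add[symmetric] by (simp only: ee_minus ee_of_nat_mult divide_inverse mult_1)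
  qed
  have "kl a m \<tau> = ee (x / y * (x * (21 * \<tau>)) / 2) * kphi (x * (21 * \<tau>)) (y * (21 * \<tau>))"
  proof -
    have "of_int (21 * int m) * \<tau> = y * (21 * \<tau>)" by (simp add: y_def)
    then show ?thesis unfolding kl_def klein_def r by (simp only: of_rat_0 z)
  qed
  also have "\<dots> = (ee (x / y * (x * (21 * \<tau>)) / 2) * ee (- (x * (21 * \<tau>)) / 2))
      * (qpoch_inf (q ^ a) (q ^ m) * qpoch_inf (q ^ (m - a)) (q ^ m) / (qpoch_inf (q ^ m) (q ^ m))\<^sup>2)"
    unfolding kphi_def e1 by simp
  also have "\<dots> = kJ a m q / ee (\<tau> / 4) ^ n"
    unfolding e2 kJ_def JJ_def J_def by (simp add: power2_eq_square power3_eq_cube)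
  finally show ?thesis by (simp only: q_def)
qed

lemma modular_wt_kl:
  assumes "m > 0" "7056 = 21 * m * m'" "7056 * a = 2 * R * m"
  shows "modular_wt 7056 (- 1) (kl a m)"
  unfolding kl_def
proof (rule modular_wt_klein)
  show "0 < 21 * int m" using assms by simp
  show "int 7056 = 21 * int m * int m'" using arg_cong[OF assms(2), of int] by simp
  have "(of_nat (7056 * a) :: rat) = of_nat (2 * R * m)" by (simp only: assms(3))
  then show "of_nat a / of_nat m * of_nat 7056 = (of_int (2 * int R) :: rat)"
    using assms(1) by (simp add: field_simps)
  show "of_nat a / of_nat m * of_int (21 * int m) = (of_int (21 * int a) :: rat)"
    using assms(1) by simp
qed

text \<open>\<open>1176 = 21 * 56\<close>, so the nome is \<open>q ^ 56\<close>.\<close>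

definition ktors2 :: "complex \<Rightarrow> complex" where
  "ktors2 \<tau> = klein 0 (1 / 2) (of_int 1176 * \<tau>)"

definition ktors3 :: "complex \<Rightarrow> complex" where
  "ktors3 \<tau> = klein 0 (1 / 3) (of_int 1176 * \<tau>)"

text \<open>The condition \<open>e * 3 * (1 - 1/2) / 2 = 3 e / 4\<close> integral gives the exponent
  4; for \<open>ktors3\<close> the corresponding number is \<open>2 e / 3\<close>, hence 3.\<close>

lemma modular_wt_ktors2: "modular_wt 7056 (- 4) (\<lambda>\<tau>. ktors2 \<tau> ^ 4)"
  using modular_wt_klein_torsion[of 1176 7056 6 "1 / 2" 1764 3 4 3] by (simp add: ktors2_def)

lemma modular_wt_ktors3: "modular_wt 7056 (- 3) (\<lambda>\<tau>. ktors3 \<tau> ^ 3)"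
  using modular_wt_klein_torsion[of 1176 7056 6 "1 / 3" 1176 2 3 2] by (simp add: ktors3_def)

lemma qpoch_cube_roots:
  assumes "\<zeta> ^ 2 + \<zeta> + 1 = (0 :: complex)"
  shows "qpoch a q n * qpoch (\<zeta> * a) q n * qpoch (\<zeta>\<^sup>2 * a) q n = qpoch (a ^ 3) (q ^ 3) n"
proof -
  have z3: "\<zeta> ^ 3 = 1"
  proof -
    have "\<zeta> ^ 3 - 1 = (\<zeta> - 1) * (\<zeta> ^ 2 + \<zeta> + 1)" by (simp add: algebra_simps eval_nat_numeral)
    then show ?thesis using assms by simp
  qed
  have "(1 - x) * (1 - \<zeta> * x) * (1 - \<zeta>\<^sup>2 * x) = 1 - x ^ 3" for x
  proof -
    have "(1 - x) * (1 - \<zeta> * x) * (1 - \<zeta>\<^sup>2 * x)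
      = 1 - (\<zeta> ^ 2 + \<zeta> + 1) * x + \<zeta> * (\<zeta> ^ 2 + \<zeta> + 1) * x ^ 2 - \<zeta> ^ 3 * x ^ 3"
      by (simp add: algebra_simps eval_nat_numeral)
    then show ?thesis using assms z3 by simp
  qed
  from this[of "a * q ^ k" for k] have "(1 - a * q ^ k) * (1 - \<zeta> * a * q ^ k) * (1 - \<zeta>\<^sup>2 * a * q ^ k) = 1 - a ^ 3 * (q ^ 3) ^ k" for k
    by (simp only: mult.assoc power_mult_distrib power_mult[symmetric] mult.commute[of k 3])
  then show ?thesis by (simp add: qpoch_def prod.distrib[symmetric])
qed

lemma qpoch_inf_cube_roots:
  assumes "\<zeta> ^ 2 + \<zeta> + 1 = (0 :: complex)" "norm q < 1"
  shows "qpoch_inf a q * qpoch_inf (\<zeta> * a) q * qpoch_inf (\<zeta>\<^sup>2 * a) q = qpoch_inf (a ^ 3) (q ^ 3)"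
proof -
  have "(\<lambda>n. qpoch a q n * qpoch (\<zeta> * a) q n * qpoch (\<zeta>\<^sup>2 * a) q n)
      \<longlonglongrightarrow> qpoch_inf a q * qpoch_inf (\<zeta> * a) q * qpoch_inf (\<zeta>\<^sup>2 * a) q"
    by (intro tendsto_mult qpoch_LIMSEQ assms)
  then show ?thesis
    using qpoch_inf_eqI[of "q ^ 3" "a ^ 3"] norm_power_less_1[OF assms(2), of 3]
    by (simp add: qpoch_cube_roots[OF assms(1)])
qed

lemma ee_third: "ee (1 / 3) ^ 2 + ee (1 / 3) + 1 = 0" "ee (1 / 3) ^ 3 = 1" "ee (1 / 3) \<noteq> 1"
proof -
  show 3: "ee (1 / 3) ^ 3 = 1" unfolding ee_of_nat_mult[symmetric] using ee_of_int[of 1] by simp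
  show 1: "ee (1 / 3) \<noteq> 1"
  proof
    assume "ee (1 / 3) = 1"
    then obtain n :: int where "1 / 3 = (of_int n :: complex)" unfolding ee_eq_1_iff by blast
    then have "of_int (3 * n) = (of_int 1 :: complex)" by (simp add: field_simps)
    then have "3 * n = 1" by (simp only: of_int_eq_iff)
    then show False by presburger
  qed
  have "(ee (1 / 3) - 1) * (ee (1 / 3) ^ 2 + ee (1 / 3) + 1) = ee (1 / 3) ^ 3 - 1"
    by (simp add: algebra_simps eval_nat_numeral)
  then show "ee (1 / 3) ^ 2 + ee (1 / 3) + 1 = 0" using 1 3 by simp
qed

context
  fixes \<tau> q :: complex
  assumes \<tau>: "Im \<tau> > 0" and q_def: "q = ee \<tau> ^ 21"
begin

lemma q_less_1: "norm q < 1"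
  unfolding q_def by (intro norm_power_less_1 norm_ee_less_1 \<tau>) simp

lemma nome_56: "ee (1176 * \<tau>) = q ^ 56"
  unfolding q_def power_mult[symmetric] using ee_of_nat_mult[of 1176 \<tau>] by simp

text \<open>At \<open>s = 1/2\<close> the two products are
  \<open>(-1; p)_\<infinity> = 2 (-p; p)_\<infinity>\<close> and \<open>(-p; p)_\<infinity>\<close>,
  and \<open>(-p; p)_\<infinity> = J 112 / J 56\<close>.\<close>

lemma ktors2_J: "ktors2 \<tau> = 2 * ee (- (1 / 4)) * (J 112 q ^ 2 / J 56 q ^ 4)"
proof -
  define p where "p = q ^ 56"
  have p: "norm p < 1" unfolding p_def by (rule norm_power_less_1[OF q_less_1]) simp
  have e: "ee (1 / 2) = - 1" "ee (1176 * \<tau> - 1 / 2) = - p" "ee (1176 * \<tau>) = p"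
    unfolding ee_diff nome_56 ee_half p_def by simp_all
  have 1: "qpoch_inf (- 1) p = 2 * qpoch_inf (- p) p"
    using qpoch_inf_rec[OF p, of "- 1"] by simp
  have 2: "qpoch_inf p p * qpoch_inf (- p) p = qpoch_inf (p\<^sup>2) (p\<^sup>2)"
    by (rule qpoch_inf_minus[OF p])
  have nz: "qpoch_inf p p \<noteq> 0" by (rule qpoch_inf_nonzero[OF p p])
  have "ktors2 \<tau> = ee (- (1 / 4)) * qpoch_inf (- 1) p * qpoch_inf (- p) p / (qpoch_inf p p)\<^sup>2"
    unfolding ktors2_def klein_def kphi_def by (simp add: of_rat_divide e)
  also have "\<dots> = 2 * ee (- (1 / 4)) * (qpoch_inf (p\<^sup>2) (p\<^sup>2) ^ 2 / qpoch_inf p p ^ 4)"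
    unfolding 1 2[symmetric] using nz by (simp add: field_simps eval_nat_numeral)
  finally show ?thesis by (simp add: J_def p_def power_mult[symmetric])
qed

text \<open>The products over \<open>\<zeta> p\<close> and \<open>\<zeta>\<^sup>2 p\<close> combine
  with \<open>(p; p)_\<infinity>\<close> to \<open>(p^3; p^3)_\<infinity>\<close> for a primitive
  cube root of unity \<zeta>.\<close>

lemma ktors3_J: "ktors3 \<tau> = ee (- (1 / 6)) * (1 - ee (1 / 3)) * (J 168 q / J 56 q ^ 3)"
proof -
  define p where "p = q ^ 56"
  define \<zeta> where "\<zeta> = ee (1 / 3)"
  note \<zeta> = ee_third[folded \<zeta>_def]
  have p: "norm p < 1" unfolding p_def by (rule norm_power_less_1[OF q_less_1]) simp
  have "inverse \<zeta> = \<zeta>\<^sup>2"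
    using \<zeta>(2) by (intro inverse_unique) (simp add: eval_nat_numeral)
  then have e: "ee (1176 * \<tau> - 1 / 3) = \<zeta>\<^sup>2 * p" "ee (1176 * \<tau>) = p"
    unfolding ee_diff nome_56 p_def \<zeta>_def[symmetric] by (simp_all add: divide_inverse mult.commute)
  have 1: "qpoch_inf \<zeta> p = (1 - \<zeta>) * qpoch_inf (\<zeta> * p) p"
    by (rule qpoch_inf_rec[OF p])
  have 2: "qpoch_inf p p * qpoch_inf (\<zeta> * p) p * qpoch_inf (\<zeta>\<^sup>2 * p) p = qpoch_inf (p ^ 3) (p ^ 3)"
    by (rule qpoch_inf_cube_roots[OF \<zeta>(1) p])
  have nz: "qpoch_inf p p \<noteq> 0" by (rule qpoch_inf_nonzero[OF p p])
  have "ktors3 \<tau> = ee (- (1 / 6)) * qpoch_inf \<zeta> p * qpoch_inf (\<zeta>\<^sup>2 * p) p / (qpoch_inf p p)\<^sup>2"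
    unfolding ktors3_def klein_def kphi_def by (simp add: of_rat_divide e \<zeta>_def[symmetric])
  also have "\<dots> = ee (- (1 / 6)) * (1 - \<zeta>) * (qpoch_inf (p ^ 3) (p ^ 3) / qpoch_inf p p ^ 3)"
    unfolding 1 2[symmetric] using nz by (simp add: field_simps eval_nat_numeral)
  finally show ?thesis by (simp add: J_def p_def \<zeta>_def power_mult[symmetric])
qed

end

text \<open>The residues \<open>b, ..., 6 b\<close> modulo \<open>7 b\<close> pair up as
  \<open>a\<close> and \<open>7 b - a\<close>. This makes \<open>J b\<close> accessible through
  Klein forms, for \<open>b = 2, 4, 8\<close> and the moduli 14, 28, 56.\<close>

lemma kJ_seventh:
  assumes q: "norm q < 1" and b: "b > 0"
  shows "kJ b (7 * b) q * kJ (2 * b) (7 * b) q * kJ (3 * b) (7 * b) q = J b q / J (7 * b) q ^ 7"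
proof -
  have "J b q = (\<Prod>i<7. qpoch_inf (q ^ (b * Suc i)) (q ^ (b * 7)))"
    by (rule J_dissect[OF q b]) simp
  also have "\<dots> = qpoch_inf (q ^ b) (q ^ (7 * b)) * qpoch_inf (q ^ (2 * b)) (q ^ (7 * b))
     * qpoch_inf (q ^ (3 * b)) (q ^ (7 * b)) * qpoch_inf (q ^ (4 * b)) (q ^ (7 * b))
     * qpoch_inf (q ^ (5 * b)) (q ^ (7 * b)) * qpoch_inf (q ^ (6 * b)) (q ^ (7 * b)) * J (7 * b) q"
  proof -
    have "(\<Prod>i<7. f i) = f 0 * f 1 * f 2 * f 3 * f 4 * f 5 * f 6" for f :: "nat \<Rightarrow> complex"
      by (simp add: eval_nat_numeral mult.assoc)
    moreover have "b * Suc 0 = b" "b * Suc 1 = 2 * b" "b * Suc 2 = 3 * b" "b * Suc 3 = 4 * b" "b * Suc 4 = 5 * b"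
      "b * Suc 5 = 6 * b" "b * Suc 6 = 7 * b" "b * 7 = 7 * b"
      by simp_all
    ultimately show ?thesis by (simp only: J_def)
  qed
  finally have J: "J b q = qpoch_inf (q ^ b) (q ^ (7 * b)) * qpoch_inf (q ^ (2 * b)) (q ^ (7 * b))
     * qpoch_inf (q ^ (3 * b)) (q ^ (7 * b)) * qpoch_inf (q ^ (4 * b)) (q ^ (7 * b))
     * qpoch_inf (q ^ (5 * b)) (q ^ (7 * b)) * qpoch_inf (q ^ (6 * b)) (q ^ (7 * b)) * J (7 * b) q" .
  have "7 * b - b = 6 * b" "7 * b - 2 * b = 5 * b" "7 * b - 3 * b = 4 * b" by simp_all
  note sub = this
  have "JJ b (7 * b) q * JJ (2 * b) (7 * b) q * JJ (3 * b) (7 * b) q = J b q * J (7 * b) q ^ 2"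
    unfolding J JJ_def J_def[of "7 * b"] sub by (simp only: power2_eq_square mult_ac)
  moreover have "kJ b (7 * b) q * kJ (2 * b) (7 * b) q * kJ (3 * b) (7 * b) q
     = JJ b (7 * b) q * JJ (2 * b) (7 * b) q * JJ (3 * b) (7 * b) q / (J (7 * b) q ^ 2 * J (7 * b) q ^ 7)"
    by (simp only: kJ_def times_divide_times_eq power_add[symmetric]) simp
  ultimately have "kJ b (7 * b) q * kJ (2 * b) (7 * b) q * kJ (3 * b) (7 * b) q
     = J b q * J (7 * b) q ^ 2 / (J (7 * b) q ^ 2 * J (7 * b) q ^ 7)" by (simp only:)
  also have "\<dots> = J b q / J (7 * b) q ^ 7"
  proof -
    have "J (7 * b) q ^ 2 \<noteq> 0" using J_nonzero[OF q, of "7 * b"] b by simp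
    then show ?thesis by (simp only: mult.commute[of "J b q"] mult_divide_mult_cancel_left_if if_False)
  qed
  finally show ?thesis .
qed

lemma kJ_half:
  assumes q: "norm q < 1" and b: "b > 0"
  shows "kJ b (2 * b) q = J b q ^ 2 / J (2 * b) q ^ 4"
proof -
  define P where "P = qpoch_inf (q ^ b) (q ^ (2 * b))"
  have 1: "J b q = P * J (2 * b) q"
    using qpoch_inf_bisect[OF q b, of b] by (simp add: J_def P_def mult_2)
  have 2: "JJ b (2 * b) q = P * P * J (2 * b) q"
    by (simp add: JJ_def J_def P_def mult_2)
  show ?thesis
    unfolding kJ_def 1 2 using J_nonzero[OF q, of "2 * b"] b
    by (simp add: power_mult_distrib field_simps eval_nat_numeral)
qed

lemma kJ_third:
  assumes q: "norm q < 1" and b: "b > 0"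
  shows "kJ b (3 * b) q = J b q / J (3 * b) q ^ 3"
proof -
  have "J b q = (\<Prod>i<3. qpoch_inf (q ^ (b * Suc i)) (q ^ (b * 3)))"
    by (rule J_dissect[OF q b]) simp
  also have "\<dots> = JJ b (3 * b) q"
  proof -
    have "(\<Prod>i<3. f i) = f 0 * f 1 * f 2" for f :: "nat \<Rightarrow> complex"
      by (simp add: eval_nat_numeral mult.assoc)
    moreover have "b * Suc 0 = b" "b * Suc 1 = 2 * b" "b * Suc 2 = 3 * b" "b * 3 = 3 * b" "3 * b - b = 2 * b"
      by simp_all
    ultimately show ?thesis by (simp only: JJ_def)
  qed
  finally show ?thesis by (simp add: kJ_def)
qed

text \<open>Up to powers of \<open>q\<close> and constants, \<open>klX\<close> is \<open>J\<^sub>5\<^sub>6\<^sup>-\<^sup>2\<^sup>0\<close>. It makes up for the powers of \<open>J\<close> that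
  remain when each summand is written through Klein forms.\<close>

definition klX :: "complex \<Rightarrow> complex" where
  "klX \<tau> = ktors3 \<tau> ^ 3 * kl 56 168 \<tau> * kl 56 112 \<tau> ^ 2 * ktors2 \<tau> ^ 4"

text \<open>Realises \<open>J 8 * J 56 ^ 21 / J 4 ^ 2\<close> up to a power of the nome: the triples
  are \<open>J 8 / J 56 ^ 7\<close> and \<open>J 4 / J 28 ^ 7\<close>, and
  \<open>kl 28 56 ^ 7\<close> trades the resulting \<open>J 28 ^ 14\<close> for
  \<open>J 56 ^ 28\<close>.\<close>

definition klV :: "complex \<Rightarrow> complex" where
  "klV \<tau> = kl 8 56 \<tau> * kl 16 56 \<tau> * kl 24 56 \<tau> / ((kl 4 28 \<tau> * kl 8 28 \<tau> * kl 12 28 \<tau>) ^ 2 * kl 28 56 \<tau> ^ 7)"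

text \<open>Realises \<open>J 4 ^ 3 / (J 2 ^ 2 * J 8)\<close> times
  \<open>J 28 ^ 7 * J 56 ^ 7\<close> up to a power of the nome; \<open>kl 14 28 ^ 7\<close> clears
  \<open>J 14\<close>.\<close>

definition klW :: "complex \<Rightarrow> complex" where
  "klW \<tau> = (kl 4 28 \<tau> * kl 8 28 \<tau> * kl 12 28 \<tau>) ^ 3
     / ((kl 2 14 \<tau> * kl 4 14 \<tau> * kl 6 14 \<tau>) ^ 2 * kl 14 28 \<tau> ^ 7 * (kl 8 56 \<tau> * kl 16 56 \<tau> * kl 24 56 \<tau>))"

lemma modular_wt_kl_14: "modular_wt 7056 (- 1) (kl a 14)"
  by (rule modular_wt_kl[of _ 24 _ "252 * a"]) auto

lemma modular_wt_kl_28: "modular_wt 7056 (- 1) (kl a 28)"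
  by (rule modular_wt_kl[of _ 12 _ "126 * a"]) auto

lemma modular_wt_kl_56: "modular_wt 7056 (- 1) (kl a 56)"
  by (rule modular_wt_kl[of _ 6 _ "63 * a"]) auto

lemma modular_wt_kl_112: "modular_wt 7056 (- 1) (kl 56 112)"
  by (rule modular_wt_kl[of _ 3 _ 1764]) auto

lemma modular_wt_kl_168: "modular_wt 7056 (- 1) (kl 56 168)"
  by (rule modular_wt_kl[of _ 2 _ 1176]) auto

lemma modular_wt_mult3:
  assumes "modular_wt N w f" "modular_wt N w g" "modular_wt N w h"
  shows "modular_wt N (3 * w) (\<lambda>\<tau>. f \<tau> * g \<tau> * h \<tau>)"
  using modular_wt_mult[OF modular_wt_mult[OF assms(1,2)] assms(3)] by (simp add: algebra_simps)

lemma modular_wt_klX: "modular_wt 7056 (- 10) klX"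
proof -
  have "modular_wt 7056 (- 3 + - 1 + int 2 * - 1 + - 4) (\<lambda>\<tau>. ktors3 \<tau> ^ 3 * kl 56 168 \<tau> * kl 56 112 \<tau> ^ 2 * ktors2 \<tau> ^ 4)"
    by (intro modular_wt_mult modular_wt_power modular_wt_ktors2 modular_wt_ktors3 modular_wt_kl_112 modular_wt_kl_168)
  then show ?thesis by (simp add: klX_def[abs_def])
qed

lemma modular_wt_klV: "modular_wt 7056 10 klV"
proof -
  have "modular_wt 7056 (3 * - 1 - (int 2 * (3 * - 1) + int 7 * - 1)) klV"
    unfolding klV_def[abs_def]
    by (intro modular_wt_divide modular_wt_mult modular_wt_mult3 modular_wt_power modular_wt_kl_28 modular_wt_kl_56)
  then show ?thesis by simp
qed

lemma modular_wt_klW: "modular_wt 7056 7 klW"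
proof -
  have "modular_wt 7056 (int 3 * (3 * - 1) - (int 2 * (3 * - 1) + int 7 * - 1 + 3 * - 1)) klW"
    unfolding klW_def[abs_def]
    by (intro modular_wt_divide modular_wt_mult modular_wt_mult3 modular_wt_power modular_wt_kl_14 modular_wt_kl_28 modular_wt_kl_56)
  then show ?thesis by simp
qed

text \<open>The constant brought in by the torsion forms in \<open>klX\<close>; it is nonzero and is
  divided out at the end.\<close>

definition klC :: complex where
  "klC = (ee (- (1 / 6)) * (1 - ee (1 / 3))) ^ 3 * (2 * ee (- (1 / 4))) ^ 4"

lemma klC_nz: "klC \<noteq> 0"
  using ee_third(3) by (simp add: klC_def)

context
  fixes \<tau> q E :: complex
  assumes \<tau>: "Im \<tau> > 0" and q_def: "q = ee \<tau> ^ 21" and E_def: "E = ee (\<tau> / 4)"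
begin

lemma norm_q: "norm q < 1" by (rule q_less_1[OF \<tau> q_def])

lemma E_nz: "E \<noteq> 0" by (simp add: E_def)

lemma kl_values:
  "kl 8 56 \<tau> = kJ 8 56 q / E ^ 288" "kl 16 56 \<tau> = kJ 16 56 q / E ^ 480" "kl 24 56 \<tau> = kJ 24 56 q / E ^ 576"
  "kl 4 56 \<tau> = kJ 4 56 q / E ^ 156" "kl 12 56 \<tau> = kJ 12 56 q / E ^ 396" "kl 20 56 \<tau> = kJ 20 56 q / E ^ 540"
  "kl 28 56 \<tau> = kJ 28 56 q / E ^ 588" "kl 2 56 \<tau> = kJ 2 56 q / E ^ 81" "kl 26 56 \<tau> = kJ 26 56 q / E ^ 585"
  "kl 10 56 \<tau> = kJ 10 56 q / E ^ 345" "kl 18 56 \<tau> = kJ 18 56 q / E ^ 513"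
  "kl 4 28 \<tau> = kJ 4 28 q / E ^ 144" "kl 8 28 \<tau> = kJ 8 28 q / E ^ 240" "kl 12 28 \<tau> = kJ 12 28 q / E ^ 288"
  "kl 6 28 \<tau> = kJ 6 28 q / E ^ 198" "kl 14 28 \<tau> = kJ 14 28 q / E ^ 294"
  "kl 2 14 \<tau> = kJ 2 14 q / E ^ 72" "kl 4 14 \<tau> = kJ 4 14 q / E ^ 120" "kl 6 14 \<tau> = kJ 6 14 q / E ^ 144"
  "kl 56 112 \<tau> = kJ 56 112 q / E ^ 1176" "kl 56 168 \<tau> = kJ 56 168 q / E ^ 1568"
  unfolding q_def E_def by (rule kl_eq_kJ; simp)+

lemma three_divide: "(x / E ^ a) * (y / E ^ b) * (z / E ^ c) = x * y * z / E ^ (a + b + c)"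
  by (simp add: power_add)

lemma kl_products:
  "kl 8 56 \<tau> * kl 16 56 \<tau> * kl 24 56 \<tau> = J 8 q / J 56 q ^ 7 / E ^ 1344"
  "kl 4 28 \<tau> * kl 8 28 \<tau> * kl 12 28 \<tau> = J 4 q / J 28 q ^ 7 / E ^ 672"
  "kl 2 14 \<tau> * kl 4 14 \<tau> * kl 6 14 \<tau> = J 2 q / J 14 q ^ 7 / E ^ 336"
  "kl 28 56 \<tau> = J 28 q ^ 2 / J 56 q ^ 4 / E ^ 588" "kl 14 28 \<tau> = J 14 q ^ 2 / J 28 q ^ 4 / E ^ 294"
  "kl 56 112 \<tau> = J 56 q ^ 2 / J 112 q ^ 4 / E ^ 1176" "kl 56 168 \<tau> = J 56 q / J 168 q ^ 3 / E ^ 1568"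
  unfolding kl_values three_divide
  using kJ_seventh[OF norm_q, of 8] kJ_seventh[OF norm_q, of 4] kJ_seventh[OF norm_q, of 2]
    kJ_half[OF norm_q, of 28] kJ_half[OF norm_q, of 14] kJ_half[OF norm_q, of 56] kJ_third[OF norm_q, of 56] by simp_all

lemma klV_value: "klV \<tau> = J 8 q * J 56 q ^ 21 / J 4 q ^ 2 * E ^ 4116"
proof -
  have nz: "J 8 q \<noteq> 0" "J 56 q \<noteq> 0" "J 4 q \<noteq> 0" "J 28 q \<noteq> 0" by (simp_all add: J_nonzero[OF norm_q])
  have 1: "(J 4 q / J 28 q ^ 7 / E ^ 672) ^ 2 = J 4 q ^ 2 / J 28 q ^ 14 / E ^ 1344"
    "(J 28 q ^ 2 / J 56 q ^ 4 / E ^ 588) ^ 7 = J 28 q ^ 14 / J 56 q ^ 28 / E ^ 4116"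
    by (simp_all only: power_divide power_mult_distrib power_mult[symmetric]) simp_all
  have 2: "J 56 q ^ 28 = J 56 q ^ 21 * J 56 q ^ 7" by (simp add: power_add[symmetric])
  show ?thesis unfolding klV_def kl_products 1 2 using nz E_nz by (simp add: divide_simps)
qed

lemma klW_value: "klW \<tau> = J 4 q ^ 3 * J 28 q ^ 7 * J 56 q ^ 7 / (J 2 q ^ 2 * J 8 q) * E ^ 2058"
proof -
  have nz: "J 8 q \<noteq> 0" "J 56 q \<noteq> 0" "J 4 q \<noteq> 0" "J 28 q \<noteq> 0" "J 2 q \<noteq> 0" "J 14 q \<noteq> 0"
    by (simp_all add: J_nonzero[OF norm_q])
  have 1: "(J 4 q / J 28 q ^ 7 / E ^ 672) ^ 3 = J 4 q ^ 3 / J 28 q ^ 21 / E ^ 2016"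
    "(J 2 q / J 14 q ^ 7 / E ^ 336) ^ 2 = J 2 q ^ 2 / J 14 q ^ 14 / E ^ 672"
    "(J 14 q ^ 2 / J 28 q ^ 4 / E ^ 294) ^ 7 = J 14 q ^ 14 / J 28 q ^ 28 / E ^ 2058"
    by (simp_all only: power_divide power_mult_distrib power_mult[symmetric]) simp_all
  have 2: "J 28 q ^ 28 = J 28 q ^ 21 * J 28 q ^ 7" by (simp add: power_add[symmetric])
  have 3: "E ^ 2016 = E ^ 672 * E ^ 1344" by (simp add: power_add[symmetric])
  show ?thesis unfolding klW_def kl_products 1 2 3 using nz E_nz by (simp add: divide_simps)
qed

lemma klX_value: "klX \<tau> = klC / (J 56 q ^ 20 * E ^ 3920)"
proof -
  define c3 c2 where "c3 = ee (- (1 / 6)) * (1 - ee (1 / 3))" and "c2 = 2 * ee (- (1 / 4))"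
  have nz: "J 56 q \<noteq> 0" "J 112 q \<noteq> 0" "J 168 q \<noteq> 0" by (simp_all add: J_nonzero[OF norm_q])
  have 1: "(c3 * (J 168 q / J 56 q ^ 3)) ^ 3 = c3 ^ 3 * (J 168 q ^ 3 / J 56 q ^ 9)"
    "(J 56 q ^ 2 / J 112 q ^ 4 / E ^ 1176) ^ 2 = J 56 q ^ 4 / J 112 q ^ 8 / E ^ 2352"
    "(c2 * (J 112 q ^ 2 / J 56 q ^ 4)) ^ 4 = c2 ^ 4 * (J 112 q ^ 8 / J 56 q ^ 16)"
    by (simp_all only: power_divide power_mult_distrib power_mult[symmetric]) simp_all
  have 2: "J 56 q ^ 9 = J 56 q ^ 4 * J 56 q ^ 4 * J 56 q" "J 56 q ^ 20 = J 56 q ^ 4 * J 56 q ^ 16"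
    "E ^ 3920 = E ^ 1568 * E ^ 2352"
    by (simp_all only: power_add[symmetric] power_Suc2[symmetric]) simp_all
  show ?thesis
    unfolding klX_def kl_products ktors3_J[OF \<tau> q_def] ktors2_J[OF \<tau> q_def] c3_def[symmetric] c2_def[symmetric] 1 2 klC_def
    using nz E_nz by (simp add: divide_simps)
qed

text \<open>The factor \<open>J 56 ^ 21\<close> of \<open>klV\<close> against
  \<open>J 56 ^ 20\<close> in \<open>klX\<close> leaves the single \<open>J 56\<close> of the
  summand. In \<open>mn\<close>, the number \<open>196 = 4116 - 3920\<close> is the exponent of
  \<open>E\<close> in \<open>klV * klX\<close>.\<close>

lemma term_even:
  assumes x: "kx = JJ a 56 q / J 56 q ^ 3 / E ^ m" and y: "ky = JJ b 56 q / J 56 q ^ 3 / E ^ n"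
    and ab: "0 < a" "a < 56" "0 < b" "b < 56" and mn: "196 + n = m + k"
  shows "kx / ky * klV \<tau> * klX \<tau> = klC * (E ^ k * (J 8 q * J 56 q * JJ a 56 q / (J 4 q ^ 2 * JJ b 56 q)))"
proof -
  have nz: "J 8 q \<noteq> 0" "J 56 q \<noteq> 0" "J 4 q \<noteq> 0" "JJ b 56 q \<noteq> 0"
    using ab by (simp_all add: J_nonzero[OF norm_q] JJ_def qpoch_inf_powers_nonzero[OF norm_q])
  have 1: "J 56 q ^ 21 = J 56 q ^ 20 * J 56 q" by (simp add: power_Suc2[symmetric])
  have 2: "E ^ 4116 = E ^ 196 * E ^ 3920" by (simp add: power_add[symmetric])
  have 3: "E ^ 196 * E ^ n = E ^ m * E ^ k" by (simp only: power_add[symmetric] mn)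
  have "kx / ky * klV \<tau> * klX \<tau> = klC * ((E ^ 196 * E ^ n) / E ^ m * (J 8 q * J 56 q * JJ a 56 q / (J 4 q ^ 2 * JJ b 56 q)))"
    unfolding x y klV_value klX_value 1 2 using nz E_nz by (simp add: divide_simps)
  also have "(E ^ 196 * E ^ n) / E ^ m = E ^ k" unfolding 3 using E_nz by simp
  finally show ?thesis .
qed

lemma klWX_value: "klW \<tau> * klX \<tau> = klC * (J 4 q ^ 3 * J 28 q ^ 7 / (J 2 q ^ 2 * J 8 q * J 56 q ^ 13)) / E ^ 1862"
proof -
  have nz: "J 8 q \<noteq> 0" "J 56 q \<noteq> 0" "J 2 q \<noteq> 0" by (simp_all add: J_nonzero[OF norm_q])
  have 1: "J 56 q ^ 20 = J 56 q ^ 13 * J 56 q ^ 7" "E ^ 3920 = E ^ 1862 * E ^ 2058"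
    by (simp_all add: power_add[symmetric])
  have eq: "(x * j / y * e) * (c / ((j' * j) * (e' * e))) = c * (x / (y * j')) / e'"
    if "j \<noteq> 0" "e \<noteq> 0" for x y j j' e e' c :: complex
    using that by (simp add: divide_simps)
  show ?thesis unfolding klW_value klX_value 1 by (rule eq) (use nz E_nz in simp_all)
qed

text \<open>The theta product of modulus 28 brings \<open>J 28 ^ 3\<close> into the denominator and
  \<open>kl 28 56 ^ 2\<close> brings \<open>J 28 ^ 4\<close>, together exactly the
  \<open>J 28 ^ 7\<close> of \<open>klW\<close>. The exponents
  \<open>1862 + 198 - 288 - 576 - 1176 = 20\<close> amount to \<open>ee \<tau> ^ 5\<close>, in
  accordance with \<open>C = -5/84\<close>.\<close>

lemma term_odd_1:
  "kl 6 28 \<tau> / (kl 8 56 \<tau> * kl 24 56 \<tau> * kl 28 56 \<tau> ^ 2) * (klW \<tau> * klX \<tau>)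
    = klC * (J 4 q ^ 3 * J 56 q * JJ 6 28 q / (J 2 q ^ 2 * J 8 q * JJ 8 56 q * JJ 24 56 q) / E ^ 20)"
proof -
  have nz: "J 8 q \<noteq> 0" "J 56 q \<noteq> 0" "J 2 q \<noteq> 0" "J 28 q \<noteq> 0" "JJ 8 56 q \<noteq> 0" "JJ 24 56 q \<noteq> 0"
    by (simp_all add: J_nonzero[OF norm_q] JJ_nonzero[OF norm_q])
  have 1: "(J 28 q ^ 2 / J 56 q ^ 4 / E ^ 588) ^ 2 = J 28 q ^ 4 / J 56 q ^ 8 / E ^ 1176"
    by (simp_all only: power_divide power_mult_distrib power_mult[symmetric]) simp_all
  have 2: "J 56 q ^ 13 = J 56 q ^ 8 * J 56 q ^ 3 * J 56 q ^ 2" "J 28 q ^ 7 = J 28 q ^ 3 * J 28 q ^ 4"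
    "E ^ 1862 * E ^ 198 = E ^ 20 * (E ^ 288 * E ^ 576 * E ^ 1176)"
    by (simp_all add: power_add[symmetric])
  have 3: "J 56 q ^ 3 = J 56 q ^ 2 * J 56 q"
    by (simp add: power_Suc2[symmetric])
  have eq: "x / j3 / e / ((y / k3 / e1) * (z / k3 / e2) * (j4 / k8 / e3)) * (c * (w * (j3 * j4) / (v * u * (k8 * k3 * k2))) / e4)
     = c * (w * k1 * x / (v * u * y * z) * ((e1 * e2 * e3) / (e4 * e)))"
    if "k3 = k2 * k1" "k1 \<noteq> 0" "k2 \<noteq> 0" "k8 \<noteq> 0" "j3 \<noteq> 0" "j4 \<noteq> 0"
    for x y z w v u c j3 j4 k1 k2 k3 k8 e e1 e2 e3 e4 :: complex
    unfolding that(1) using that(2-) by (simp add: divide_simps)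
  have "kl 6 28 \<tau> / (kl 8 56 \<tau> * kl 24 56 \<tau> * kl 28 56 \<tau> ^ 2) * (klW \<tau> * klX \<tau>)
    = klC * (J 4 q ^ 3 * J 56 q * JJ 6 28 q / (J 2 q ^ 2 * J 8 q * JJ 8 56 q * JJ 24 56 q)
        * ((E ^ 288 * E ^ 576 * E ^ 1176) / (E ^ 1862 * E ^ 198)))"
    unfolding klWX_value kl_products(4) 1 unfolding kl_values kJ_def 2(1,2) by (rule eq[OF 3]) (use nz in simp_all)
  also have "(E ^ 288 * E ^ 576 * E ^ 1176) / (E ^ 1862 * E ^ 198) = 1 / E ^ 20"
  proof -
    have "e / (e' * e) = 1 / e'" if "e \<noteq> 0" for e e' :: complex using that by simp
    then show ?thesis unfolding 2(3) using E_nz by (metis no_zero_divisors power_not_zero)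
  qed
  finally show ?thesis by simp
qed

text \<open>Two theta products of modulus 56 stand above and two below, so their cubes of
  \<open>J 56\<close> cancel; \<open>kl 28 56 ^ 3\<close> reduces \<open>J 28 ^ 7\<close> to
  \<open>J 28\<close> and \<open>J 56 ^ 13\<close> to \<open>J 56\<close>.\<close>

lemma term_odd_2:
  assumes kx: "kx = JJ a 56 q / J 56 q ^ 3 / E ^ na" "kx' = JJ a' 56 q / J 56 q ^ 3 / E ^ na'"
    and ky: "ky = JJ b 56 q / J 56 q ^ 3 / E ^ nb" "ky' = JJ b' 56 q / J 56 q ^ 3 / E ^ nb'"
    and ab: "0 < a" "a < 56" "0 < a'" "a' < 56" "0 < b" "b < 56" "0 < b'" "b' < 56"
    and n: "nb + nb' + 1764 = k + 1862 + na + na'"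
  shows "kx * kx' / (ky * ky' * kl 28 56 \<tau> ^ 3) * (klW \<tau> * klX \<tau>)
    = klC * (E ^ k * (J 4 q ^ 3 * J 28 q * JJ a 56 q * JJ a' 56 q / (J 2 q ^ 2 * J 8 q * J 56 q * JJ b 56 q * JJ b' 56 q)))"
proof -
  have nz: "J 8 q \<noteq> 0" "J 56 q \<noteq> 0" "J 2 q \<noteq> 0" "J 28 q \<noteq> 0" "JJ b 56 q \<noteq> 0" "JJ b' 56 q \<noteq> 0"
    using ab by (simp_all add: J_nonzero[OF norm_q] JJ_nonzero[OF norm_q])
  have 1: "(J 28 q ^ 2 / J 56 q ^ 4 / E ^ 588) ^ 3 = J 28 q ^ 6 / J 56 q ^ 12 / E ^ 1764"
    by (simp_all only: power_divide power_mult_distrib power_mult[symmetric]) simp_all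
  have 2: "J 56 q ^ 13 = J 56 q ^ 12 * J 56 q" "J 28 q ^ 7 = J 28 q ^ 6 * J 28 q"
    by (simp_all add: power_Suc2[symmetric])
  have 3: "E ^ nb * E ^ nb' * E ^ 1764 = E ^ k * (E ^ 1862 * E ^ na * E ^ na')"
    unfolding power_add[symmetric] n by (simp only: add.assoc)
  have "kx * kx' / (ky * ky' * kl 28 56 \<tau> ^ 3) * (klW \<tau> * klX \<tau>)
    = klC * ((E ^ nb * E ^ nb' * E ^ 1764) / (E ^ 1862 * E ^ na * E ^ na')
       * (J 4 q ^ 3 * J 28 q * JJ a 56 q * JJ a' 56 q / (J 2 q ^ 2 * J 8 q * J 56 q * JJ b 56 q * JJ b' 56 q)))"
    unfolding klWX_value kl_products(4) 1 kx ky 2 using nz E_nz by (simp add: divide_simps)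
  also have "(E ^ nb * E ^ nb' * E ^ 1764) / (E ^ 1862 * E ^ na * E ^ na') = E ^ k"
    unfolding 3 using E_nz by simp
  finally show ?thesis .
qed

lemma kl_56_values:
  "kl a 56 \<tau> = kJ a 56 q / E ^ n \<Longrightarrow> kl a 56 \<tau> = JJ a 56 q / J 56 q ^ 3 / E ^ n"
  by (simp only: kJ_def)

end

section \<open>The three functions and their modularity\<close>

definition modF1 :: "complex \<Rightarrow> complex" where
  "modF1 \<tau> = rhs1 (ee \<tau> ^ 21) / ee (\<tau> / 4) ^ 20"

definition modF2 :: "complex \<Rightarrow> complex" where
  "modF2 \<tau> = ee (\<tau> / 4) ^ 16 * rhs2 (ee \<tau> ^ 21)"

definition modF3 :: "complex \<Rightarrow> complex" where
  "modF3 \<tau> = ee (\<tau> / 4) ^ 4 * rhs3 (ee \<tau> ^ 21)"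

lemma ee_quarter: "ee \<tau> = ee (\<tau> / 4) ^ 4"
  unfolding ee_of_nat_mult[symmetric] by simp

lemma modular_wt_even_term: "modular_wt 7056 0 (\<lambda>\<tau>. kl a 56 \<tau> / kl b 56 \<tau> * klV \<tau> * klX \<tau>)"
proof -
  have "modular_wt 7056 ((- 1 - - 1) + 10 + - 10) (\<lambda>\<tau>. kl a 56 \<tau> / kl b 56 \<tau> * klV \<tau> * klX \<tau>)"
    by (intro modular_wt_mult modular_wt_divide modular_wt_kl_56 modular_wt_klV modular_wt_klX)
  then show ?thesis by simp
qed

lemma modular_wt_odd_term:
  "modular_wt 7056 0 (\<lambda>\<tau>. kl a 56 \<tau> * kl a' 56 \<tau> / (kl b 56 \<tau> * kl b' 56 \<tau> * kl 28 56 \<tau> ^ 3) * (klW \<tau> * klX \<tau>))"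
proof -
  have "modular_wt 7056 ((- 1 + - 1) - (- 1 + - 1 + int 3 * - 1) + (7 + - 10))
     (\<lambda>\<tau>. kl a 56 \<tau> * kl a' 56 \<tau> / (kl b 56 \<tau> * kl b' 56 \<tau> * kl 28 56 \<tau> ^ 3) * (klW \<tau> * klX \<tau>))"
    by (intro modular_wt_mult modular_wt_divide modular_wt_power modular_wt_kl_56 modular_wt_klW modular_wt_klX)
  then show ?thesis by simp
qed

lemma modular_wt_odd_term_1:
  "modular_wt 7056 0 (\<lambda>\<tau>. kl 6 28 \<tau> / (kl 8 56 \<tau> * kl 24 56 \<tau> * kl 28 56 \<tau> ^ 2) * (klW \<tau> * klX \<tau>))"
proof -
  have "modular_wt 7056 (- 1 - (- 1 + - 1 + int 2 * - 1) + (7 + - 10))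
     (\<lambda>\<tau>. kl 6 28 \<tau> / (kl 8 56 \<tau> * kl 24 56 \<tau> * kl 28 56 \<tau> ^ 2) * (klW \<tau> * klX \<tau>))"
    by (intro modular_wt_mult modular_wt_divide modular_wt_power modular_wt_kl_56 modular_wt_kl_28 modular_wt_klW modular_wt_klX)
  then show ?thesis by simp
qed

lemma modular_wt_0_scale: "modular_wt N 0 f \<Longrightarrow> modular_wt N 0 (\<lambda>\<tau>. c * f \<tau>)"
  using modular_wt_mult[OF modular_wt_const] by fastforce

lemma modular_wt_modF1: "modular_wt 7056 0 modF1"
proof (rule modular_wt_cong)
  show "modular_wt 7056 0 (\<lambda>\<tau>. 1 / klC * (kl 6 28 \<tau> / (kl 8 56 \<tau> * kl 24 56 \<tau> * kl 28 56 \<tau> ^ 2) * (klW \<tau> * klX \<tau>))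
      + 2 / klC * (kl 8 56 \<tau> / kl 4 56 \<tau> * klV \<tau> * klX \<tau>))"
    by (intro modular_wt_add_0 modular_wt_0_scale modular_wt_even_term modular_wt_odd_term_1)
  fix \<tau> :: complex assume \<tau>: "Im \<tau> > 0"
  define E where "E = ee (\<tau> / 4)"
  define q where "q = ee \<tau> ^ 21"
  note 1 = kl_56_values[OF \<tau> q_def E_def]
  note 2 = kl_values[OF \<tau> q_def E_def]
  have t: "kl 8 56 \<tau> / kl 4 56 \<tau> * klV \<tau> * klX \<tau> = klC * (E ^ 64 * (J 8 q * J 56 q * JJ 8 56 q / (J 4 q ^ 2 * JJ 4 56 q)))"
    by (rule term_even[OF \<tau> q_def E_def 1[OF 2(1)] 1[OF 2(4)]]) simp_all
  have q: "q = E ^ 84" by (simp add: q_def E_def ee_quarter[of \<tau>] power_mult[symmetric])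
  \<comment> \<open>\<open>64 = 84 - 20\<close>: the exponent of the even term is the common shift
    together with the factor \<open>q\<close> of the second summand.\<close>
  have "E ^ 64 = q / E ^ 20" unfolding q using E_nz[OF \<tau> q_def E_def]
    by (simp add: field_simps power_add[symmetric])
  then show "1 / klC * (kl 6 28 \<tau> / (kl 8 56 \<tau> * kl 24 56 \<tau> * kl 28 56 \<tau> ^ 2) * (klW \<tau> * klX \<tau>))
      + 2 / klC * (kl 8 56 \<tau> / kl 4 56 \<tau> * klV \<tau> * klX \<tau>) = modF1 \<tau>"
    unfolding term_odd_1[OF \<tau> q_def E_def] t modF1_def rhs1_def q_def[symmetric] E_def[symmetric]
    using klC_nz by (simp add: add_divide_distrib mult_ac)
qed

lemma modular_wt_modF2: "modular_wt 7056 0 modF2"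
proof (rule modular_wt_cong)
  show "modular_wt 7056 0 (\<lambda>\<tau>. 2 / klC * (kl 24 56 \<tau> / kl 12 56 \<tau> * klV \<tau> * klX \<tau>)
      + 1 / klC * (kl 10 56 \<tau> * kl 18 56 \<tau> / (kl 16 56 \<tau> * kl 24 56 \<tau> * kl 28 56 \<tau> ^ 3) * (klW \<tau> * klX \<tau>)))"
    by (intro modular_wt_add_0 modular_wt_0_scale modular_wt_even_term modular_wt_odd_term)
  fix \<tau> :: complex assume \<tau>: "Im \<tau> > 0"
  define E where "E = ee (\<tau> / 4)"
  define q where "q = ee \<tau> ^ 21"
  note 1 = kl_56_values[OF \<tau> q_def E_def]
  note 2 = kl_values[OF \<tau> q_def E_def]
  have t: "kl 24 56 \<tau> / kl 12 56 \<tau> * klV \<tau> * klX \<tau> = klC * (E ^ 16 * (J 8 q * J 56 q * JJ 24 56 q / (J 4 q ^ 2 * JJ 12 56 q)))"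
    by (rule term_even[OF \<tau> q_def E_def 1[OF 2(3)] 1[OF 2(5)]]) simp_all
  have u: "kl 10 56 \<tau> * kl 18 56 \<tau> / (kl 16 56 \<tau> * kl 24 56 \<tau> * kl 28 56 \<tau> ^ 3) * (klW \<tau> * klX \<tau>)
    = klC * (E ^ 100 * (J 4 q ^ 3 * J 28 q * JJ 10 56 q * JJ 18 56 q / (J 2 q ^ 2 * J 8 q * J 56 q * JJ 16 56 q * JJ 24 56 q)))"
    by (rule term_odd_2[OF \<tau> q_def E_def 1[OF 2(10)] 1[OF 2(11)] 1[OF 2(2)] 1[OF 2(3)]]) simp_all
  have q: "q = E ^ 84" by (simp add: q_def E_def ee_quarter[of \<tau>] power_mult[symmetric])
  have "E ^ 100 = E ^ 16 * q" unfolding q by (simp add: power_add[symmetric])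
  then show "2 / klC * (kl 24 56 \<tau> / kl 12 56 \<tau> * klV \<tau> * klX \<tau>)
      + 1 / klC * (kl 10 56 \<tau> * kl 18 56 \<tau> / (kl 16 56 \<tau> * kl 24 56 \<tau> * kl 28 56 \<tau> ^ 3) * (klW \<tau> * klX \<tau>)) = modF2 \<tau>"
    unfolding t u modF2_def rhs2_def q_def[symmetric] E_def[symmetric]
    using klC_nz by (simp add: distrib_left mult_ac)
qed

lemma modular_wt_modF3: "modular_wt 7056 0 modF3"
proof (rule modular_wt_cong)
  show "modular_wt 7056 0 (\<lambda>\<tau>. 1 / klC * (kl 2 56 \<tau> * kl 26 56 \<tau> / (kl 8 56 \<tau> * kl 16 56 \<tau> * kl 28 56 \<tau> ^ 3) * (klW \<tau> * klX \<tau>))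
      + 2 / klC * (kl 16 56 \<tau> / kl 20 56 \<tau> * klV \<tau> * klX \<tau>))"
    by (intro modular_wt_add_0 modular_wt_0_scale modular_wt_even_term modular_wt_odd_term)
  fix \<tau> :: complex assume \<tau>: "Im \<tau> > 0"
  define E where "E = ee (\<tau> / 4)"
  define q where "q = ee \<tau> ^ 21"
  note 1 = kl_56_values[OF \<tau> q_def E_def]
  note 2 = kl_values[OF \<tau> q_def E_def]
  have t: "kl 16 56 \<tau> / kl 20 56 \<tau> * klV \<tau> * klX \<tau> = klC * (E ^ 256 * (J 8 q * J 56 q * JJ 16 56 q / (J 4 q ^ 2 * JJ 20 56 q)))"
    by (rule term_even[OF \<tau> q_def E_def 1[OF 2(2)] 1[OF 2(6)]]) simp_all
  have u: "kl 2 56 \<tau> * kl 26 56 \<tau> / (kl 8 56 \<tau> * kl 16 56 \<tau> * kl 28 56 \<tau> ^ 3) * (klW \<tau> * klX \<tau>)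
    = klC * (E ^ 4 * (J 4 q ^ 3 * J 28 q * JJ 2 56 q * JJ 26 56 q / (J 2 q ^ 2 * J 8 q * J 56 q * JJ 8 56 q * JJ 16 56 q)))"
    by (rule term_odd_2[OF \<tau> q_def E_def 1[OF 2(8)] 1[OF 2(9)] 1[OF 2(1)] 1[OF 2(2)]]) simp_all
  have q: "q = E ^ 84" by (simp add: q_def E_def ee_quarter[of \<tau>] power_mult[symmetric])
  have "E ^ 256 = E ^ 4 * q ^ 3" unfolding q by (simp add: power_add[symmetric] power_mult[symmetric])
  then show "1 / klC * (kl 2 56 \<tau> * kl 26 56 \<tau> / (kl 8 56 \<tau> * kl 16 56 \<tau> * kl 28 56 \<tau> ^ 3) * (klW \<tau> * klX \<tau>))
      + 2 / klC * (kl 16 56 \<tau> / kl 20 56 \<tau> * klV \<tau> * klX \<tau>) = modF3 \<tau>"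
    unfolding t u modF3_def rhs3_def q_def[symmetric] E_def[symmetric]
    using klC_nz by (simp add: distrib_left mult_ac)
qed

lemma holomorphic_JJ [holomorphic_intros]:
  assumes g: "g holomorphic_on A" and A: "open A" and less: "\<And>z. z \<in> A \<Longrightarrow> norm (g z) < 1" and m: "m > 0"
  shows "(\<lambda>z. JJ a m (g z)) holomorphic_on A" "(\<lambda>z. J m (g z)) holomorphic_on A"
  unfolding JJ_def J_def using norm_power_less_1[OF less m]
  by (intro holomorphic_intros g A; simp)+

lemma holomorphic_rhs:
  assumes g: "g holomorphic_on A" and A: "open A" and less: "\<And>z. z \<in> A \<Longrightarrow> norm (g z) < 1"
  shows "(\<lambda>z. rhs1 (g z)) holomorphic_on A" "(\<lambda>z. rhs2 (g z)) holomorphic_on A" "(\<lambda>z. rhs3 (g z)) holomorphic_on A"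
  unfolding rhs1_def rhs2_def rhs3_def
  by (intro holomorphic_intros g A less; simp add: J_nonzero JJ_nonzero less)+

lemma holomorphic_modF:
  "modF1 holomorphic_on {\<tau>. Im \<tau> > 0}" "modF2 holomorphic_on {\<tau>. Im \<tau> > 0}" "modF3 holomorphic_on {\<tau>. Im \<tau> > 0}"
proof -
  have o: "open {\<tau>. Im \<tau> > 0}" by (rule open_halfspace_Im_gt)
  have g: "(\<lambda>\<tau>. ee \<tau> ^ 21) holomorphic_on {\<tau>. Im \<tau> > 0}" by (intro holomorphic_intros)
  have less: "norm (ee \<tau> ^ 21) < 1" if "\<tau> \<in> {\<tau>. Im \<tau> > 0}" for \<tau>
    using that norm_power_less_1[OF norm_ee_less_1, of \<tau> 21] by simp
  show "modF1 holomorphic_on {\<tau>. Im \<tau> > 0}" "modF2 holomorphic_on {\<tau>. Im \<tau> > 0}" "modF3 holomorphic_on {\<tau>. Im \<tau> > 0}"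
    unfolding modF1_def[abs_def] modF2_def[abs_def] modF3_def[abs_def]
    by (intro holomorphic_intros holomorphic_rhs[OF g o less]; simp)+
qed

text \<open>The exponents 20, 16 and 4 are multiples of 4, so only integral powers of
  \<open>ee \<tau>\<close> occur. Translation by 1 lies outside the matrices covered by
  \<open>inv_wt\<close> and has to be read off from the nome.\<close>

lemma modF_of_int: "modF1 (\<tau> + of_int n) = modF1 \<tau>" "modF2 (\<tau> + of_int n) = modF2 \<tau>" "modF3 (\<tau> + of_int n) = modF3 \<tau>"
proof -
  have e: "ee (\<tau> + of_int n) = ee \<tau>" by (simp add: ee_add)
  have e20: "ee (\<tau> / 4) ^ (4 * k) = ee \<tau> ^ k" for k \<tau>
    by (simp only: power_mult ee_quarter[symmetric])
  have "ee ((\<tau> + of_int n) / 4) ^ 20 = ee (\<tau> / 4) ^ 20" "ee ((\<tau> + of_int n) / 4) ^ 16 = ee (\<tau> / 4) ^ 16"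
    "ee ((\<tau> + of_int n) / 4) ^ 4 = ee (\<tau> / 4) ^ 4"
    using e20[of "\<tau> + of_int n" 5] e20[of \<tau> 5] e20[of "\<tau> + of_int n" 4] e20[of \<tau> 4]
      e20[of "\<tau> + of_int n" 1] e20[of \<tau> 1] by (simp_all add: e)
  then show "modF1 (\<tau> + of_int n) = modF1 \<tau>" "modF2 (\<tau> + of_int n) = modF2 \<tau>" "modF3 (\<tau> + of_int n) = modF3 \<tau>"
    by (simp_all only: modF1_def modF2_def modF3_def e)
qed

text \<open>Weight 0 supplies invariance and the cusps, holomorphy supplies the interior condition;
  \<open>g\<close> has to agree with \<open>f\<close> in the upper half-plane only.\<close>

lemma modular_functionI:
  assumes wt: "modular_wt N 0 f" and hol: "f holomorphic_on {\<tau>. Im \<tau> > 0}"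
    and per: "\<And>\<tau> n. f (\<tau> + of_int n) = f \<tau>" and eq: "\<And>\<tau>. Im \<tau> > 0 \<Longrightarrow> g \<tau> = f \<tau>"
  shows "modular_function (Gamma1 N) g"
  unfolding modular_function_def
proof (intro conjI ballI allI impI)
  have "g holomorphic_on {\<tau>. Im \<tau> > 0}"
    by (rule holomorphic_transform[OF hol]) (simp add: eq)
  then show "g nicely_meromorphic_on {\<tau>. Im \<tau> > 0}"
    using analytic_on_open[OF open_halfspace_Im_gt] analytic_on_imp_nicely_meromorphic_on by blast
next
  fix \<gamma> :: "int^2^2" and \<tau> :: complex
  assume \<gamma>: "\<gamma> \<in> Gamma1 N" and \<tau>: "Im \<tau> > 0"
  define a b c d where "a = \<gamma> $ 1 $ 1" and "b = \<gamma> $ 1 $ 2" and "c = \<gamma> $ 2 $ 1" and "d = \<gamma> $ 2 $ 2"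
  have det: "a * d - b * c = 1"
    using \<gamma> by (simp add: Gamma1_def SL2Z_def det_2 a_def b_def c_def d_def)
  have "int N dvd a - 1" "int N dvd c" "int N dvd d - 1"
    using \<gamma> by (simp_all add: Gamma1_def a_def c_def d_def cong_iff_dvd_diff)
  then obtain a' c' d' where abc: "a - 1 = int N * a'" "c = int N * c'" "d - 1 = int N * d'"
    by (elim dvdE)
  \<comment> \<open>These are the entries of the second column of \<gamma> times the translation by
    \<open>- b\<close>. The upper one is \<open>- (a - 1) * b\<close>, divisible by
    \<open>N\<close>, so \<open>inv_wt\<close> applies at \<open>\<tau> + b\<close>.\<close>
  define b2 d2 where "b2 = a * (- b) + b" and "d2 = c * (- b) + d"
  have det2: "a * d2 - b2 * c = 1" using det by (simp add: b2_def d2_def algebra_simps)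
  have b2: "b2 = int N * (- a' * b)"
  proof -
    have "b2 = - ((a - 1) * b)" by (simp add: b2_def algebra_simps)
    then show ?thesis by (simp add: abc(1))
  qed
  have d2: "d2 = 1 + int N * (d' - c' * b)"
  proof -
    have "d2 = 1 + (d - 1) - c * b" by (simp add: d2_def algebra_simps)
    then show ?thesis by (simp only: abc(2,3)) (simp add: algebra_simps)
  qed
  have a: "a = 1 + int N * a'" using abc(1) by simp
  have \<tau>b: "Im (\<tau> + of_int b) > 0" using \<tau> by simp
  have "moebius_act \<gamma> \<tau> = (of_int a * (\<tau> + of_int b) + of_int b2) / (of_int c * (\<tau> + of_int b) + of_int d2)"
    by (simp add: moebius_act_def a_def b_def c_def d_def b2_def d2_def algebra_simps)
  also have "f \<dots> = f (\<tau> + of_int b)"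
    using wt[unfolded modular_wt_def, THEN conjunct1, unfolded inv_wt_def, rule_format, OF \<tau>b det2 a b2 abc(2) d2] by simp
  also have "\<dots> = f \<tau>" by (rule per)
  finally have "f (moebius_act \<gamma> \<tau>) = f \<tau>" .
  moreover have "Im (moebius_act \<gamma> \<tau>) > 0"
    using Im_moebius(2)[OF det \<tau>] by (simp add: moebius_act_def a_def b_def c_def d_def)
  ultimately show "g (moebius_act \<gamma> \<tau>) = g \<tau>" by (simp add: eq \<tau>)
next
  fix \<gamma> :: "int^2^2" assume "\<gamma> \<in> SL2Z"
  then have det: "\<gamma> $ 1 $ 1 * \<gamma> $ 2 $ 2 - \<gamma> $ 1 $ 2 * \<gamma> $ 2 $ 1 = 1"
    by (simp add: SL2Z_def det_2)
  obtain F where F: "cusp_mero F" "\<And>\<tau>. Im \<tau> > 0 \<Longrightarrow> f (moebius_act \<gamma> \<tau>) = F \<tau>"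
    using wt[unfolded modular_wt_def, THEN conjunct2, unfolded cusp_wt_def, rule_format, OF det]
    by (auto simp: moebius_act_def)
  have "cusp_mero (\<lambda>\<tau>. g (moebius_act \<gamma> \<tau>))"
  proof (rule cusp_mero_cong[OF F(1)])
    fix \<tau> :: complex assume \<tau>: "Im \<tau> > 0"
    have "Im (moebius_act \<gamma> \<tau>) > 0"
      using Im_moebius(2)[OF det \<tau>] by (simp add: moebius_act_def)
    then show "F \<tau> = g (moebius_act \<gamma> \<tau>)" using F(2)[OF \<tau>] by (simp add: eq)
  qed
  then obtain h G Y where h: "h > 0" "G meromorphic_on {0}"
    "\<And>\<tau>. Im \<tau> > Y \<Longrightarrow> g (moebius_act \<gamma> \<tau>) = G (ee (\<tau> / of_nat h))"
    unfolding cusp_mero_def by blast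
  have "qpow (1 / of_nat h) \<tau> = ee (\<tau> / of_nat h)" for \<tau>
    by (simp add: qpow_ee of_rat_divide)
  then show "meromorphic_at_cusp g \<gamma>"
    unfolding meromorphic_at_cusp_def using h by (intro exI[of _ h] conjI exI[of _ G] exI[of _ Y]) auto
qed

text \<open>The exponent of the Nahm sum is a quarter of the integral form in the identities; with
  \<open>84 = 4 * 21\<close> it becomes the exponent of \<open>q = ee (21 \<tau>)\<close>, and
  \<open>C\<close> contributes the integer \<open>k = 84 * C\<close>.\<close>

lemma nahm_sum_eq:
  fixes b1 b2 :: int and C :: rat
  assumes B: "4 * B1 = of_int b1" "4 * B2 = of_int b2" and C: "84 * C = of_int k"
    and sum: "((\<lambda>(i, j). q powi ((int i)^2 + 2 * (int j)^2 - 2 * int i * int j + b1 * int i + b2 * int j)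
          / (qpoch (q^4) (q^4) i * qpoch (q^4) (q^4) j)) has_sum S) (UNIV :: (nat \<times> nat) set)"
    and q: "q = ee \<tau> ^ 21"
  shows "nahm_sum (vector [vector [1/2, -1/2], vector [-1/2, 1]]) (vector [B1, B2]) C (84 * \<tau>) = ee \<tau> powi k * S"
proof -
  have q': "q = ee (21 * \<tau>)" unfolding q using ee_of_nat_mult[of 21 \<tau>] by simp
  have q4: "qpow 1 (84 * \<tau>) = q ^ 4"
    unfolding q' qpow_ee ee_of_nat_mult[symmetric] by simp
  have term_eq: "qpow (nahm_exponent (vector [vector [1/2, -1/2], vector [-1/2, 1]]) (vector [B1, B2]) C
        (vector [of_nat i, of_nat j])) (84 * \<tau>)
      = ee \<tau> powi k * q powi ((int i)^2 + 2 * (int j)^2 - 2 * int i * int j + b1 * int i + b2 * int j)" for i j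
  proof -
    define e where "e = (int i)^2 + 2 * (int j)^2 - 2 * int i * int j + b1 * int i + b2 * int j"
    have "84 * nahm_exponent (vector [vector [1/2, -1/2], vector [-1/2, 1]]) (vector [B1, B2]) C
        (vector [of_nat i, of_nat j])
      = 84 * C + 21 * ((of_nat i)^2 + 2 * (of_nat j)^2 - 2 * of_nat i * of_nat j + (4 * B1) * of_nat i + (4 * B2) * of_nat j)"
      by (simp add: nahm_exponent_def sum_2 matrix_vector_mult_def vector_2 field_simps power2_eq_square)
    also have "\<dots> = of_int (k + 21 * e)" unfolding B C e_def by simp
    finally have "of_rat (84 * nahm_exponent (vector [vector [1/2, -1/2], vector [-1/2, 1]]) (vector [B1, B2]) C
        (vector [of_nat i, of_nat j])) = (of_int (k + 21 * e) :: complex)"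
      by (simp only: of_rat_of_int_eq)
    then have "of_rat (nahm_exponent (vector [vector [1/2, -1/2], vector [-1/2, 1]]) (vector [B1, B2]) C
        (vector [of_nat i, of_nat j])) * (84 * \<tau>) = of_int k * \<tau> + of_int e * (21 * \<tau>)"
      by (simp add: of_rat_mult algebra_simps)
    then show ?thesis
      unfolding qpow_ee by (simp only: ee_add ee_of_int_mult q' e_def)
  qed
  have "nahm_sum (vector [vector [1/2, -1/2], vector [-1/2, 1]]) (vector [B1, B2]) C (84 * \<tau>)
    = (\<Sum>\<^sub>\<infinity>z. ee \<tau> powi k * (case z of (i, j) \<Rightarrow> q powi ((int i)^2 + 2 * (int j)^2 - 2 * int i * int j + b1 * int i + b2 * int j)
          / (qpoch (q^4) (q^4) i * qpoch (q^4) (q^4) j)))"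
    unfolding nahm_sum_def q4 term_eq by (intro infsum_cong) (simp add: case_prod_unfold)
  also have "\<dots> = ee \<tau> powi k * S"
    by (rule infsumI[OF has_sum_cmult_right[OF sum]])
  finally show ?thesis .
qed

theorem theorem3p7:
  shows "(\<forall>q::complex. norm q < 1 \<longrightarrow>
     ((\<lambda>(i, j). q powi ((int i)^2 + 2 * (int j)^2 - 2 * int i * int j)
          / (qpoch (q^4) (q^4) i * qpoch (q^4) (q^4) j)) has_sum
        (J 4 q ^ 3 * J 56 q * JJ 6 28 q / (J 2 q ^ 2 * J 8 q * JJ 8 56 q * JJ 24 56 q)
         + 2 * q * (J 8 q * J 56 q * JJ 8 56 q / (J 4 q ^ 2 * JJ 4 56 q))))
       (UNIV :: (nat \<times> nat) set) \<and>
     ((\<lambda>(i, j). q powi ((int i)^2 + 2 * (int j)^2 - 2 * int i * int j + 2 * int i - 2 * int j)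
          / (qpoch (q^4) (q^4) i * qpoch (q^4) (q^4) j)) has_sum
        (2 * (J 8 q * J 56 q * JJ 24 56 q / (J 4 q ^ 2 * JJ 12 56 q))
         + q * (J 4 q ^ 3 * J 28 q * JJ 10 56 q * JJ 18 56 q
                / (J 2 q ^ 2 * J 8 q * J 56 q * JJ 16 56 q * JJ 24 56 q))))
       (UNIV :: (nat \<times> nat) set) \<and>
     ((\<lambda>(i, j). q powi ((int i)^2 + 2 * (int j)^2 - 2 * int i * int j + 2 * int i)
          / (qpoch (q^4) (q^4) i * qpoch (q^4) (q^4) j)) has_sum
        (J 4 q ^ 3 * J 28 q * JJ 2 56 q * JJ 26 56 q
                / (J 2 q ^ 2 * J 8 q * J 56 q * JJ 8 56 q * JJ 16 56 q)
         + 2 * q ^ 3 * (J 8 q * J 56 q * JJ 16 56 q / (J 4 q ^ 2 * JJ 20 56 q))))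
       (UNIV :: (nat \<times> nat) set))
   \<and> (\<forall>(B, C) \<in> {(vector [0, 0], -5/84), (vector [1/2, -1/2], 1/21), (vector [1/2, 0], 1/84)}.
        modular_function (Gamma1 7056)
          (\<lambda>\<tau>. nahm_sum (vector [vector [1/2, -1/2], vector [-1/2, 1]]) B C (84 * \<tau>)))"
proof (intro conjI allI impI)
  fix q :: complex assume q: "norm q < 1"
  show "((\<lambda>(i, j). q powi ((int i)^2 + 2 * (int j)^2 - 2 * int i * int j)
          / (qpoch (q^4) (q^4) i * qpoch (q^4) (q^4) j)) has_sum
        (J 4 q ^ 3 * J 56 q * JJ 6 28 q / (J 2 q ^ 2 * J 8 q * JJ 8 56 q * JJ 24 56 q)
         + 2 * q * (J 8 q * J 56 q * JJ 8 56 q / (J 4 q ^ 2 * JJ 4 56 q))))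
       (UNIV :: (nat \<times> nat) set)"
    using identity1[OF q] unfolding rhs1_def .
  show "((\<lambda>(i, j). q powi ((int i)^2 + 2 * (int j)^2 - 2 * int i * int j + 2 * int i - 2 * int j)
          / (qpoch (q^4) (q^4) i * qpoch (q^4) (q^4) j)) has_sum
        (2 * (J 8 q * J 56 q * JJ 24 56 q / (J 4 q ^ 2 * JJ 12 56 q))
         + q * (J 4 q ^ 3 * J 28 q * JJ 10 56 q * JJ 18 56 q
                / (J 2 q ^ 2 * J 8 q * J 56 q * JJ 16 56 q * JJ 24 56 q))))
       (UNIV :: (nat \<times> nat) set)"
    using identity2[OF q] unfolding rhs2_def .
  show "((\<lambda>(i, j). q powi ((int i)^2 + 2 * (int j)^2 - 2 * int i * int j + 2 * int i)
          / (qpoch (q^4) (q^4) i * qpoch (q^4) (q^4) j)) has_sum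
        (J 4 q ^ 3 * J 28 q * JJ 2 56 q * JJ 26 56 q
                / (J 2 q ^ 2 * J 8 q * J 56 q * JJ 8 56 q * JJ 16 56 q)
         + 2 * q ^ 3 * (J 8 q * J 56 q * JJ 16 56 q / (J 4 q ^ 2 * JJ 20 56 q))))
       (UNIV :: (nat \<times> nat) set)"
    using identity3[OF q] unfolding rhs3_def .
next
  let ?A = "vector [vector [1/2, -1/2], vector [-1/2, 1]] :: rat^2^2"
  have q: "norm (ee \<tau> ^ 21) < 1" if "Im \<tau> > 0" for \<tau>
    by (rule norm_power_less_1[OF norm_ee_less_1[OF that]]) simp
  have 1: "modular_function (Gamma1 7056) (\<lambda>\<tau>. nahm_sum ?A (vector [0, 0]) (-5/84) (84 * \<tau>))"
  proof (rule modular_functionI[OF modular_wt_modF1 holomorphic_modF(1) modF_of_int(1)])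
    fix \<tau> :: complex assume "Im \<tau> > 0"
    then have "nahm_sum ?A (vector [0, 0]) (-5/84) (84 * \<tau>) = ee \<tau> powi (- 5) * rhs1 (ee \<tau> ^ 21)"
      using identity1[OF q] by (intro nahm_sum_eq[where ?b1.0 = 0 and ?b2.0 = 0]) simp_all
    also have "\<dots> = modF1 \<tau>"
      by (simp add: modF1_def ee_quarter[of \<tau>] power_int_minus power_mult[symmetric] field_simps)
    finally show "nahm_sum ?A (vector [0, 0]) (-5/84) (84 * \<tau>) = modF1 \<tau>" .
  qed
  have 2: "modular_function (Gamma1 7056) (\<lambda>\<tau>. nahm_sum ?A (vector [1/2, -1/2]) (1/21) (84 * \<tau>))"
  proof (rule modular_functionI[OF modular_wt_modF2 holomorphic_modF(2) modF_of_int(2)])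
    fix \<tau> :: complex assume "Im \<tau> > 0"
    then have "nahm_sum ?A (vector [1/2, -1/2]) (1/21) (84 * \<tau>) = ee \<tau> powi 4 * rhs2 (ee \<tau> ^ 21)"
      using identity2[OF q] by (intro nahm_sum_eq[where ?b1.0 = 2 and ?b2.0 = "- 2"]) simp_all
    also have "\<dots> = modF2 \<tau>"
      by (simp add: modF2_def ee_quarter[of \<tau>] power_mult[symmetric])
    finally show "nahm_sum ?A (vector [1/2, -1/2]) (1/21) (84 * \<tau>) = modF2 \<tau>" .
  qed
  have 3: "modular_function (Gamma1 7056) (\<lambda>\<tau>. nahm_sum ?A (vector [1/2, 0]) (1/84) (84 * \<tau>))"
  proof (rule modular_functionI[OF modular_wt_modF3 holomorphic_modF(3) modF_of_int(3)])
    fix \<tau> :: complex assume "Im \<tau> > 0"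
    then have "nahm_sum ?A (vector [1/2, 0]) (1/84) (84 * \<tau>) = ee \<tau> powi 1 * rhs3 (ee \<tau> ^ 21)"
      using identity3[OF q] by (intro nahm_sum_eq[where ?b1.0 = 2 and ?b2.0 = 0]) simp_all
    also have "\<dots> = modF3 \<tau>"
      by (simp add: modF3_def ee_quarter[of \<tau>])
    finally show "nahm_sum ?A (vector [1/2, 0]) (1/84) (84 * \<tau>) = modF3 \<tau>" .
  qed
  show "\<forall>(B, C) \<in> {(vector [0, 0], -5/84), (vector [1/2, -1/2], 1/21), (vector [1/2, 0], 1/84)}.
        modular_function (Gamma1 7056) (\<lambda>\<tau>. nahm_sum ?A B C (84 * \<tau>))"
    using 1 2 3 by simp
qed

end
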